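(* Let $\pi:Y\to X$ be a fibered manifold with $\dim X=n$, let $\rho$ be an $n$-form on $J^{r-1}Y$ and let $h\rho$ be the associated Lagrangian on $J^rY$. Let $\Xi_1,\Xi_2$ be two $\pi$-vertical vector fields on $Y$. 1. Suppose that $\Xi_2$ is a symmetry of the first variation of $h\rho$ generated by $\Xi_1$, i.e. $L_{J^r\Xi_2}L_{J^r\Xi_1}h\rho=0$, and that $\Xi_2\rfloor\mathcal J_{\Xi_1}(h\rho)=0$. Then $$d_H\epsilon_{\Xi_2}\big(L_{J^r\Xi_1}h\rho\big)=0.$$ 2. Suppose that $\Xi_1$ and $\Xi_2$ are Jacobi fields, i.e. $\mathcal J_{\Xi_1}(h\rho)=0$ and $\mathcal J_{\Xi_2}(h\rho)=0$. Then, along critical sections of $h\rho$, $$d_H\epsilon_{\Xi_2}\big(\Xi_1\rfloor E_n(h\rho)\big)=0.$$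
   Context: Jets. $\pi:Y\to X$ is a fibered manifold (surjective submersion), $\dim X=n$, $\dim Y=n+m$, with fibered coordinates $(x^i,y^\sigma)$; $J^kY$ is the $k$-th jet space with induced coordinates $(x^i,y^\sigma_I)$, $|I|\le k$; $ds=dx^1\wedge\dots\wedge dx^n$; $d_i=\partial_{x^i}+\sum_I y^\sigma_{Ii}\,\partial/\partial y^\sigma_I$ is the total derivative and $d_I=d_{i_1}\cdots d_{i_s}$ for $I=(i_1,\dots,i_s)$. Sums run over all multi-indices, the operators $\partial/\partial y^\sigma_I$ being multiplied by the usual combinatorial factors that compensate for repetitions. All identities are understood up to pull-back by the jet projections, and vector fields on $Y$ are prolonged to whatever jet order is needed; $J^k\Xi$ (or $J\Xi$) denotes the prolongation. Contact structure. $\omega^\sigma_J=dy^\sigma_J-y^\sigma_{Ji}dx^i$. Every $q$-form $\rho$ on $J^kY$ decomposes uniquely, after pull-back to $J^{k+1}Y$, as $\sum_{i=0}^q p_i\rho$, where $p_i\rho$ is generated by products containing exactly $i$ factors $\omega^\sigma_J$; $h\rho:=p_0\rho$. A Lagrangian is a horizontal $n$-form on some $J^kY$; for an $n$-form $\rho$, $h\rho$ is the Lagrangian associated with $\rho$. The horizontal differential is $d_H\rho=\sum_i p_i d p_i\rho$. Interior Euler operator. For an $(n+k)$-form $\rho$, $k\ge1$, $\mathcal I(\rho)=\frac1k\,\omega^\sigma\wedge\sum_{|I|\ge 0}(-1)^{|I|}d_I\big(\frac{\partial}{\partial y^\sigma_I}\rfloor p_k\rho\big)$, where $d_I$ acts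 on forms as iterated Lie derivative along the total derivatives. The residual operator $\mathcal R$ is a local operator such that $p_k\rho=\mathcal I(\rho)+p_k d p_k\mathcal R(\rho)$, with $\mathcal R(\rho)$ a local $(n+k-1)$-form satisfying $p_{k-1}\mathcal R(\rho)=0$. For a Lagrangian $\lambda$, $E_n(\lambda):=\mathcal I(d\lambda)=E_\sigma(\lambda)\,\omega^\sigma\wedge ds$ is its Euler--Lagrange form; a critical section (extremal) is a local section $\gamma$ of $\pi$ along whose jet prolongation all $E_\sigma(\lambda)$ vanish. Noether current. For a Lagrangian $\lambda$ and a vertical vector field $\Xi$ on $Y$, $\epsilon_\Xi(\lambda):=-J\Xi\rfloor p_1\mathcal R(d\lambda)$. Jacobi morphism. For a vertical vector field $\Xi$ on $Y$, $\mathcal J_\Xi(\lambda):=E_n(\Xi\rfloor E_n(\lambda))$. A Jacobi field for $\lambda$ is a vertical vector field $\Xi$ with $\mathcal J_\Xi(\lambda)=0$. Symmetries. A vector field $\Xi$ is a symmetry of a Lagrangian $\lambda$ if $L_{J\Xi}\lambda=0$; the first variation of $\lambda$ generated by $\Xi_1$ is the Lagrangian $L_{J\Xi_1}\lambda$. "Along critical sections $d_H\epsilon=0$" means that $d_H\epsilon$ pulled back by the jet prolongation of any critical section vanishes. *)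

theory Defs
  imports "HOL-Analysis.Analysis" "HOL-Library.Multiset" "HOL-Library.Groups_Big_Fun"
begin

section \<open>Smooth manifolds and fibered manifolds\<close>

primrec cont_diff_on :: "nat \<Rightarrow> 'a::euclidean_space set \<Rightarrow> ('a \<Rightarrow> 'b::real_normed_vector) \<Rightarrow> bool" where
  "cont_diff_on 0 S f \<longleftrightarrow> continuous_on S f"
| "cont_diff_on (Suc k) S f \<longleftrightarrow> (\<forall>u\<in>S. f differentiable (at u)) \<and>
     (\<forall>v. cont_diff_on k S (\<lambda>u. frechet_derivative f (at u) v))"

text \<open>\<open>C\<^sup>\<infinity>\<close>, for open sets only.\<close>

definition smooth_on :: "'a::euclidean_space set \<Rightarrow> ('a \<Rightarrow> 'b::real_normed_vector) \<Rightarrow> bool" where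
  "smooth_on S f \<longleftrightarrow> (\<forall>k. cont_diff_on k S f)"

type_synonym ('p, 'e) chart = "'p set \<times> ('p \<Rightarrow> 'e)"

definition is_chart :: "('p::topological_space, 'e::euclidean_space) chart \<Rightarrow> bool" where
  "is_chart = (\<lambda>(U, \<phi>). open U \<and> open (\<phi> ` U) \<and> (\<exists>\<theta>. homeomorphism U (\<phi> ` U) \<phi> \<theta>))"

definition compatible_charts :: "('p, 'e::euclidean_space) chart \<Rightarrow> ('p, 'e) chart \<Rightarrow> bool" where
  "compatible_charts = (\<lambda>(U, \<phi>) (U', \<phi>').
     smooth_on (\<phi> ` (U \<inter> U')) (\<phi>' \<circ> inv_into U \<phi>) \<and>
     smooth_on (\<phi>' ` (U \<inter> U')) (\<phi> \<circ> inv_into U' \<phi>'))"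

definition smooth_atlas :: "('p::topological_space, 'e::euclidean_space) chart set \<Rightarrow> bool" where
  "smooth_atlas A \<longleftrightarrow> (\<forall>c\<in>A. is_chart c) \<and> (\<Union>c\<in>A. fst c) = UNIV \<and>
     (\<forall>c\<in>A. \<forall>c'\<in>A. compatible_charts c c')"

definition maximal_atlas :: "('p::topological_space, 'e::euclidean_space) chart set \<Rightarrow> ('p, 'e) chart set" where
  "maximal_atlas A = {c. is_chart c \<and> (\<forall>c'\<in>A. compatible_charts c c')}"

text \<open>
  The dimensions are \<open>n = CARD('n)\<close> and \<open>m = CARD('m)\<close>. The order on \<open>'n\<close> is that
  of the index set \<open>{1, \<dots>, n}\<close>.
\<close>

type_synonym 'n base_space = "real ^ 'n"
type_synonym ('n, 'm) total_space = "(real ^ 'n) \<times> (real ^ 'm)"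

record ('x, 'y, 'n, 'm) fibration =
  base_atlas :: "('x, 'n base_space) chart set"
  total_atlas :: "('y, ('n, 'm) total_space) chart set"
  proj :: "'y \<Rightarrow> 'x"

definition fibered_manifold ::
  "('x::{second_countable_topology, t2_space}, 'y::{second_countable_topology, t2_space},
    'n::{finite, linorder}, 'm::finite) fibration \<Rightarrow> bool" where
  "fibered_manifold F \<longleftrightarrow>
     smooth_atlas (base_atlas F) \<and> smooth_atlas (total_atlas F) \<and>
     continuous_on UNIV (proj F) \<and> surj (proj F) \<and>
     (\<forall>(V, \<psi>)\<in>total_atlas F. \<forall>(U, \<phi>)\<in>base_atlas F.
        smooth_on (\<psi> ` (V \<inter> proj F -` U)) (\<phi> \<circ> proj F \<circ> inv_into V \<psi>) \<and>
        (\<forall>u\<in>\<psi> ` (V \<inter> proj F -` U).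
           surj (frechet_derivative (\<phi> \<circ> proj F \<circ> inv_into V \<psi>) (at u))))"

text \<open>A fibered chart is a chart on the total space together with the chart it induces on the base.\<close>

type_synonym ('x, 'y, 'n, 'm) fchart = "('y, ('n, 'm) total_space) chart \<times> ('x, 'n base_space) chart"

definition fibered_charts ::
  "('x::{second_countable_topology, t2_space}, 'y::{second_countable_topology, t2_space},
    'n::{finite, linorder}, 'm::finite) fibration \<Rightarrow> ('x, 'y, 'n, 'm) fchart set" where
  "fibered_charts F = {((V, \<psi>), (U, \<phi>)).
     (V, \<psi>) \<in> maximal_atlas (total_atlas F) \<and> (U, \<phi>) \<in> maximal_atlas (base_atlas F) \<and>
     U = proj F ` V \<and> (\<forall>p\<in>V. fst (\<psi> p) = \<phi> (proj F p))}"

definition local_section ::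
  "('x::{second_countable_topology, t2_space}, 'y::{second_countable_topology, t2_space},
    'n::{finite, linorder}, 'm::finite) fibration \<Rightarrow> 'x set \<Rightarrow> ('x \<Rightarrow> 'y) \<Rightarrow> bool" where
  "local_section F W \<gamma> \<longleftrightarrow> open W \<and> continuous_on W \<gamma> \<and> (\<forall>x\<in>W. proj F (\<gamma> x) = x) \<and>
     (\<forall>((V, \<psi>), (U, \<phi>))\<in>fibered_charts F.
        smooth_on (\<phi> ` {x\<in>W. \<gamma> x \<in> V}) (\<psi> \<circ> \<gamma> \<circ> inv_into U \<phi>))"

text \<open>
  A vector field is given by its components in all fibered charts, related by the
  transformation law of tangent vectors.
\<close>

type_synonym ('x, 'y, 'n, 'm) field_components =
  "('x, 'y, 'n, 'm) fchart \<Rightarrow> ('n, 'm) total_space \<Rightarrow> ('n, 'm) total_space"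

definition vector_field ::
  "('x::{second_countable_topology, t2_space}, 'y::{second_countable_topology, t2_space},
    'n::{finite, linorder}, 'm::finite) fibration \<Rightarrow> ('x, 'y, 'n, 'm) field_components \<Rightarrow> bool" where
  "vector_field F \<Xi> \<longleftrightarrow>
     (\<forall>((V, \<psi>), c)\<in>fibered_charts F. smooth_on (\<psi> ` V) (\<Xi> ((V, \<psi>), c))) \<and>
     (\<forall>((V, \<psi>), c)\<in>fibered_charts F. \<forall>((V', \<psi>'), c')\<in>fibered_charts F. \<forall>p\<in>V \<inter> V'.
        \<Xi> ((V', \<psi>'), c') (\<psi>' p) =
          frechet_derivative (\<psi>' \<circ> inv_into V \<psi>) (at (\<psi> p)) (\<Xi> ((V, \<psi>), c) (\<psi> p)))"

definition vertical_field ::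
  "('x::{second_countable_topology, t2_space}, 'y::{second_countable_topology, t2_space},
    'n::{finite, linorder}, 'm::finite) fibration \<Rightarrow> ('x, 'y, 'n, 'm) field_components \<Rightarrow> bool" where
  "vertical_field F \<Xi> \<longleftrightarrow> vector_field F \<Xi> \<and>
     (\<forall>((V, \<psi>), c)\<in>fibered_charts F. \<forall>u\<in>\<psi> ` V. fst (\<Xi> ((V, \<psi>), c) u) = 0)"

section \<open>Jet coordinates\<close>

text \<open>
  Multi-indices are unordered (multisets), so each coordinate \<open>y\<^sup>\<sigma>\<^sub>I\<close> occurs only once. A sum over
  multisets equals the sum over ordered multi-indices \<open>(i\<^sub>1, \<dots>, i\<^sub>s)\<close> in which
  \<open>\<partial>/\<partial>y\<^sup>\<sigma>\<^sub>I\<close> carries the factor compensating for repetitions.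

  The jet spaces of all orders are handled in the coordinates of the infinite jet space; an
  object lives on the \<open>k\<close>-jets if it involves only coordinates of order at most \<open>k\<close>. Pull-back
  by the jet projections thereby becomes the identity.
\<close>

datatype ('n, 'm) coord = X 'n | Y 'm "'n multiset"

type_synonym ('n, 'm) jet = "('n, 'm) coord \<Rightarrow> real"
type_synonym ('n, 'm) jvec = "('n, 'm) coord \<Rightarrow> real"

fun jet_order :: "('n, 'm) coord \<Rightarrow> nat" where
  "jet_order (X i) = 0"
| "jet_order (Y \<sigma> I) = size I"

definition base_fibre :: "('n::finite, 'm::finite) jet \<Rightarrow> ('n, 'm) total_space" where
  "base_fibre z = (\<chi> i. z (X i), \<chi> \<sigma>. z (Y \<sigma> {#}))"

definition jet_domain :: "('x, 'y, 'n::finite, 'm::finite) fchart \<Rightarrow> ('n, 'm) jet set" where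
  "jet_domain = (\<lambda>((V, \<psi>), c). {z. base_fibre z \<in> \<psi> ` V})"

definition multi_partial :: "'n::{finite, linorder} multiset \<Rightarrow> ('n base_space \<Rightarrow> real) \<Rightarrow> 'n base_space \<Rightarrow> real" where
  "multi_partial I f =
     foldr (\<lambda>i g u. frechet_derivative g (at u) (axis i 1)) (sorted_list_of_multiset I) f"

fun jet_coord :: "('x, 'y, 'n::{finite, linorder}, 'm::finite) fchart \<Rightarrow> ('x \<Rightarrow> 'y) \<Rightarrow> 'x \<Rightarrow> ('n, 'm) jet" where
  "jet_coord ((V, \<psi>), (U, \<phi>)) \<gamma> x (X i) = \<phi> x $ i"
| "jet_coord ((V, \<psi>), (U, \<phi>)) \<gamma> x (Y \<sigma> I) =
     multi_partial I (\<lambda>u. snd (\<psi> (\<gamma> (inv_into U \<phi> u))) $ \<sigma>) (\<phi> x)"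

text \<open>
  Transition functions of the induced charts on the jet spaces: the coordinate \<open>a\<close> in the new
  chart is read off from any section representing \<open>z\<close> up to the order of \<open>a\<close>.
\<close>

definition jet_transition ::
  "('x::{second_countable_topology, t2_space}, 'y::{second_countable_topology, t2_space},
    'n::{finite, linorder}, 'm::finite) fibration \<Rightarrow>
   ('x, 'y, 'n, 'm) fchart \<Rightarrow> ('x, 'y, 'n, 'm) fchart \<Rightarrow> ('n, 'm) jet \<Rightarrow> ('n, 'm) jet" where
  "jet_transition F C C' z a =
     (case (SOME (\<gamma>, x). \<exists>W. local_section F W \<gamma> \<and> x \<in> W \<and> \<gamma> x \<in> fst (fst C) \<and>
                            (\<forall>b. jet_order b \<le> jet_order a \<longrightarrow> jet_coord C \<gamma> x b = z b))
      of (\<gamma>, x) \<Rightarrow> jet_coord C' \<gamma> x a)"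

section \<open>Functions and differential forms in jet coordinates\<close>

definition coord_partial :: "('n, 'm) coord \<Rightarrow> (('n, 'm) jet \<Rightarrow> real) \<Rightarrow> ('n, 'm) jet \<Rightarrow> real" where
  "coord_partial a f z = deriv (\<lambda>t. f (z(a := t))) (z a)"

definition jet_function :: "('n, 'm) jet set \<Rightarrow> nat \<Rightarrow> (('n, 'm) jet \<Rightarrow> real) \<Rightarrow> bool" where
  "jet_function U k f \<longleftrightarrow>
     (\<forall>z\<in>U. \<forall>z'\<in>U. (\<forall>a. jet_order a \<le> k \<longrightarrow> z a = z' a) \<longrightarrow> f z = f z') \<and>
     (\<forall>as. continuous_on U (foldr coord_partial as f) \<and>
        (\<forall>a. \<forall>z\<in>U. (\<lambda>t. foldr coord_partial as f (z(a := t))) differentiable (at (z a))))"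

definition dir_deriv :: "('n, 'm) jvec \<Rightarrow> (('n, 'm) jet \<Rightarrow> real) \<Rightarrow> ('n, 'm) jet \<Rightarrow> real" where
  "dir_deriv v f z = deriv (\<lambda>t. f (\<lambda>a. z a + t * v a)) 0"

text \<open>
  A form assigns to a point and a list of tangent vectors a number; a \<open>q\<close>-form is nonzero only
  on lists of length \<open>q\<close>. Wedge products and exterior derivatives follow the convention
  \<open>(\<alpha> \<and> \<beta>)(v, w) = \<alpha>(v) \<beta>(w) - \<alpha>(w) \<beta>(v)\<close> for 1-forms.
\<close>

type_synonym ('n, 'm) jform = "('n, 'm) jet \<Rightarrow> ('n, 'm) jvec list \<Rightarrow> real"

definition is_jform :: "('n, 'm) jet set \<Rightarrow> nat \<Rightarrow> nat \<Rightarrow> ('n, 'm) jform \<Rightarrow> bool" where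
  "is_jform U k q \<rho> \<longleftrightarrow>
     (\<forall>z\<in>U. \<forall>vs. length vs \<noteq> q \<longrightarrow> \<rho> z vs = 0) \<and>
     (\<forall>z\<in>U. \<forall>us ws v w s t. \<rho> z (us @ (\<lambda>a. s * v a + t * w a) # ws) =
        s * \<rho> z (us @ v # ws) + t * \<rho> z (us @ w # ws)) \<and>
     (\<forall>z\<in>U. \<forall>vs. \<not> distinct vs \<longrightarrow> \<rho> z vs = 0) \<and>
     (\<forall>z\<in>U. \<forall>vs. \<rho> z (map (\<lambda>v a. if jet_order a \<le> k then v a else 0) vs) = \<rho> z vs) \<and>
     (\<forall>vs. jet_function U k (\<lambda>z. \<rho> z vs))"

definition vanishes_on :: "('n, 'm) jet set \<Rightarrow> ('n, 'm) jform \<Rightarrow> bool" where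
  "vanishes_on U \<rho> \<longleftrightarrow> (\<forall>z\<in>U. \<forall>vs. \<rho> z vs = 0)"

text \<open>
  A \<open>q\<close>-form on the \<open>k\<close>-th jet space is given by its representatives in all fibered charts,
  which are mapped to each other by pull-back along the jet transition functions.
\<close>

definition form_on_jets ::
  "('x::{second_countable_topology, t2_space}, 'y::{second_countable_topology, t2_space},
    'n::{finite, linorder}, 'm::finite) fibration \<Rightarrow> nat \<Rightarrow> nat \<Rightarrow>
   (('x, 'y, 'n, 'm) fchart \<Rightarrow> ('n, 'm) jform) \<Rightarrow> bool" where
  "form_on_jets F k q \<rho> \<longleftrightarrow>
     (\<forall>C\<in>fibered_charts F. is_jform (jet_domain C) k q (\<rho> C)) \<and>
     (\<forall>C\<in>fibered_charts F. \<forall>C'\<in>fibered_charts F. \<forall>z vs.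
        base_fibre z \<in> snd (fst C) ` (fst (fst C) \<inter> fst (fst C')) \<longrightarrow>
        \<rho> C z vs = \<rho> C' (jet_transition F C C' z)
          (map (\<lambda>v a. dir_deriv v (\<lambda>z. jet_transition F C C' z a) z) vs))"

definition contract :: "(('n, 'm) jet \<Rightarrow> ('n, 'm) jvec) \<Rightarrow> ('n, 'm) jform \<Rightarrow> ('n, 'm) jform" where
  "contract V \<rho> z vs = \<rho> z (V z # vs)"

definition wedge1 :: "(('n, 'm) jet \<Rightarrow> ('n, 'm) jvec \<Rightarrow> real) \<Rightarrow> ('n, 'm) jform \<Rightarrow> ('n, 'm) jform" where
  "wedge1 \<alpha> \<rho> z vs =
     (\<Sum>j<length vs. (-1) ^ j * \<alpha> z (vs ! j) * \<rho> z (take j vs @ drop (Suc j) vs))"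

text \<open>The argument vectors are extended as constant fields, so no bracket terms occur.\<close>

definition ext_deriv :: "('n, 'm) jform \<Rightarrow> ('n, 'm) jform" where
  "ext_deriv \<rho> z vs =
     (\<Sum>j<length vs. (-1) ^ j * dir_deriv (vs ! j) (\<lambda>z. \<rho> z (take j vs @ drop (Suc j) vs)) z)"

text \<open>
  Cartan's formula; it also applies to the total derivatives, which raise the jet order and have no flow.
\<close>

definition lie_deriv :: "(('n, 'm) jet \<Rightarrow> ('n, 'm) jvec) \<Rightarrow> ('n, 'm) jform \<Rightarrow> ('n, 'm) jform" where
  "lie_deriv V \<rho> z vs = contract V (ext_deriv \<rho>) z vs + ext_deriv (contract V \<rho>) z vs"

section \<open>Contact structure\<close>

definition unit_vec :: "('n, 'm) coord \<Rightarrow> ('n, 'm) jvec" where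
  "unit_vec a b = (if b = a then 1 else 0)"

fun total_vec :: "'n \<Rightarrow> ('n, 'm) jet \<Rightarrow> ('n, 'm) jvec" where
  "total_vec i z (X j) = (if j = i then 1 else 0)"
| "total_vec i z (Y \<sigma> I) = z (Y \<sigma> (add_mset i I))"

definition total_deriv :: "'n::linorder multiset \<Rightarrow> (('n, 'm) jet \<Rightarrow> real) \<Rightarrow> ('n, 'm) jet \<Rightarrow> real" where
  "total_deriv I f =
     foldr (\<lambda>i g z. dir_deriv (total_vec i z) g z) (sorted_list_of_multiset I) f"

definition total_lie :: "'n::linorder multiset \<Rightarrow> ('n, 'm) jform \<Rightarrow> ('n, 'm) jform" where
  "total_lie I \<rho> = foldr (\<lambda>i. lie_deriv (total_vec i)) (sorted_list_of_multiset I) \<rho>"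

definition omega :: "'m \<Rightarrow> 'n::finite multiset \<Rightarrow> ('n, 'm) jet \<Rightarrow> ('n, 'm) jvec \<Rightarrow> real" where
  "omega \<sigma> J z v = v (Y \<sigma> J) - (\<Sum>i\<in>UNIV. z (Y \<sigma> (add_mset i J)) * v (X i))"

text \<open>
  In the coframe \<open>dx\<^sup>i, \<omega>\<^sup>\<sigma>\<^sub>J\<close>, which is dual to the frame \<open>d\<^sub>i, \<partial>/\<partial>y\<^sup>\<sigma>\<^sub>J\<close>, a vector splits into
  \<open>dx\<^sup>i(v) d\<^sub>i\<close> and \<open>\<omega>\<^sup>\<sigma>\<^sub>J(v) \<partial>/\<partial>y\<^sup>\<sigma>\<^sub>J\<close> (sums over repeated indices). Inserting these expansions, the terms of a form
  with exactly \<open>i\<close> factors \<open>\<omega>\<^sup>\<sigma>\<^sub>J\<close> are those in which exactly \<open>i\<close> arguments are replaced by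
  their contact part; see \<open>contact_part_frame\<close> and \<open>sum_contact_part\<close> below.
\<close>

definition hor_part :: "('n::finite, 'm) jet \<Rightarrow> ('n, 'm) jvec \<Rightarrow> ('n, 'm) jvec" where
  "hor_part z v a = (\<Sum>i\<in>UNIV. v (X i) * total_vec i z a)"

fun con_part :: "('n::finite, 'm) jet \<Rightarrow> ('n, 'm) jvec \<Rightarrow> ('n, 'm) jvec" where
  "con_part z v (X i) = 0"
| "con_part z v (Y \<sigma> J) = omega \<sigma> J z v"

definition contact_part :: "nat \<Rightarrow> ('n::finite, 'm) jform \<Rightarrow> ('n, 'm) jform" where
  "contact_part i \<rho> z vs =
     (\<Sum>S | S \<subseteq> {..<length vs} \<and> card S = i.
        \<rho> z (map (\<lambda>j. if j \<in> S then con_part z (vs ! j) else hor_part z (vs ! j)) [0..<length vs]))"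

lemma hor_con_part: "hor_part z v a + con_part z v a = v a"
proof (cases a)
  case (X j)
  then show ?thesis
    by (simp add: hor_part_def if_distrib cong: if_cong)
next
  case (Y \<sigma> J)
  then show ?thesis
    by (simp add: hor_part_def omega_def mult.commute)
qed

lemma sum_contact_part:
  assumes lin: "\<And>us ws v w s t. \<rho> z (us @ (\<lambda>a. s * v a + t * w a) # ws) =
    s * \<rho> z (us @ v # ws) + t * \<rho> z (us @ w # ws)"
  shows "(\<Sum>i\<le>length vs. contact_part i \<rho> z vs) = \<rho> z vs"
proof -
  let ?part = "\<lambda>S vs j. if j \<in> S then con_part z (vs ! j) else hor_part z (vs ! j)"
  have expand: "(\<Sum>S\<in>Pow {..<length vs}. \<rho> z (map (?part S vs) [0..<length vs] @ ws)) = \<rho> z (vs @ ws)"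
    for ws
  proof (induction vs arbitrary: ws rule: rev_induct)
    case Nil
    then show ?case by simp
  next
    case (snoc v vs)
    let ?n = "length vs"
    let ?vs = "vs @ [v]"
    have map_eq: "map (?part S ?vs) [0..<?n] = map (?part (S - {?n}) vs) [0..<?n]" for S
      by (auto simp: nth_append)
    have disj: "Pow {..<?n} \<inter> insert ?n ` Pow {..<?n} = {}"
      by auto
    have inj: "inj_on (insert ?n) (Pow {..<?n})"
      by (rule inj_onI) (metis PowD insert_ident lessThan_iff less_irrefl subsetD)
    have "(\<Sum>S\<in>Pow {..<length ?vs}. \<rho> z (map (?part S ?vs) [0..<length ?vs] @ ws)) =
        (\<Sum>S\<in>Pow {..<?n}. \<rho> z (map (?part S ?vs) [0..<Suc ?n] @ ws)) +
        (\<Sum>S\<in>Pow {..<?n}. \<rho> z (map (?part (insert ?n S) ?vs) [0..<Suc ?n] @ ws))"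
      by (simp only: length_append_singleton lessThan_Suc Pow_insert)
        (simp only: sum.union_disjoint[OF _ _ disj] finite_Pow_iff finite_lessThan finite_imageI
          sum.reindex[OF inj] o_def)
    also have "\<dots> = (\<Sum>S\<in>Pow {..<?n}. \<rho> z (map (?part S vs) [0..<?n] @ hor_part z v # ws)) +
        (\<Sum>S\<in>Pow {..<?n}. \<rho> z (map (?part S vs) [0..<?n] @ con_part z v # ws))"
    proof -
      have "\<rho> z (map (?part S ?vs) [0..<Suc ?n] @ ws) =
          \<rho> z (map (?part S vs) [0..<?n] @ hor_part z v # ws)"
        and "\<rho> z (map (?part (insert ?n S) ?vs) [0..<Suc ?n] @ ws) =
          \<rho> z (map (?part S vs) [0..<?n] @ con_part z v # ws)" if "S \<in> Pow {..<?n}" for S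
      proof -
        have n: "?n \<notin> S" using that by auto
        show "\<rho> z (map (?part S ?vs) [0..<Suc ?n] @ ws) =
          \<rho> z (map (?part S vs) [0..<?n] @ hor_part z v # ws)"
          using n map_eq[of S] by (simp del: map_eq_conv)
        show "\<rho> z (map (?part (insert ?n S) ?vs) [0..<Suc ?n] @ ws) =
          \<rho> z (map (?part S vs) [0..<?n] @ con_part z v # ws)"
          using n map_eq[of "insert ?n S"] by (simp del: map_eq_conv)
      qed
      then show ?thesis by (intro arg_cong2[where f = "(+)"] sum.cong refl)
    qed
    also have "\<dots> = \<rho> z (vs @ hor_part z v # ws) + \<rho> z (vs @ con_part z v # ws)"
      using snoc.IH by simp
    also have "\<dots> = \<rho> z (vs @ (\<lambda>a. 1 * hor_part z v a + 1 * con_part z v a) # ws)"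
      by (simp only: lin)
    finally show ?case
      by (simp add: hor_con_part)
  qed
  have "(\<Sum>i\<le>length vs. contact_part i \<rho> z vs) =
      (\<Sum>i\<le>length vs. \<Sum>S | S \<in> Pow {..<length vs} \<and> card S = i. \<rho> z (map (?part S vs) [0..<length vs]))"
    by (simp add: contact_part_def)
  also have "\<dots> = (\<Sum>S\<in>Pow {..<length vs}. \<rho> z (map (?part S vs) [0..<length vs]))"
    by (rule sum.group) (auto dest: card_mono[rotated])
  finally show ?thesis
    using expand[of "[]"] by simp
qed

fun frame :: "('n, 'm) jet \<Rightarrow> ('n, 'm) coord \<Rightarrow> ('n, 'm) jvec" where
  "frame z (X i) = total_vec i z"
| "frame z (Y \<sigma> I) = unit_vec (Y \<sigma> I)"

lemma contact_part_frame:
  assumes lin: "\<And>us ws v w s t. \<rho> z (us @ (\<lambda>a. s * v a + t * w a) # ws) =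
    s * \<rho> z (us @ v # ws) + t * \<rho> z (us @ w # ws)"
  shows "contact_part i \<rho> z (map (frame z) as) =
    (if card {j. j < length as \<and> (\<exists>\<sigma> I. as ! j = Y \<sigma> I)} = i then \<rho> z (map (frame z) as) else 0)"
proof -
  let ?T = "{j. j < length as \<and> (\<exists>\<sigma> I. as ! j = Y \<sigma> I)}"
  let ?vs = "map (frame z) as"
  let ?g = "\<lambda>S j. if j \<in> S then con_part z (?vs ! j) else hor_part z (?vs ! j)"
  let ?f = "\<lambda>S. \<rho> z (map (?g S) [0..<length ?vs])"
  have zero: "\<rho> z ws = 0" if "j < length ws" "ws ! j = (\<lambda>a. 0)" for j ws
  proof -
    have "ws = take j ws @ (\<lambda>a. 0) # drop (Suc j) ws"
      using that id_take_nth_drop by metis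
    then show ?thesis
      using lin[of "take j ws" 0 "\<lambda>a. 0" 0 "\<lambda>a. 0" "drop (Suc j) ws"] by simp
  qed
  have conX: "con_part z (total_vec i z) = (\<lambda>a. 0)" for i
  proof
    fix a show "con_part z (total_vec i z) a = 0"
      by (cases a) (simp_all add: omega_def if_distrib cong: if_cong)
  qed
  have horX: "hor_part z (total_vec i z) = total_vec i z" for i
  proof
    fix a show "hor_part z (total_vec i z) a = total_vec i z a"
      using hor_con_part[of z "total_vec i z" a] by (simp add: conX)
  qed
  have horY: "hor_part z (unit_vec (Y \<sigma> I)) = (\<lambda>a. 0)" for \<sigma> I
    by (simp add: hor_part_def unit_vec_def fun_eq_iff)
  have conY: "con_part z (unit_vec (Y \<sigma> I)) = unit_vec (Y \<sigma> I)" for \<sigma> I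
  proof
    fix a show "con_part z (unit_vec (Y \<sigma> I)) a = unit_vec (Y \<sigma> I) a"
      using hor_con_part[of z "unit_vec (Y \<sigma> I)" a] by (simp add: horY)
  qed
  have other: "?f S = 0" if "S \<subseteq> {..<length as}" "S \<noteq> ?T" for S
  proof -
    from \<open>S \<noteq> ?T\<close> obtain j where "(j \<in> S) \<noteq> (j \<in> ?T)"
      by blast
    with \<open>S \<subseteq> {..<length as}\<close> have j: "j < length as" "(j \<in> S) \<noteq> (\<exists>\<sigma> I. as ! j = Y \<sigma> I)"
      by auto
    have "?g S j = (\<lambda>a. 0)"
      using j by (cases "as ! j") (auto simp: conX horY)
    then show ?thesis
      using j by (intro zero[of j]) auto
  qed
  have main: "?f ?T = \<rho> z ?vs"
  proof -
    have g: "?g ?T j = frame z (as ! j)" if "j < length as" for j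
      using that by (cases "as ! j") (auto simp: horX conY)
    have "map (?g ?T) [0..<length ?vs] = map (\<lambda>j. frame z (as ! j)) [0..<length ?vs]"
      by (rule map_cong[OF refl], rule g) simp
    also have "\<dots> = ?vs"
      by (rule nth_equalityI) auto
    finally have "map (?g ?T) [0..<length ?vs] = ?vs" .
    then show ?thesis by simp
  qed
  have "contact_part i \<rho> z ?vs = (\<Sum>S | S \<subseteq> {..<length as} \<and> card S = i. ?f S)"
    by (simp add: contact_part_def)
  also have "\<dots> = (\<Sum>S | S \<subseteq> {..<length as} \<and> card S = i. if S = ?T then \<rho> z ?vs else 0)"
    by (rule sum.cong) (use other main in auto)
  also have "\<dots> = (if card ?T = i then \<rho> z ?vs else 0)"
    by (subst sum.delta) auto
  finally show ?thesis .
qed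

definition horizontalization :: "('n::finite, 'm) jform \<Rightarrow> ('n, 'm) jform" where
  "horizontalization \<rho> = contact_part 0 \<rho>"

text \<open>Contact parts of degree above that of the form vanish, so the sum may include one surplus term.\<close>

definition hor_deriv :: "('n::finite, 'm) jform \<Rightarrow> ('n, 'm) jform" where
  "hor_deriv \<rho> z vs = (\<Sum>i\<le>length vs. contact_part i (ext_deriv (contact_part i \<rho>)) z vs)"

section \<open>Variational operators\<close>

text \<open>
  Prolongation of a vertical field; the base components of \<open>\<xi>\<close> are zero and do not enter.
\<close>

fun prolong :: "(('n, 'm) total_space \<Rightarrow> ('n, 'm) total_space) \<Rightarrow>
    ('n::{finite, linorder}, 'm::finite) jet \<Rightarrow> ('n, 'm) jvec" where
  "prolong \<xi> z (X i) = 0"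
| "prolong \<xi> z (Y \<sigma> I) = total_deriv I (\<lambda>z. snd (\<xi> (base_fibre z)) $ \<sigma>) z"

text \<open>
  \<open>Sum_any\<close> sums over the finite support: for a form of finite order only finitely many multi-indices contribute.
\<close>

definition interior_euler :: "nat \<Rightarrow> ('n::{finite, linorder}, 'm::finite) jform \<Rightarrow> ('n, 'm) jform" where
  "interior_euler k \<rho> z vs = (1 / real k) * (\<Sum>\<sigma>\<in>UNIV. wedge1 (omega \<sigma> {#})
     (\<lambda>z ws. Sum_any (\<lambda>I. (-1) ^ size I *
        total_lie I (contract (\<lambda>_. unit_vec (Y \<sigma> I)) (contact_part k \<rho>)) z ws)) z vs)"

definition euler_lagrange :: "('n::{finite, linorder}, 'm::finite) jform \<Rightarrow> ('n, 'm) jform" where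
  "euler_lagrange \<Lambda> = interior_euler 1 (ext_deriv \<Lambda>)"

text \<open>The coefficient of \<open>\<omega>\<^sup>\<sigma> \<and> ds\<close>, by evaluation on the dual frame.\<close>

definition euler_coeff :: "'m \<Rightarrow> ('n::{finite, linorder}, 'm::finite) jform \<Rightarrow> ('n, 'm) jet \<Rightarrow> real" where
  "euler_coeff \<sigma> \<Lambda> z = euler_lagrange \<Lambda> z
     (unit_vec (Y \<sigma> {#}) # map (\<lambda>i. total_vec i z) (sorted_list_of_set UNIV))"

definition jacobi_morphism ::
  "(('n, 'm) total_space \<Rightarrow> ('n, 'm) total_space) \<Rightarrow>
   ('n::{finite, linorder}, 'm::finite) jform \<Rightarrow> ('n, 'm) jform" where
  "jacobi_morphism \<xi> \<Lambda> = euler_lagrange (contract (prolong \<xi>) (euler_lagrange \<Lambda>))"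

text \<open>
  Residual operators on the jets over a chart; they are not unique. \<open>R k\<close> acts on
  \<open>(n + k)\<close>-forms of arbitrary finite order, and the last clause is locality.
\<close>

definition residual_operator ::
  "('n::{finite, linorder}, 'm::finite) jet set \<Rightarrow> (nat \<Rightarrow> ('n, 'm) jform \<Rightarrow> ('n, 'm) jform) \<Rightarrow> bool" where
  "residual_operator U R \<longleftrightarrow>
     (\<forall>k \<rho> s. 1 \<le> k \<and> is_jform U s (CARD('n) + k) \<rho> \<longrightarrow>
        (\<exists>s'. is_jform U s' (CARD('n) + k - 1) (R k \<rho>)) \<and>
        (\<forall>z\<in>U. \<forall>vs. contact_part k \<rho> z vs =
           interior_euler k \<rho> z vs + contact_part k (ext_deriv (contact_part k (R k \<rho>))) z vs) \<and>
        vanishes_on U (contact_part (k - 1) (R k \<rho>))) \<and>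
     (\<forall>k \<rho> \<rho>' s s' W. 1 \<le> k \<and> is_jform U s (CARD('n) + k) \<rho> \<and> is_jform U s' (CARD('n) + k) \<rho>' \<and>
        open W \<and> W \<subseteq> U \<and> (\<forall>z\<in>W. \<forall>vs. \<rho> z vs = \<rho>' z vs) \<longrightarrow>
        (\<forall>z\<in>W. \<forall>vs. R k \<rho> z vs = R k \<rho>' z vs))"

definition noether_current ::
  "(nat \<Rightarrow> ('n, 'm) jform \<Rightarrow> ('n, 'm) jform) \<Rightarrow>
   (('n, 'm) total_space \<Rightarrow> ('n, 'm) total_space) \<Rightarrow>
   ('n::{finite, linorder}, 'm::finite) jform \<Rightarrow> ('n, 'm) jform" where
  "noether_current R \<xi> \<Lambda> z vs = - contract (prolong \<xi>) (contact_part 1 (R 1 (ext_deriv \<Lambda>))) z vs"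

definition critical_section ::
  "('x::{second_countable_topology, t2_space}, 'y::{second_countable_topology, t2_space},
    'n::{finite, linorder}, 'm::finite) fibration \<Rightarrow>
   (('x, 'y, 'n, 'm) fchart \<Rightarrow> ('n, 'm) jform) \<Rightarrow> 'x set \<Rightarrow> ('x \<Rightarrow> 'y) \<Rightarrow> bool" where
  "critical_section F \<Lambda> W \<gamma> \<longleftrightarrow> local_section F W \<gamma> \<and>
     (\<forall>C\<in>fibered_charts F. \<forall>x\<in>W. \<gamma> x \<in> fst (fst C) \<longrightarrow>
        (\<forall>\<sigma>. euler_coeff \<sigma> (\<Lambda> C) (jet_coord C \<gamma> x) = 0))"

text \<open>Pull-back by the jet prolongation of a section, in the coordinates of a fibered chart.\<close>

definition pullback_section ::
  "('x, 'y, 'n::{finite, linorder}, 'm::finite) fchart \<Rightarrow> ('x \<Rightarrow> 'y) \<Rightarrow> ('n, 'm) jform \<Rightarrow>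
   'n base_space \<Rightarrow> ('n base_space) list \<Rightarrow> real" where
  "pullback_section C \<gamma> \<eta> u ws =
     (let s = (\<lambda>u. jet_coord C \<gamma> (inv_into (fst (snd C)) (snd (snd C)) u))
      in \<eta> (s u) (map (\<lambda>w a. deriv (\<lambda>t. s (u + t *\<^sub>R w) a) 0) ws))"

definition vanishes_along ::
  "('x, 'y, 'n::{finite, linorder}, 'm::finite) fchart \<Rightarrow> 'x set \<Rightarrow> ('x \<Rightarrow> 'y) \<Rightarrow> ('n, 'm) jform \<Rightarrow> bool" where
  "vanishes_along C W \<gamma> \<eta> \<longleftrightarrow>
     (\<forall>x\<in>W. \<gamma> x \<in> fst (fst C) \<longrightarrow> (\<forall>ws. pullback_section C \<gamma> \<eta> (snd (snd C) x) ws = 0))"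

end

theory Submission
  imports Defs
begin

text \<open>
  For a horizontal \<open>n\<close>-form \<open>\<mu>\<close>, Lie derivatives along total derivatives or prolonged vertical
  fields, the contact part of \<open>d\<mu>\<close> and the Euler--Lagrange form act on the functions
  \<open>z \<mapsto> \<mu> z vs\<close> with the arguments \<open>vs\<close> held fixed, so everything reduces to scalar identities for
  \<open>E\<^sub>\<sigma>(f) = \<Sum>\<^sub>I (-1)\<^bsup>|I|\<^esup> d\<^sub>I(\<partial>f/\<partial>y\<^sup>\<sigma>\<^sub>I)\<close>. These follow from the bilinear expression
  \<open>E\<^sub>\<sigma>(f; g) = \<Sum>\<^sub>I (-1)\<^bsup>|I|\<^esup> d\<^sub>I(g \<partial>f/\<partial>y\<^sup>\<sigma>\<^sub>I)\<close>, which satisfies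
  \<open>E\<^sub>\<sigma>(fg) = E\<^sub>\<sigma>(f; g) + E\<^sub>\<sigma>(g; f)\<close> and \<open>E\<^sub>\<sigma>(d\<^sub>i f; g) = - E\<^sub>\<sigma>(f; d\<^sub>i g)\<close>: writing \<open>pr Q\<close> for the
  prolonged field, \<open>E\<^sub>\<sigma>(pr Q L) = E\<^sub>\<sigma>(Q\<^sup>\<tau> E\<^sub>\<tau>(L))\<close>, and for \<open>Q\<close> of order zero
  \<open>E\<^sub>\<sigma>(Q\<^sup>\<tau> E\<^sub>\<tau>(L)) = pr Q (E\<^sub>\<sigma>(L)) + \<partial>Q\<^sup>\<tau>/\<partial>y\<^sup>\<sigma> E\<^sub>\<tau>(L)\<close>.

  Since \<open>J\<Xi>\<close> preserves the contact forms, \<open>d\<^sub>H \<epsilon>\<^sub>\<Xi>(\<Lambda>) = J\<Xi> \<rfloor> p\<^sub>1 d p\<^sub>1 R(d\<Lambda>) = L\<^bsub>J\<Xi>\<^esub> \<Lambda> - J\<Xi> \<rfloor> E\<^sub>n(\<Lambda>)\<close>. For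
  \<open>\<Lambda> = L\<^bsub>J\<Xi>1\<^esub> h\<rho>\<close> the last term is \<open>\<Xi>2 \<rfloor> \<J>\<^bsub>\<Xi>1\<^esub>(h\<rho>)\<close> by the first identity. For \<open>\<Lambda> = \<Xi>1 \<rfloor> E\<^sub>n(h\<rho>)\<close> it
  vanishes, and \<open>L\<^bsub>J\<Xi>2\<^esub> \<Lambda>\<close> vanishes on critical sections by the second.
\<close>

section \<open>Calculus of functions on jets\<close>

text \<open>A jet has infinitely many coordinates and carries the product topology, so smoothness
  here means finite order together with continuous iterated partials. Finite order substitutes for
  finite dimension: it reduces the chain rule, Schwarz's theorem and all formal sums over
  multi-indices to finitely many variables or terms. This is why orders are tracked throughout,
  mostly by crude common bounds.

  A second obstacle is that prolonged fields and total derivatives vary with the jet, whereas forms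
  are differentiated with constant arguments. On horizontal forms only the base components of
  arguments count, and those of such fields are constant. The form R(d\<Lambda>) is not horizontal,
  and there the variation of the arguments has to be computed.

  In the second statement the derivative of Q1^\<tau> E_\<tau>(L) along pr Q2 has the terms pr
  Q2(Q1^\<tau>) E_\<tau>(L) and Q1^\<tau> pr Q2(E_\<tau>(L)). At a critical jet the first is zero
  outright, the second by the Jacobi equation of \<Xi>2; the Jacobi equation of \<Xi>1 removes
  \<Xi>2 \<rfloor> E_n(\<Lambda>).\<close>

primrec partials_upto :: "nat \<Rightarrow> ('n, 'm) jet set \<Rightarrow> (('n, 'm) jet \<Rightarrow> real) \<Rightarrow> bool" where
  "partials_upto 0 U f \<longleftrightarrow> continuous_on U f"
| "partials_upto (Suc m) U f \<longleftrightarrow> continuous_on U f \<and>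
     (\<forall>a. (\<forall>z\<in>U. (\<lambda>t. f (z(a := t))) differentiable (at (z a))) \<and> partials_upto m U (coord_partial a f))"

text \<open>\<open>jet_function\<close> iterates partials with the head of the list outermost,
  whereas \<open>partials_upto\<close> takes the innermost derivative first. The second form suits
  sums, products and composites, whose first partials are computed and then handled by
  induction.\<close>

lemma jet_function_iff:
  "jet_function U k f \<longleftrightarrow>
     (\<forall>z\<in>U. \<forall>z'\<in>U. (\<forall>a. jet_order a \<le> k \<longrightarrow> z a = z' a) \<longrightarrow> f z = f z') \<and>
     (\<forall>m. partials_upto m U f)"
proof -
  define S where "S f \<longleftrightarrow> (\<forall>as. continuous_on U (foldr coord_partial as f) \<and>
        (\<forall>a. \<forall>z\<in>U. (\<lambda>t. foldr coord_partial as f (z(a := t))) differentiable (at (z a))))" for f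
  have S_partial: "S (coord_partial a f)" if "S f" for a f
    unfolding S_def
  proof
    fix as
    show "continuous_on U (foldr coord_partial as (coord_partial a f)) \<and>
        (\<forall>b. \<forall>z\<in>U. (\<lambda>t. foldr coord_partial as (coord_partial a f) (z(b := t))) differentiable (at (z b)))"
      using that[unfolded S_def, rule_format, of "as @ [a]"] by simp
  qed
  have "partials_upto m U f" if "S f" for m
    using that
  proof (induction m arbitrary: f)
    case 0
    then show ?case using 0[unfolded S_def, rule_format, of "[]"] by simp
  next
    case (Suc m)
    then show ?case
      using Suc.prems[unfolded S_def, rule_format, of "[]"] S_partial by simp
  qed
  moreover have "S f" if "\<forall>m. partials_upto m U f"
  proof -
    have "continuous_on U (foldr coord_partial as f) \<and>
        (\<forall>a. \<forall>z\<in>U. (\<lambda>t. foldr coord_partial as f (z(a := t))) differentiable (at (z a)))" for as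
      using that
    proof (induction as arbitrary: f rule: rev_induct)
      case Nil
      show ?case
        using Nil[rule_format, of "Suc 0"] unfolding partials_upto.simps foldr.simps id_apply by blast
    next
      case (snoc a as)
      have "partials_upto m U (coord_partial a f)" for m
        using snoc.prems[rule_format, of "Suc m"] by simp
      then show ?case using snoc.IH by simp
    qed
    then show ?thesis by (simp add: S_def)
  qed
  ultimately show ?thesis unfolding jet_function_def S_def by blast
qed

text \<open>This finiteness is the substitute for finite dimension: derivatives of a function of
  order \<open>k\<close> are sums over these coordinates only.\<close>

lemma finite_jet_order_le: "finite {a :: ('n::finite, 'm::finite) coord. jet_order a \<le> k}"
proof -
  have "finite (\<Union>l\<le>k. {I :: 'n multiset. size I = l})"
  proof (intro finite_UN_I finite_atMost)
    fix l
    have "{I :: 'n multiset. size I = l} \<subseteq> mset ` {xs. set xs \<subseteq> UNIV \<and> length xs = l}"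
    proof
      fix I :: "'n multiset" assume "I \<in> {I. size I = l}"
      moreover obtain xs where "mset xs = I" using ex_mset by blast
      ultimately show "I \<in> mset ` {xs. set xs \<subseteq> UNIV \<and> length xs = l}" by auto
    qed
    then show "finite {I :: 'n multiset. size I = l}"
      by (rule finite_subset) (intro finite_imageI finite_lists_length_eq finite)
  qed
  then have fin: "finite {I :: 'n multiset. size I \<le> k}"
    by (rule rev_finite_subset) auto
  have "{a :: ('n, 'm) coord. jet_order a \<le> k} \<subseteq>
      range X \<union> (\<lambda>(\<sigma>, I). Y \<sigma> I) ` (UNIV \<times> {I. size I \<le> k})"
  proof
    fix a :: "('n, 'm) coord" assume "a \<in> {a. jet_order a \<le> k}"
    then show "a \<in> range X \<union> (\<lambda>(\<sigma>, I). Y \<sigma> I) ` (UNIV \<times> {I. size I \<le> k})"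
      by (cases a) auto
  qed
  then show ?thesis
    by (rule finite_subset) (use fin in auto)
qed

lemma finite_multiset_size_le: "finite {I :: 'n::finite multiset. size I \<le> k}"
proof -
  \<comment> \<open>With a one-point fibre index, \<open>Y ()\<close> embeds multi-indices into the
    coordinates, so the previous finiteness applies.\<close>
  have "finite (Y () -` {a :: ('n, unit) coord. jet_order a \<le> k})"
    by (rule finite_vimageI[OF finite_jet_order_le]) (simp add: inj_def)
  then show ?thesis by (simp add: vimage_def)
qed

text \<open>The bound on \<theta> is symmetric and \<open>h\<close> may be zero or negative, so
  difference quotients can be estimated without distinguishing the sign of the increment.\<close>

lemma mean_value_increment:
  fixes g :: "real \<Rightarrow> real"
  assumes "\<And>s. \<bar>s\<bar> \<le> \<bar>h\<bar> \<Longrightarrow> (g has_real_derivative g' s) (at s)"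
  obtains \<theta> where "\<bar>\<theta>\<bar> \<le> \<bar>h\<bar>" "g h - g 0 = h * g' \<theta>"
proof -
  consider "h = 0" | "0 < h" | "h < 0" by linarith
  then show ?thesis
  proof cases
    case 1
    then show ?thesis using that[of 0] by simp
  next
    case 2
    have "\<exists>\<theta>>0. \<theta> < h \<and> g h - g 0 = (h - 0) * g' \<theta>"
      by (rule MVT2) (use 2 assms in auto)
    then show ?thesis using that by force
  next
    case 3
    have "\<exists>\<theta>>h. \<theta> < 0 \<and> g 0 - g h = (0 - h) * g' \<theta>"
      by (rule MVT2) (use 3 assms in auto)
    then obtain \<theta> where "h < \<theta>" "\<theta> < 0" "g 0 - g h = (0 - h) * g' \<theta>" by blast
    then show ?thesis using that[of \<theta>] by auto
  qed
qed

text \<open>Models the jets over the domain of a fibered chart. The cylinder condition says that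
  membership is decided by the coordinates x and y alone, so coordinates of positive order can be
  altered freely without leaving \<open>U\<close>. Openness keeps short coordinate slices and line
  segments inside \<open>U\<close>.\<close>

locale jet_region =
  fixes U :: "('n::{finite, linorder}, 'm::finite) jet set"
  assumes open_region: "open U"
    and region_cylinder: "\<And>z z'. z \<in> U \<Longrightarrow> (\<And>a. jet_order a = 0 \<Longrightarrow> z a = z' a) \<Longrightarrow> z' \<in> U"
begin

lemma slice_in_region:
  assumes "z \<in> U"
  shows "\<forall>\<^sub>F t in nhds (z a). z(a := t) \<in> U"
proof -
  have "continuous_on UNIV (\<lambda>t. (z(a := t)) b)" for b
    by (cases "b = a") auto
  then have "continuous_on UNIV (\<lambda>t. z(a := t))"
    by (rule continuous_on_coordinatewise_then_product)
  then have "open ((\<lambda>t. z(a := t)) -` U)"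
    using open_region by (simp add: continuous_on_open_vimage)
  then show ?thesis
    using assms unfolding eventually_nhds by (intro exI[of _ "(\<lambda>t. z(a := t)) -` U"]) auto
qed

lemma line_in_region:
  assumes "z \<in> U"
  shows "\<forall>\<^sub>F t in nhds 0. (\<lambda>a. z a + t * v a) \<in> U"
proof -
  have "continuous_on UNIV (\<lambda>t a. z a + t * v a)"
    by (rule continuous_on_coordinatewise_then_product) (intro continuous_intros)
  then have "open ((\<lambda>t a. z a + t * v a) -` U)"
    using open_region by (simp add: continuous_on_open_vimage)
  then show ?thesis
    using assms unfolding eventually_nhds by (intro exI[of _ "(\<lambda>t a. z a + t * v a) -` U"]) auto
qed

text \<open>Functions and forms are controlled on \<open>U\<close> only, their values elsewhere
  being arbitrary. Short slices and segments remain in \<open>U\<close>, so operators built from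
  derivatives depend only on values on \<open>U\<close>.\<close>

lemma coord_partial_cong:
  assumes "\<And>z. z \<in> U \<Longrightarrow> f z = g z" "z \<in> U"
  shows "coord_partial a f z = coord_partial a g z"
  unfolding coord_partial_def
  by (rule deriv_cong_ev) (use slice_in_region[OF \<open>z \<in> U\<close>, of a] assms(1) in \<open>auto elim: eventually_mono\<close>)

lemma dir_deriv_cong:
  assumes "\<And>z. z \<in> U \<Longrightarrow> f z = g z" "z \<in> U"
  shows "dir_deriv v f z = dir_deriv v g z"
  unfolding dir_deriv_def
  by (rule deriv_cong_ev) (use line_in_region[OF \<open>z \<in> U\<close>, of v] assms(1) in \<open>auto elim: eventually_mono\<close>)

lemma slice_differentiable_cong:
  fixes f g :: "('n, 'm) jet \<Rightarrow> real"
  assumes "\<And>z. z \<in> U \<Longrightarrow> f z = g z" "z \<in> U"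
    and "(\<lambda>t. f (z(a := t))) differentiable (at (z a))"
  shows "(\<lambda>t. g (z(a := t))) differentiable (at (z a))"
proof -
  have "\<forall>\<^sub>F t in nhds (z a). f (z(a := t)) = g (z(a := t))"
    using slice_in_region[OF \<open>z \<in> U\<close>, of a] assms(1) by (auto elim: eventually_mono)
  then have "((\<lambda>t. f (z(a := t))) has_real_derivative D) (at (z a)) \<longleftrightarrow>
      ((\<lambda>t. g (z(a := t))) has_real_derivative D) (at (z a))" for D
    by (intro DERIV_cong_ev refl)
  then show ?thesis using assms(3) by (simp only: real_differentiable_def)
qed

lemma partials_upto_cong:
  assumes "\<And>z. z \<in> U \<Longrightarrow> f z = g z" "partials_upto m U f"
  shows "partials_upto m U g"
  using assms
proof (induction m arbitrary: f g)
  case 0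
  have "continuous_on U f = continuous_on U g"
    by (rule continuous_on_cong[OF refl 0(1)])
  then show ?case using 0(2) by (simp only: partials_upto.simps)
next
  case (Suc m)
  note f = Suc.prems(2)[unfolded partials_upto.simps]
  have "continuous_on U f = continuous_on U g"
    by (rule continuous_on_cong[OF refl Suc.prems(1)])
  moreover have "(\<lambda>t. g (z(a := t))) differentiable (at (z a))" if "z \<in> U" for z a
  proof (rule slice_differentiable_cong[of f g, OF Suc.prems(1) that])
    show "(\<lambda>t. f (z(a := t))) differentiable (at (z a))" using f that by blast
  qed
  moreover have "partials_upto m U (coord_partial a g)" for a
  proof (rule Suc.IH)
    show "partials_upto m U (coord_partial a f)" using f by blast
    show "coord_partial a f z = coord_partial a g z" if "z \<in> U" for z
      by (rule coord_partial_cong[OF Suc.prems(1) that])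
  qed
  ultimately show ?case using f unfolding partials_upto.simps by blast
qed

lemma jet_function_cong:
  assumes eq: "\<And>z. z \<in> U \<Longrightarrow> f z = g z" and f: "jet_function U k f"
  shows "jet_function U k g"
  unfolding jet_function_iff
proof (intro conjI allI ballI impI)
  show "partials_upto m U g" for m
    by (rule partials_upto_cong[OF eq]) (use f in \<open>auto simp: jet_function_iff\<close>)
  fix z z' assume "z \<in> U" "z' \<in> U" "\<forall>a. jet_order a \<le> k \<longrightarrow> z a = z' a"
  then have "f z = f z'" using f unfolding jet_function_iff by blast
  then show "g z = g z'" using eq \<open>z \<in> U\<close> \<open>z' \<in> U\<close> by simp
qed

lemma has_coord_partial:
  assumes "(\<lambda>t. f (z(a := t))) differentiable (at (z a))"
  shows "((\<lambda>t. f (z(a := t))) has_real_derivative coord_partial a f z) (at (z a))"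
  using assms unfolding coord_partial_def by (simp add: DERIV_deriv_iff_real_differentiable)

lemma coord_partialI:
  "((\<lambda>t. f (z(a := t))) has_real_derivative D) (at (z a)) \<Longrightarrow> coord_partial a f z = D"
  unfolding coord_partial_def by (rule DERIV_imp_deriv)

lemma jet_function_has_coord_partial:
  assumes "jet_function U k f" "z \<in> U"
  shows "((\<lambda>t. f (z(a := t))) has_real_derivative coord_partial a f z) (at (z a))"
proof (rule has_coord_partial)
  have "partials_upto (Suc 0) U f" using assms by (simp only: jet_function_iff)
  then show "(\<lambda>t. f (z(a := t))) differentiable (at (z a))"
    using assms(2) unfolding partials_upto.simps by blast
qed

lemma partials_upto_has_coord_partial:
  assumes "partials_upto (Suc m) U f" "z \<in> U"
  shows "((\<lambda>t. f (z(a := t))) has_real_derivative coord_partial a f z) (at (z a))"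
proof (rule has_coord_partial)
  show "(\<lambda>t. f (z(a := t))) differentiable (at (z a))"
    using assms unfolding partials_upto.simps by blast
qed

lemma partials_upto_SucI:
  assumes "continuous_on U f"
    and "\<And>a z. z \<in> U \<Longrightarrow> ((\<lambda>t. f (z(a := t))) has_real_derivative f' a z) (at (z a))"
    and "\<And>a. partials_upto m U (f' a)"
  shows "partials_upto (Suc m) U f"
proof -
  have "(\<lambda>t. f (z(a := t))) differentiable (at (z a))" if "z \<in> U" for a z
    using assms(2)[OF that, of a] by (auto simp only: real_differentiable_def)
  moreover have "partials_upto m U (coord_partial a f)" for a
  proof (rule partials_upto_cong[OF _ assms(3)])
    show "f' a z = coord_partial a f z" if "z \<in> U" for z
      by (rule coord_partialI[OF assms(2)[OF that], symmetric])
  qed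
  ultimately show ?thesis using assms(1) unfolding partials_upto.simps by blast
qed

section \<open>Sums and products of smooth functions of finite order\<close>

lemma partials_upto_const: "partials_upto m U (\<lambda>z. c)"
proof (induction m arbitrary: c)
  case (Suc m)
  show ?case by (rule partials_upto_SucI[where f' = "\<lambda>a z. 0"]) (use Suc in auto)
qed simp

lemma partials_upto_coord: "partials_upto m U (\<lambda>z. z b)"
proof -
  have cont: "continuous_on U (\<lambda>z. z b)"
    by (rule continuous_on_subset[OF continuous_on_product_coordinates subset_UNIV])
  show ?thesis
  proof (cases m)
    case (Suc l)
    have "((\<lambda>t. (z(a := t)) b) has_real_derivative (if a = b then 1 else 0)) (at (z a))" for z a
      by (cases "a = b") simp_all
    then show ?thesis
      unfolding Suc by (rule partials_upto_SucI[OF cont]) (rule partials_upto_const)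
  qed (simp add: cont)
qed

lemma partials_upto_Suc_imp: "partials_upto (Suc m) U f \<Longrightarrow> partials_upto m U f"
proof (induction m arbitrary: f)
  case 0
  then show ?case by simp
next
  case (Suc m)
  then have "partials_upto m U (coord_partial a f)" for a
    unfolding partials_upto.simps(2)[of "Suc m"] by blast
  then show ?case using Suc.prems unfolding partials_upto.simps(2) by blast
qed

lemma partials_upto_add:
  assumes "partials_upto m U f" "partials_upto m U g"
  shows "partials_upto m U (\<lambda>z. f z + g z)"
  using assms
proof (induction m arbitrary: f g)
  case 0
  then show ?case by (simp add: continuous_on_add)
next
  case (Suc m)
  note fg = Suc.prems[unfolded partials_upto.simps]
  show ?case
  proof (rule partials_upto_SucI)
    show "continuous_on U (\<lambda>z. f z + g z)" using fg by (intro continuous_on_add) blast+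
    show "((\<lambda>t. f (z(a := t)) + g (z(a := t))) has_real_derivative
        coord_partial a f z + coord_partial a g z) (at (z a))" if "z \<in> U" for a z
      by (rule DERIV_add[OF partials_upto_has_coord_partial[OF Suc.prems(1) that]
          partials_upto_has_coord_partial[OF Suc.prems(2) that]])
    show "partials_upto m U (\<lambda>z. coord_partial a f z + coord_partial a g z)" for a
      using fg by (intro Suc.IH) blast+
  qed
qed

lemma partials_upto_mult:
  assumes "partials_upto m U f" "partials_upto m U g"
  shows "partials_upto m U (\<lambda>z. f z * g z)"
  using assms
proof (induction m arbitrary: f g)
  case 0
  then show ?case by (simp add: continuous_on_mult)
next
  case (Suc m)
  note fg = Suc.prems[unfolded partials_upto.simps]
  show ?case
  proof (rule partials_upto_SucI)
    show "continuous_on U (\<lambda>z. f z * g z)" using fg by (intro continuous_on_mult) blast+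
    show "((\<lambda>t. f (z(a := t)) * g (z(a := t))) has_real_derivative
        coord_partial a f z * g z + coord_partial a g z * f z) (at (z a))" if "z \<in> U" for a z
      using DERIV_mult[OF partials_upto_has_coord_partial[OF Suc.prems(1) that]
          partials_upto_has_coord_partial[OF Suc.prems(2) that], of a] by (simp only: fun_upd_triv)
    show "partials_upto m U (\<lambda>z. coord_partial a f z * g z + coord_partial a g z * f z)" for a
      using fg Suc.prems[THEN partials_upto_Suc_imp]
      by (intro partials_upto_add Suc.IH) blast+
  qed
qed

lemma jet_functionI:
  assumes "\<And>z z'. z \<in> U \<Longrightarrow> z' \<in> U \<Longrightarrow> (\<And>a. jet_order a \<le> k \<Longrightarrow> z a = z' a) \<Longrightarrow> f z = f z'"
    and "\<And>m. partials_upto m U f"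
  shows "jet_function U k f"
  unfolding jet_function_iff using assms by blast

lemma jet_function_eq:
  "jet_function U k f \<Longrightarrow> z \<in> U \<Longrightarrow> z' \<in> U \<Longrightarrow> (\<And>a. jet_order a \<le> k \<Longrightarrow> z a = z' a) \<Longrightarrow> f z = f z'"
  unfolding jet_function_def by blast

lemma jet_function_partials: "jet_function U k f \<Longrightarrow> partials_upto m U f"
  unfolding jet_function_iff by blast

lemma jet_function_const [intro, simp]: "jet_function U k (\<lambda>z. c)"
  by (rule jet_functionI[OF refl partials_upto_const])

lemma jet_function_coord: "jet_order a \<le> k \<Longrightarrow> jet_function U k (\<lambda>z. z a)"
  by (rule jet_functionI[OF _ partials_upto_coord]) blast

lemma jet_function_add:
  assumes "jet_function U k f" "jet_function U k g"
  shows "jet_function U k (\<lambda>z. f z + g z)"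
  by (rule jet_functionI[OF arg_cong2[where f = "(+)"]])
    (fact jet_function_eq[OF assms(1)] jet_function_eq[OF assms(2)]
      partials_upto_add[OF assms[THEN jet_function_partials]])+

lemma jet_function_mult:
  assumes "jet_function U k f" "jet_function U k g"
  shows "jet_function U k (\<lambda>z. f z * g z)"
  by (rule jet_functionI[OF arg_cong2[where f = "(*)"]])
    (fact jet_function_eq[OF assms(1)] jet_function_eq[OF assms(2)]
      partials_upto_mult[OF assms[THEN jet_function_partials]])+

lemma jet_function_sum:
  "(\<And>i. i \<in> I \<Longrightarrow> jet_function U k (f i)) \<Longrightarrow> jet_function U k (\<lambda>z. \<Sum>i\<in>I. f i z)"
  by (induction I rule: infinite_finite_induct) (auto intro: jet_function_add)

lemma jet_function_mono:
  assumes "jet_function U k f" "k \<le> l"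
  shows "jet_function U l f"
proof (rule jet_functionI[OF jet_function_eq[OF assms(1)] jet_function_partials[OF assms(1)]])
  fix z z' :: "('n, 'm) jet" and a :: "('n, 'm) coord"
  assume "\<And>a. jet_order a \<le> l \<Longrightarrow> z a = z' a" "jet_order a \<le> k"
  then show "z a = z' a" using \<open>k \<le> l\<close> by simp
qed

text \<open>Points that differ only in a coordinate of order above \<open>k\<close> have the same
  value; such a coordinate has positive order, so the cylinder condition keeps the whole slice in
  \<open>U\<close>.\<close>

lemma coord_partial_high_order:
  assumes "jet_function U k f" "k < jet_order a" "z \<in> U"
  shows "coord_partial a f z = 0"
proof -
  have "z(a := t) \<in> U" for t
    by (rule region_cylinder[OF \<open>z \<in> U\<close>]) (use assms(2) in auto)
  then have "f (z(a := t)) = f z" for t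
    by (intro jet_function_eq[OF assms(1)]) (use assms in auto)
  then show ?thesis by (simp add: coord_partial_def)
qed

text \<open>The order does not grow: if two jets agree up to order \<open>k\<close>, so do their
  slices in a coordinate of order at most \<open>k\<close>, and in a coordinate of higher order both
  partials vanish.\<close>

lemma jet_function_coord_partial:
  assumes f: "jet_function U k f"
  shows "jet_function U k (coord_partial a f)"
proof (rule jet_functionI)
  show "partials_upto m U (coord_partial a f)" for m
    using jet_function_partials[OF f, of "Suc m"] unfolding partials_upto.simps by blast
  fix z z' assume z: "z \<in> U" "z' \<in> U" "\<And>a. jet_order a \<le> k \<Longrightarrow> z a = z' a"
  show "coord_partial a f z = coord_partial a f z'"
  proof (cases "jet_order a \<le> k")
    case True
    have "\<forall>\<^sub>F t in nhds (z a). f (z(a := t)) = f (z'(a := t))"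
      using slice_in_region[OF \<open>z \<in> U\<close>, of a]
    proof eventually_elim
      case (elim t)
      have "z'(a := t) \<in> U"
        by (rule region_cylinder[OF elim]) (use z in auto)
      with elim show ?case by (rule jet_function_eq[OF f]) (use z in auto)
    qed
    then show ?thesis
      unfolding coord_partial_def using z(3)[OF True] by (intro deriv_cong_ev) simp_all
  next
    case False
    then show ?thesis using coord_partial_high_order[OF f] z(1,2) by simp
  qed
qed

section \<open>The chain rule along lines and the symmetry of second partials\<close>

lemma coord_partial_continuous: "jet_function U k f \<Longrightarrow> continuous_on U (coord_partial a f)"
  using jet_function_partials[OF jet_function_coord_partial, of k f 0 a]
  unfolding partials_upto.simps by blast

text \<open>Two parameters are what both uses need: in the chain rule the position on the line and
  an increment in one coordinate, in Schwarz's theorem the increments in two coordinates.\<close>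

lemma continuous_near:
  fixes p :: "real \<times> real \<Rightarrow> ('n, 'm) jet" and g :: "('n, 'm) jet \<Rightarrow> real"
  assumes "continuous_on U g" "continuous_on UNIV p" "p (0, 0) \<in> U" "0 < e"
  obtains d where "0 < d" "\<And>s t. \<bar>s\<bar> < d \<Longrightarrow> \<bar>t\<bar> < d \<Longrightarrow> p (s, t) \<in> U \<and> \<bar>g (p (s, t)) - g (p (0, 0))\<bar> < e"
proof -
  have op: "open (p -` U)"
    using assms open_region by (simp add: continuous_on_open_vimage)
  have "continuous_on (p -` U) (\<lambda>x. g (p x))"
    by (rule continuous_on_compose2[OF assms(1)]) (use assms(2) continuous_on_subset in auto)
  then have "isCont (\<lambda>x. g (p x)) (0, 0)"
    using op assms(3) by (simp add: continuous_on_eq_continuous_at)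
  then have "((\<lambda>x. g (p x)) \<longlongrightarrow> g (p (0, 0))) (nhds (0, 0))"
    using tendsto_at_iff_tendsto_nhds[of "\<lambda>x. g (p x)" "(0, 0)"] by (simp only: isCont_def)
  from tendstoD[OF this \<open>0 < e\<close>]
  have "\<forall>\<^sub>F x in nhds (0, 0). \<bar>g (p x) - g (p (0, 0))\<bar> < e"
    by (simp only: dist_real_def)
  moreover have "\<forall>\<^sub>F x in nhds (0, 0). p x \<in> U"
    using op assms(3) by (auto simp: eventually_nhds)
  ultimately have "\<forall>\<^sub>F x in nhds (0, 0). p x \<in> U \<and> \<bar>g (p x) - g (p (0, 0))\<bar> < e"
    by (simp add: eventually_conj_iff)
  then obtain d where d: "0 < d" "\<And>x. dist x (0, 0) < d \<Longrightarrow> p x \<in> U \<and> \<bar>g (p x) - g (p (0, 0))\<bar> < e"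
    unfolding eventually_nhds_metric by blast
  \<comment> \<open>Half the radius suffices since the distance in the plane is at most |s| +
    |t|.\<close>
  have "p (s, t) \<in> U \<and> \<bar>g (p (s, t)) - g (p (0, 0))\<bar> < e" if "\<bar>s\<bar> < d / 2" "\<bar>t\<bar> < d / 2" for s t
  proof (rule d(2))
    have "dist (s, t) (0, 0) \<le> \<bar>s\<bar> + \<bar>t\<bar>"
      by (simp add: dist_Pair_Pair dist_real_def sqrt_sum_squares_le_sum_abs)
    then show "dist (s, t) (0, 0) < d" using that by linarith
  qed
  then show ?thesis using that[of "d / 2"] d(1) by simp
qed

text \<open>Continuous partials imply the chain rule, by induction on the set of moving coordinates:
  one coordinate is split off, its increment is expressed by the mean value theorem through its
  partial at an intermediate point, and that partial converges by continuity.\<close>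

lemma line_derivative_finite:
  assumes f: "jet_function U k f" and "finite A" "z \<in> U" "\<And>a. a \<notin> A \<Longrightarrow> w a = 0"
  shows "((\<lambda>t. f (\<lambda>a. z a + t * w a)) has_real_derivative (\<Sum>a\<in>A. w a * coord_partial a f z)) (at 0)"
  using assms(2,4)
proof (induction A arbitrary: w rule: finite_induct)
  case empty
  then show ?case by simp
next
  case (insert b A)
  define w' where "w' = w(b := 0)"
  \<comment> \<open>The first parameter moves all coordinates except \<open>b\<close>, the second
    moves \<open>b\<close> alone; the point of the line at time t is
    \<open>p (t, t * w b)\<close>.\<close>
  define p where "p = (\<lambda>(t, s). (\<lambda>a. z a + t * w' a)(b := z b + s))"
  define g where "g t = f (p (t, t * w b)) - f (p (t, 0))" for t
  have "(\<lambda>a. z a + t * w a) = p (t, t * w b)" and pz: "(\<lambda>a. z a + t * w' a) = p (t, 0)" for t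
    by (auto simp: p_def w'_def)
  then have split: "(\<lambda>t. f (\<lambda>a. z a + t * w a)) = (\<lambda>t. f (\<lambda>a. z a + t * w' a) + g t)"
    by (simp add: g_def)
  have "((\<lambda>t. f (\<lambda>a. z a + t * w' a)) has_real_derivative (\<Sum>a\<in>A. w' a * coord_partial a f z)) (at 0)"
    by (rule insert.IH) (use insert.prems in \<open>auto simp: w'_def\<close>)
  moreover have "(\<Sum>a\<in>A. w' a * coord_partial a f z) = (\<Sum>a\<in>A. w a * coord_partial a f z)"
    by (rule sum.cong) (use insert.hyps in \<open>auto simp: w'_def\<close>)
  moreover have "(g has_real_derivative w b * coord_partial b f z) (at 0)"
  proof (cases "w b = 0")
    case True
    then have "g = (\<lambda>t. 0)" by (simp add: g_def fun_eq_iff)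
    then show ?thesis using True by simp
  next
    case False
    have p0: "p (0, 0) = z" by (auto simp: p_def)
    have p0U: "p (0, 0) \<in> U" using p0 \<open>z \<in> U\<close> by simp
    have g0: "g 0 = 0" by (simp add: g_def)
    have cont_p: "continuous_on UNIV p"
    proof (rule continuous_on_coordinatewise_then_product)
      show "continuous_on UNIV (\<lambda>x. p x i)" for i
        by (cases "i = b") (simp_all add: p_def case_prod_unfold, (intro continuous_intros)+)
    qed
    have "\<exists>d>0. \<forall>h. h \<noteq> 0 \<and> \<bar>h\<bar> < d \<longrightarrow> \<bar>(g h - g 0) / h - w b * coord_partial b f z\<bar> < e" if "0 < e" for e
    proof -
      have "0 < e / \<bar>w b\<bar>" using that False by simp
      then obtain d where d: "0 < d" "\<And>s t. \<bar>s\<bar> < d \<Longrightarrow> \<bar>t\<bar> < d \<Longrightarrow>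
          p (s, t) \<in> U \<and> \<bar>coord_partial b f (p (s, t)) - coord_partial b f (p (0, 0))\<bar> < e / \<bar>w b\<bar>"
        by (rule continuous_near[OF coord_partial_continuous[OF f, of b] cont_p p0U]) blast
      show ?thesis
      proof (intro exI conjI allI impI)
        \<comment> \<open>The second bound makes \<open>h * w b\<close>, the increment in coordinate
          \<open>b\<close>, smaller than \<open>d\<close> in absolute value.\<close>
        show "0 < min d (d / \<bar>w b\<bar>)" using d False by simp
        fix h assume h: "h \<noteq> 0 \<and> \<bar>h\<bar> < min d (d / \<bar>w b\<bar>)"
        then have hd: "\<bar>h\<bar> < d" "\<bar>h * w b\<bar> < d"
          using False by (auto simp: abs_mult field_simps)
        have "((\<lambda>s. f (p (h, s))) has_real_derivative coord_partial b f (p (h, s))) (at s)"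
          if "\<bar>s\<bar> \<le> \<bar>h * w b\<bar>" for s
        proof -
          have "p (h, s) \<in> U" using d(2)[of h s] that hd by simp
          from jet_function_has_coord_partial[OF f this, of b]
          have "((\<lambda>t. f ((p (h, s))(b := t))) has_real_derivative coord_partial b f (p (h, s))) (at (s + z b))"
            by (simp add: p_def add.commute)
          then have "((\<lambda>x. f ((p (h, s))(b := x + z b))) has_real_derivative coord_partial b f (p (h, s))) (at s)"
            by (simp add: DERIV_shift)
          moreover have "(p (h, s))(b := x + z b) = p (h, x)" for x
            by (auto simp: p_def)
          ultimately show ?thesis by simp
        qed
        then obtain \<theta> where th: "\<bar>\<theta>\<bar> \<le> \<bar>h * w b\<bar>"
          "f (p (h, h * w b)) - f (p (h, 0)) = h * w b * coord_partial b f (p (h, \<theta>))"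
          using mean_value_increment[of "h * w b" "\<lambda>s. f (p (h, s))" "\<lambda>s. coord_partial b f (p (h, s))"]
          by blast
        have "g h = h * (w b * coord_partial b f (p (h, \<theta>)))"
          by (simp only: g_def th(2) mult.assoc)
        then have "(g h - g 0) / h = w b * coord_partial b f (p (h, \<theta>))"
          using h g0 by simp
        then have eq: "\<bar>(g h - g 0) / h - w b * coord_partial b f z\<bar> =
            \<bar>coord_partial b f (p (h, \<theta>)) - coord_partial b f z\<bar> * \<bar>w b\<bar>"
          by (simp only: right_diff_distrib[symmetric] abs_mult mult.commute)
        have "\<bar>coord_partial b f (p (h, \<theta>)) - coord_partial b f z\<bar> < e / \<bar>w b\<bar>"
          using d(2)[of h \<theta>] th(1) hd p0 by simp
        then have "\<bar>coord_partial b f (p (h, \<theta>)) - coord_partial b f z\<bar> * \<bar>w b\<bar> < e"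
          by (rule iffD1[OF pos_less_divide_eq, rotated]) (use False in simp)
        then show "\<bar>(g h - g 0) / h - w b * coord_partial b f z\<bar> < e"
          unfolding eq .
      qed
    qed
    then show ?thesis
      unfolding DERIV_def LIM_def by (simp add: dist_real_def)
  qed
  ultimately have "((\<lambda>t. f (\<lambda>a. z a + t * w a)) has_real_derivative
      (\<Sum>a\<in>A. w a * coord_partial a f z) + w b * coord_partial b f z) (at 0)"
    unfolding split by (simp only: DERIV_add)
  then show ?case using insert.hyps by (simp add: add.commute)
qed

text \<open>The direction may have infinitely many nonzero components. A function of order
  \<open>k\<close> sees only those of order at most \<open>k\<close>, so the direction is truncated
  to \<open>w\<close> and the finite case applies.\<close>

lemma has_dir_deriv:
  assumes f: "jet_function U k f" and z: "z \<in> U"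
  shows "((\<lambda>t. f (\<lambda>a. z a + t * v a)) has_real_derivative
    (\<Sum>a | jet_order a \<le> k. v a * coord_partial a f z)) (at 0)"
proof -
  define w where "w a = (if jet_order a \<le> k then v a else 0)" for a
  have "((\<lambda>t. f (\<lambda>a. z a + t * w a)) has_real_derivative
      (\<Sum>a | jet_order a \<le> k. w a * coord_partial a f z)) (at 0)"
    by (rule line_derivative_finite[OF f finite_jet_order_le z]) (simp add: w_def)
  moreover have "(\<Sum>a | jet_order a \<le> k. w a * coord_partial a f z) =
      (\<Sum>a | jet_order a \<le> k. v a * coord_partial a f z)"
    by (rule sum.cong) (auto simp: w_def)
  moreover have "\<forall>\<^sub>F t in nhds 0. f (\<lambda>a. z a + t * w a) = f (\<lambda>a. z a + t * v a)"
    using line_in_region[OF z, of w] line_in_region[OF z, of v]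
    by eventually_elim (rule jet_function_eq[OF f], auto simp: w_def)
  then have "((\<lambda>t. f (\<lambda>a. z a + t * w a)) has_real_derivative D) (at 0) \<longleftrightarrow>
      ((\<lambda>t. f (\<lambda>a. z a + t * v a)) has_real_derivative D) (at 0)" for D
    by (intro DERIV_cong_ev refl)
  ultimately show ?thesis by simp
qed

lemma dir_deriv_eq:
  assumes "jet_function U k f" "z \<in> U"
  shows "dir_deriv v f z = (\<Sum>a | jet_order a \<le> k. v a * coord_partial a f z)"
  unfolding dir_deriv_def by (rule DERIV_imp_deriv[OF has_dir_deriv[OF assms]])

lemma has_dir_deriv':
  assumes "jet_function U k f" "z \<in> U"
  shows "((\<lambda>t. f (\<lambda>a. z a + t * v a)) has_real_derivative dir_deriv v f z) (at 0)"
  using has_dir_deriv[OF assms] dir_deriv_eq[OF assms] by simp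

lemma dir_deriv_add:
  assumes "jet_function U k f" "jet_function U l g" "z \<in> U"
  shows "dir_deriv v (\<lambda>z. f z + g z) z = dir_deriv v f z + dir_deriv v g z"
  unfolding dir_deriv_def[of v "\<lambda>z. f z + g z"]
  by (intro DERIV_imp_deriv DERIV_add has_dir_deriv'[OF assms(1,3)] has_dir_deriv'[OF assms(2,3)])

lemma dir_deriv_mult:
  assumes "jet_function U k f" "jet_function U l g" "z \<in> U"
  shows "dir_deriv v (\<lambda>z. f z * g z) z = dir_deriv v f z * g z + f z * dir_deriv v g z"
proof -
  have "dir_deriv v (\<lambda>z. f z * g z) z =
      dir_deriv v f z * g (\<lambda>a. z a + 0 * v a) + dir_deriv v g z * f (\<lambda>a. z a + 0 * v a)"
    unfolding dir_deriv_def[of v "\<lambda>z. f z * g z"]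
    by (intro DERIV_imp_deriv DERIV_mult has_dir_deriv'[OF assms(1,3)] has_dir_deriv'[OF assms(2,3)])
  then show ?thesis by (simp add: mult.commute)
qed

lemma dir_deriv_const [simp]: "dir_deriv v (\<lambda>z. c) z = 0"
  by (simp add: dir_deriv_def)

lemma dir_deriv_cmult:
  assumes "jet_function U k f" "z \<in> U"
  shows "dir_deriv v (\<lambda>z. c * f z) z = c * dir_deriv v f z"
  using dir_deriv_mult[OF jet_function_const[of 0 c] assms] by simp

lemma dir_deriv_sum:
  assumes "\<And>i. i \<in> I \<Longrightarrow> jet_function U k (f i)" "z \<in> U"
  shows "dir_deriv v (\<lambda>z. \<Sum>i\<in>I. f i z) z = (\<Sum>i\<in>I. dir_deriv v (f i) z)"
  using assms(1)
proof (induction I rule: infinite_finite_induct)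
  case (insert i I)
  have "dir_deriv v (\<lambda>z. f i z + (\<Sum>i\<in>I. f i z)) z = dir_deriv v (f i) z + dir_deriv v (\<lambda>z. \<Sum>i\<in>I. f i z) z"
    by (rule dir_deriv_add[of k _ k]) (use insert.prems assms(2) in \<open>auto intro!: jet_function_sum\<close>)
  with insert show ?case by simp
qed auto

text \<open>Makes the linearity and Leibniz rules of directional derivatives available for partials;
  the two are the same one-variable derivative up to a shift.\<close>

lemma coord_partial_dir_deriv: "coord_partial a f z = dir_deriv (unit_vec a) f z"
proof -
  have "(\<lambda>b. z b + t * unit_vec a b) = z(a := z a + t)" for t
    by (auto simp: unit_vec_def)
  then have "dir_deriv (unit_vec a) f z = deriv (\<lambda>t. f (z(a := z a + t))) 0"
    by (simp add: dir_deriv_def)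
  also have "\<dots> = deriv (\<lambda>t. f (z(a := t))) (z a)"
  proof -
    have "((\<lambda>t. f (z(a := z a + t))) has_field_derivative D) (at 0) \<longleftrightarrow>
        ((\<lambda>t. f (z(a := t))) has_field_derivative D) (at (z a))" for D
      using DERIV_shift[of "\<lambda>t. f (z(a := t))" D 0 "z a"] by (simp only: add.commute add_0_left)
    then show ?thesis by (simp only: deriv_def)
  qed
  finally show ?thesis by (simp add: coord_partial_def)
qed

text \<open>Schwarz's theorem, by the double difference quotient.\<close>

lemma coord_partial_commute:
  assumes f: "jet_function U k f" and z: "z \<in> U"
  shows "coord_partial a (coord_partial b f) z = coord_partial b (coord_partial a f) z"
proof (cases "a = b")
  case False
  define p where "p a b = (\<lambda>(s, t). z(a := z a + s, b := z b + t))" for a b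
  define \<Delta> where "\<Delta> a b h = f (p a b (h, h)) - f (p a b (h, 0)) - f (p a b (0, h)) + f (p a b (0, 0))"
    for a b and h :: real
  have quotient: "\<exists>d>0. \<forall>h. 0 < h \<and> h < d \<longrightarrow> \<bar>\<Delta> a b h / h\<^sup>2 - coord_partial b (coord_partial a f) z\<bar> < e"
    if "0 < e" "a \<noteq> b" for e a b
  proof -
    let ?p = "p a b"
    have p0: "?p (0, 0) = z" by (auto simp: p_def)
    have cont_p: "continuous_on UNIV ?p"
    proof (rule continuous_on_coordinatewise_then_product)
      show "continuous_on UNIV (\<lambda>x. ?p x i)" for i
        using \<open>a \<noteq> b\<close> by (cases "i = a"; cases "i = b")
          (simp_all add: p_def case_prod_unfold, (intro continuous_intros)+)
    qed
    have fa: "jet_function U k (coord_partial a f)" by (rule jet_function_coord_partial[OF f])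
    have p0U: "?p (0, 0) \<in> U" using p0 z by simp
    obtain d where d: "0 < d" "\<And>s t. \<bar>s\<bar> < d \<Longrightarrow> \<bar>t\<bar> < d \<Longrightarrow>
        ?p (s, t) \<in> U \<and>
        \<bar>coord_partial b (coord_partial a f) (?p (s, t)) - coord_partial b (coord_partial a f) (?p (0, 0))\<bar> < e"
      by (rule continuous_near[OF coord_partial_continuous[OF fa, of b] cont_p p0U \<open>0 < e\<close>]) blast
    have upd: "(?p (s, t))(a := x + z a) = ?p (x, t)" "(?p (s, t))(b := x + z b) = ?p (s, x)"
        "?p (s, t) a = s + z a" "?p (s, t) b = t + z b" for s t x
      using \<open>a \<noteq> b\<close> by (auto simp: p_def)
    have da: "((\<lambda>s. f (?p (s, t))) has_real_derivative coord_partial a f (?p (s, t))) (at s)"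
      if "\<bar>s\<bar> < d" "\<bar>t\<bar> < d" for s t
    proof -
      have "?p (s, t) \<in> U" using d(2) that by simp
      from jet_function_has_coord_partial[OF f this, of a]
      have "((\<lambda>x. f ((?p (s, t))(a := x + z a))) has_real_derivative coord_partial a f (?p (s, t))) (at s)"
        by (simp add: upd DERIV_shift)
      then show ?thesis by (simp add: upd)
    qed
    have db: "((\<lambda>t. coord_partial a f (?p (s, t))) has_real_derivative
        coord_partial b (coord_partial a f) (?p (s, t))) (at t)"
      if "\<bar>s\<bar> < d" "\<bar>t\<bar> < d" for s t
    proof -
      have "?p (s, t) \<in> U" using d(2) that by simp
      from jet_function_has_coord_partial[OF fa this, of b]
      have "((\<lambda>x. coord_partial a f ((?p (s, t))(b := x + z b))) has_real_derivative
          coord_partial b (coord_partial a f) (?p (s, t))) (at t)"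
        by (simp add: upd DERIV_shift)
      then show ?thesis by (simp add: upd)
    qed
    show ?thesis
    proof (intro exI conjI allI impI)
      fix h assume h: "0 < h \<and> h < d"
      obtain \<theta> where th: "\<bar>\<theta>\<bar> \<le> \<bar>h\<bar>" "(f (?p (h, h)) - f (?p (h, 0))) - (f (?p (0, h)) - f (?p (0, 0))) =
          h * (coord_partial a f (?p (\<theta>, h)) - coord_partial a f (?p (\<theta>, 0)))"
        by (rule mean_value_increment[of h "\<lambda>s. f (?p (s, h)) - f (?p (s, 0))"
            "\<lambda>s. coord_partial a f (?p (s, h)) - coord_partial a f (?p (s, 0))"])
          (use h in \<open>auto intro!: DERIV_diff da\<close>)
      obtain \<eta> where et: "\<bar>\<eta>\<bar> \<le> \<bar>h\<bar>" "coord_partial a f (?p (\<theta>, h)) - coord_partial a f (?p (\<theta>, 0)) =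
          h * coord_partial b (coord_partial a f) (?p (\<theta>, \<eta>))"
        by (rule mean_value_increment[of h "\<lambda>t. coord_partial a f (?p (\<theta>, t))"
            "\<lambda>t. coord_partial b (coord_partial a f) (?p (\<theta>, t))"])
          (use h th in \<open>auto intro!: db\<close>)
      have "\<Delta> a b h / h\<^sup>2 = coord_partial b (coord_partial a f) (?p (\<theta>, \<eta>))"
        using th(2) et(2) h by (simp add: \<Delta>_def field_simps power2_eq_square)
      then show "\<bar>\<Delta> a b h / h\<^sup>2 - coord_partial b (coord_partial a f) z\<bar> < e"
        using d(2)[of \<theta> \<eta>] th(1) et(1) h p0 by simp
    qed (rule d)
  qed
  \<comment> \<open>Both mixed partials are limits of the same quotient, because the double
    difference does not depend on the order of the two coordinates.\<close>
  have sym: "\<Delta> a b h = \<Delta> b a h" for h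
  proof -
    have "p a b (s, t) = p b a (t, s)" for s t
      using False by (auto simp: p_def)
    then show ?thesis by (simp add: \<Delta>_def)
  qed
  show ?thesis
  proof (rule ccontr)
    assume ne: "\<not> ?thesis"
    \<comment> \<open>Half the gap: one quotient cannot be this close to both mixed
      partials.\<close>
    define e where "e = \<bar>coord_partial a (coord_partial b f) z - coord_partial b (coord_partial a f) z\<bar> / 2"
    have "0 < e" using ne by (simp add: e_def)
    obtain d1 where "0 < d1"
      and 1: "\<And>h. 0 < h \<and> h < d1 \<Longrightarrow> \<bar>\<Delta> a b h / h\<^sup>2 - coord_partial b (coord_partial a f) z\<bar> < e"
      using quotient[OF \<open>0 < e\<close> False] by blast
    obtain d2 where "0 < d2"
      and 2: "\<And>h. 0 < h \<and> h < d2 \<Longrightarrow> \<bar>\<Delta> b a h / h\<^sup>2 - coord_partial a (coord_partial b f) z\<bar> < e"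
      using quotient[OF \<open>0 < e\<close> False[symmetric]] by blast
    define h where "h = min d1 d2 / 2"
    have h: "0 < h \<and> h < d1" "0 < h \<and> h < d2" using \<open>0 < d1\<close> \<open>0 < d2\<close> by (auto simp: h_def)
    have "dist (coord_partial a (coord_partial b f) z) (coord_partial b (coord_partial a f) z) <
        \<bar>coord_partial a (coord_partial b f) z - coord_partial b (coord_partial a f) z\<bar>"
      by (rule dist_triangle_half_r[of "\<Delta> b a h / h\<^sup>2"])
        (use 1[OF h(1)] 2[OF h(2)] in \<open>simp_all only: sym[of h] e_def dist_real_def\<close>)
    then show False by (simp only: dist_real_def order.irrefl)
  qed
qed simp

end

section \<open>Total derivatives and the Euler operator\<close>

context jet_region
begin

section \<open>Commutators of point-dependent fields\<close>

lemma jet_function_dir_deriv: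
  assumes f: "jet_function U k f" and V: "\<And>a. jet_order a \<le> k \<Longrightarrow> jet_function U l (\<lambda>z. V z a)" and "k \<le> l"
  shows "jet_function U l (\<lambda>z. dir_deriv (V z) f z)"
proof (rule jet_function_cong)
  show "jet_function U l (\<lambda>z. \<Sum>a | jet_order a \<le> k. V z a * coord_partial a f z)"
    by (intro jet_function_sum jet_function_mult V jet_function_mono[OF jet_function_coord_partial[OF f] \<open>k \<le> l\<close>])
      simp
  show "(\<Sum>a | jet_order a \<le> k. V z a * coord_partial a f z) = dir_deriv (V z) f z" if "z \<in> U" for z
    by (rule dir_deriv_eq[OF f that, symmetric])
qed

text \<open>The outer direction is frozen; only \<open>W\<close> varies with the jet. The formula
  separates the terms that differentiate \<open>W\<close> from the second-order terms, which cancel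
  in a commutator.\<close>

lemma dir_deriv_dir_deriv:
  assumes f: "jet_function U k f" and W: "\<And>a. jet_order a \<le> k \<Longrightarrow> jet_function U l (\<lambda>z. W z a)" and z: "z \<in> U"
  shows "dir_deriv v (\<lambda>z. dir_deriv (W z) f z) z =
    (\<Sum>a | jet_order a \<le> k. dir_deriv v (\<lambda>z. W z a) z * coord_partial a f z) +
    (\<Sum>a | jet_order a \<le> k. \<Sum>b | jet_order b \<le> k. W z a * v b * coord_partial b (coord_partial a f) z)"
proof -
  have W': "jet_function U (max k l) (\<lambda>z. W z a)" if "jet_order a \<le> k" for a
    by (rule jet_function_mono[OF W[OF that]]) simp
  have f': "jet_function U (max k l) (coord_partial a f)" for a
    by (rule jet_function_mono[OF jet_function_coord_partial[OF f]]) simp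
  have "dir_deriv v (\<lambda>z. dir_deriv (W z) f z) z =
      dir_deriv v (\<lambda>z. \<Sum>a | jet_order a \<le> k. W z a * coord_partial a f z) z"
    by (rule dir_deriv_cong[OF dir_deriv_eq[OF f] z])
  also have "\<dots> = (\<Sum>a | jet_order a \<le> k. dir_deriv v (\<lambda>z. W z a * coord_partial a f z) z)"
    by (rule dir_deriv_sum[where k = "max k l", OF _ z], rule jet_function_mult[OF W' f']) simp
  also have "\<dots> = (\<Sum>a | jet_order a \<le> k. dir_deriv v (\<lambda>z. W z a) z * coord_partial a f z +
      (\<Sum>b | jet_order b \<le> k. W z a * v b * coord_partial b (coord_partial a f) z))"
  proof (rule sum.cong[OF refl])
    fix a :: "('n, 'm) coord" assume "a \<in> {a. jet_order a \<le> k}"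
    then have "jet_order a \<le> k" by simp
    from dir_deriv_mult[OF W'[OF this] f' z]
    have "dir_deriv v (\<lambda>z. W z a * coord_partial a f z) z =
      dir_deriv v (\<lambda>z. W z a) z * coord_partial a f z + W z a * dir_deriv v (coord_partial a f) z" .
    then show "dir_deriv v (\<lambda>z. W z a * coord_partial a f z) z =
      dir_deriv v (\<lambda>z. W z a) z * coord_partial a f z +
      (\<Sum>b | jet_order b \<le> k. W z a * v b * coord_partial b (coord_partial a f) z)"
      by (simp only: dir_deriv_eq[OF jet_function_coord_partial[OF f] z] sum_distrib_left mult.assoc)
  qed
  also have "\<dots> = (\<Sum>a | jet_order a \<le> k. dir_deriv v (\<lambda>z. W z a) z * coord_partial a f z) +
    (\<Sum>a | jet_order a \<le> k. \<Sum>b | jet_order b \<le> k. W z a * v b * coord_partial b (coord_partial a f) z)"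
    by (rule sum.distrib)
  finally show ?thesis .
qed

text \<open>By Schwarz's theorem the second-order terms of the two compositions agree, which leaves
  the components of the Lie bracket.\<close>

lemma field_commutator:
  assumes f: "jet_function U k f" and z: "z \<in> U"
    and V: "\<And>a. jet_order a \<le> k \<Longrightarrow> jet_function U l (\<lambda>z. V z a)"
    and W: "\<And>a. jet_order a \<le> k \<Longrightarrow> jet_function U l (\<lambda>z. W z a)"
  shows "dir_deriv (V z) (\<lambda>z. dir_deriv (W z) f z) z - dir_deriv (W z) (\<lambda>z. dir_deriv (V z) f z) z =
    (\<Sum>a | jet_order a \<le> k.
      (dir_deriv (V z) (\<lambda>z. W z a) z - dir_deriv (W z) (\<lambda>z. V z a) z) * coord_partial a f z)"
proof -
  have "(\<Sum>a | jet_order a \<le> k. \<Sum>b | jet_order b \<le> k. W z a * V z b * coord_partial b (coord_partial a f) z) =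
      (\<Sum>b | jet_order b \<le> k. \<Sum>a | jet_order a \<le> k. V z b * W z a * coord_partial a (coord_partial b f) z)"
    by (subst sum.swap) (simp only: coord_partial_commute[OF f z] mult.commute)
  moreover have "dir_deriv (V z) (\<lambda>z. dir_deriv (W z) f z) z =
    (\<Sum>a | jet_order a \<le> k. dir_deriv (V z) (\<lambda>z. W z a) z * coord_partial a f z) +
    (\<Sum>a | jet_order a \<le> k. \<Sum>b | jet_order b \<le> k. W z a * V z b * coord_partial b (coord_partial a f) z)"
    by (rule dir_deriv_dir_deriv[where W = W, OF f W z])
  moreover have "dir_deriv (W z) (\<lambda>z. dir_deriv (V z) f z) z =
    (\<Sum>a | jet_order a \<le> k. dir_deriv (W z) (\<lambda>z. V z a) z * coord_partial a f z) +
    (\<Sum>a | jet_order a \<le> k. \<Sum>b | jet_order b \<le> k. V z a * W z b * coord_partial b (coord_partial a f) z)"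
    by (rule dir_deriv_dir_deriv[where W = V, OF f V z])
  ultimately show ?thesis
    by (simp only: left_diff_distrib sum_subtractf)
qed

lemma field_commute:
  assumes "jet_function U k f" "z \<in> U"
    and "\<And>a. jet_order a \<le> k \<Longrightarrow> jet_function U l (\<lambda>z. V z a)"
    and "\<And>a. jet_order a \<le> k \<Longrightarrow> jet_function U l (\<lambda>z. W z a)"
    and "\<And>a. jet_order a \<le> k \<Longrightarrow> dir_deriv (V z) (\<lambda>z. W z a) z = dir_deriv (W z) (\<lambda>z. V z a) z"
  shows "dir_deriv (V z) (\<lambda>z. dir_deriv (W z) f z) z = dir_deriv (W z) (\<lambda>z. dir_deriv (V z) f z) z"
proof -
  have "dir_deriv (V z) (\<lambda>z. dir_deriv (W z) f z) z - dir_deriv (W z) (\<lambda>z. dir_deriv (V z) f z) z =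
    (\<Sum>a | jet_order a \<le> k.
      (dir_deriv (V z) (\<lambda>z. W z a) z - dir_deriv (W z) (\<lambda>z. V z a) z) * coord_partial a f z)"
    by (rule field_commutator[where V = V and W = W, OF assms(1-4)])
  also have "\<dots> = 0" by (rule sum.neutral) (simp add: assms(5))
  finally show ?thesis by simp
qed

section \<open>Total derivatives and multi-indices\<close>

lemma jet_function_total_vec:
  assumes "jet_order a \<le> k"
  shows "jet_function U (Suc k) (\<lambda>z. total_vec i z a)"
proof (cases a)
  case (Y \<sigma> I)
  then show ?thesis using assms by (simp add: jet_function_coord)
qed simp

lemma jet_function_total:
  assumes "jet_function U k f"
  shows "jet_function U (Suc k) (\<lambda>z. dir_deriv (total_vec i z) f z)"
  by (rule jet_function_dir_deriv[OF assms jet_function_total_vec]) simp_all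

lemma dir_deriv_coord: "dir_deriv v (\<lambda>z. z a) z = v a"
proof -
  have "((\<lambda>t. z a + t * v a) has_real_derivative v a) (at 0)"
    by (auto intro!: derivative_eq_intros)
  then show ?thesis unfolding dir_deriv_def by (rule DERIV_imp_deriv)
qed

text \<open>The component of d_j along y_I is the coordinate with index I + j, and d_i of that
  coordinate has index I + j + i; multisets make this symmetric in i and j.\<close>

lemma total_commute:
  assumes "jet_function U k f" "z \<in> U"
  shows "dir_deriv (total_vec i z) (\<lambda>z. dir_deriv (total_vec j z) f z) z =
    dir_deriv (total_vec j z) (\<lambda>z. dir_deriv (total_vec i z) f z) z"
proof (rule field_commute[OF assms jet_function_total_vec jet_function_total_vec])
  fix a :: "('n, 'm) coord"
  show "dir_deriv (total_vec i z) (\<lambda>z. total_vec j z a) z = dir_deriv (total_vec j z) (\<lambda>z. total_vec i z a) z"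
    by (cases a) (simp_all add: dir_deriv_coord add_mset_commute)
qed

abbreviation total_list :: "'n list \<Rightarrow> (('n, 'm) jet \<Rightarrow> real) \<Rightarrow> ('n, 'm) jet \<Rightarrow> real" where
  "total_list is f \<equiv> foldr (\<lambda>i g z. dir_deriv (total_vec i z) g z) is f"

lemma jet_function_total_list: "jet_function U k f \<Longrightarrow> jet_function U (k + length is) (total_list is f)"
  by (induction "is") (simp_all add: jet_function_total)

lemma total_list_cong:
  assumes "\<And>z. z \<in> U \<Longrightarrow> f z = g z" "z \<in> U"
  shows "total_list is f z = total_list is g z"
  using assms(2)
proof (induction "is" arbitrary: z)
  case (Cons i "is")
  show ?case by (simp, rule dir_deriv_cong[OF Cons.IH Cons.prems])
qed (simp add: assms)

lemma total_list_Cons_commute: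
  assumes f: "jet_function U k f" and z: "z \<in> U"
  shows "total_list is (\<lambda>z. dir_deriv (total_vec i z) f z) z = dir_deriv (total_vec i z) (total_list is f) z"
  using z
proof (induction "is" arbitrary: z)
  case (Cons j "is")
  have "total_list (j # is) (\<lambda>z. dir_deriv (total_vec i z) f z) z =
      dir_deriv (total_vec j z) (\<lambda>z. dir_deriv (total_vec i z) (total_list is f) z) z"
    by (simp, rule dir_deriv_cong[OF Cons.IH Cons.prems])
  also have "\<dots> = dir_deriv (total_vec i z) (\<lambda>z. dir_deriv (total_vec j z) (total_list is f) z) z"
    by (rule total_commute[OF jet_function_total_list[OF f] Cons.prems])
  finally show ?case by simp
qed simp

text \<open>\<open>insort\<close> may place the new index inside the list; commutation carries its
  derivative to the outermost place.\<close>

lemma total_list_insort: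
  assumes f: "jet_function U k f" and z: "z \<in> U"
  shows "total_list (insort i is) f z = dir_deriv (total_vec i z) (total_list is f) z"
  using z
proof (induction "is" arbitrary: z)
  case (Cons j "is")
  show ?case
  proof (cases "i \<le> j")
    case False
    have "total_list (insort i (j # is)) f z =
        dir_deriv (total_vec j z) (\<lambda>z. dir_deriv (total_vec i z) (total_list is f) z) z"
      using False by (simp, intro dir_deriv_cong[OF Cons.IH Cons.prems])
    also have "\<dots> = dir_deriv (total_vec i z) (\<lambda>z. dir_deriv (total_vec j z) (total_list is f) z) z"
      by (rule total_commute[OF jet_function_total_list[OF f] Cons.prems])
    finally show ?thesis by simp
  qed simp
qed simp

lemma total_deriv_empty [simp]: "total_deriv {#} f = f"
  by (simp add: total_deriv_def)

lemma length_sorted_list_of_multiset: "length (sorted_list_of_multiset I) = size I"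
  by (metis mset_sorted_list_of_multiset size_mset)

lemma jet_function_total_deriv: "jet_function U k f \<Longrightarrow> jet_function U (k + size I) (total_deriv I f)"
  unfolding total_deriv_def using jet_function_total_list[of k f "sorted_list_of_multiset I"]
  by (simp add: length_sorted_list_of_multiset)

lemma total_deriv_cong:
  assumes "\<And>z. z \<in> U \<Longrightarrow> f z = g z" "z \<in> U"
  shows "total_deriv I f z = total_deriv I g z"
  unfolding total_deriv_def by (rule total_list_cong[OF assms])

text \<open>Together with the primed variant, this lets an index added to a multi-index act as the
  outermost or as the innermost derivative, so later inductions over multi-indices can avoid sorted
  lists.\<close>

lemma total_deriv_add_mset:
  assumes "jet_function U k f" "z \<in> U"
  shows "total_deriv (add_mset i I) f z = dir_deriv (total_vec i z) (total_deriv I f) z"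
  unfolding total_deriv_def sorted_list_of_multiset_insert by (rule total_list_insort[OF assms])

lemma total_deriv_add_mset':
  assumes "jet_function U k f" "z \<in> U"
  shows "total_deriv (add_mset i I) f z = total_deriv I (\<lambda>z. dir_deriv (total_vec i z) f z) z"
  unfolding total_deriv_add_mset[OF assms] unfolding total_deriv_def
  by (rule total_list_Cons_commute[OF assms, symmetric])

lemma total_deriv_zero [simp]: "total_deriv I (\<lambda>z :: ('n, 'm) jet. 0) = (\<lambda>z. 0)"
proof -
  have "total_list is (\<lambda>z. 0) = (\<lambda>z. 0)" for "is"
    by (induction "is") simp_all
  then show ?thesis by (simp add: total_deriv_def)
qed

lemma total_deriv_add:
  assumes f: "jet_function U k f" and g: "jet_function U k g" and "z \<in> U"
  shows "total_deriv I (\<lambda>z. f z + g z) z = total_deriv I f z + total_deriv I g z"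
  using assms(3)
proof (induction I arbitrary: z)
  case (add i I)
  have "total_deriv (add_mset i I) (\<lambda>z. f z + g z) z =
      dir_deriv (total_vec i z) (total_deriv I (\<lambda>z. f z + g z)) z"
    by (rule total_deriv_add_mset[OF jet_function_add[OF f g] add.prems])
  also have "\<dots> = dir_deriv (total_vec i z) (\<lambda>z. total_deriv I f z + total_deriv I g z) z"
    by (rule dir_deriv_cong[OF add.IH add.prems])
  also have "\<dots> = total_deriv (add_mset i I) f z + total_deriv (add_mset i I) g z"
    unfolding total_deriv_add_mset[OF f add.prems] total_deriv_add_mset[OF g add.prems]
    by (rule dir_deriv_add[OF jet_function_total_deriv[OF f] jet_function_total_deriv[OF g] add.prems])
  finally show ?case .
qed simp

lemma total_deriv_cmult:
  assumes f: "jet_function U k f" and "z \<in> U"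
  shows "total_deriv I (\<lambda>z. c * f z) z = c * total_deriv I f z"
  using assms(2)
proof (induction I arbitrary: z)
  case (add i I)
  have "total_deriv (add_mset i I) (\<lambda>z. c * f z) z = dir_deriv (total_vec i z) (total_deriv I (\<lambda>z. c * f z)) z"
    by (rule total_deriv_add_mset[OF jet_function_mult[OF jet_function_const f] add.prems])
  also have "\<dots> = dir_deriv (total_vec i z) (\<lambda>z. c * total_deriv I f z) z"
    by (rule dir_deriv_cong[OF add.IH add.prems])
  also have "\<dots> = c * total_deriv (add_mset i I) f z"
    unfolding total_deriv_add_mset[OF f add.prems]
    by (rule dir_deriv_cmult[OF jet_function_total_deriv[OF f] add.prems])
  finally show ?case .
qed simp

lemma total_deriv_sum:
  assumes "\<And>i. i \<in> A \<Longrightarrow> jet_function U k (f i)" "z \<in> U"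
  shows "total_deriv I (\<lambda>z. \<Sum>i\<in>A. f i z) z = (\<Sum>i\<in>A. total_deriv I (f i) z)"
  using assms(1)
proof (induction A rule: infinite_finite_induct)
  case (insert i A)
  have "total_deriv I (\<lambda>z. f i z + (\<Sum>i\<in>A. f i z)) z = total_deriv I (f i) z + total_deriv I (\<lambda>z. \<Sum>i\<in>A. f i z) z"
    by (rule total_deriv_add[OF _ _ assms(2)]) (use insert.prems in \<open>auto intro!: jet_function_sum\<close>)
  with insert show ?case by simp
qed auto

text \<open>The commutator of \<partial>/\<partial>y_I with d_i comes from the component of d_i
  along y_J, the coordinate with index J + i: its derivative is 1 exactly when J + i = I. So the
  multi-index is lowered by i, and there is no extra term if i does not occur in I.\<close>

lemma coord_partial_total:
  assumes f: "jet_function U k f" and z: "z \<in> U"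
  shows "coord_partial (Y \<sigma> I) (\<lambda>z. dir_deriv (total_vec i z) f z) z =
    dir_deriv (total_vec i z) (coord_partial (Y \<sigma> I) f) z +
    (if i \<in># I then coord_partial (Y \<sigma> (I - {#i#})) f z else 0)"
proof -
  have unit: "jet_function U (Suc k) (\<lambda>z. unit_vec (Y \<sigma> I) a)" for a by simp
  have "dir_deriv (unit_vec (Y \<sigma> I)) (\<lambda>z. dir_deriv (total_vec i z) f z) z -
      dir_deriv (total_vec i z) (\<lambda>z. dir_deriv (unit_vec (Y \<sigma> I)) f z) z =
      (\<Sum>a | jet_order a \<le> k.
        (dir_deriv (unit_vec (Y \<sigma> I)) (\<lambda>z. total_vec i z a) z -
         dir_deriv (total_vec i z) (\<lambda>z. unit_vec (Y \<sigma> I) a) z) * coord_partial a f z)"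
    by (rule field_commutator[OF f z unit jet_function_total_vec])
  also have "\<dots> = (\<Sum>a | jet_order a \<le> k.
      if i \<in># I \<and> a = Y \<sigma> (I - {#i#}) then coord_partial a f z else 0)"
  proof (rule sum.cong[OF refl])
    fix a :: "('n, 'm) coord"
    show "(dir_deriv (unit_vec (Y \<sigma> I)) (\<lambda>z. total_vec i z a) z -
         dir_deriv (total_vec i z) (\<lambda>z. unit_vec (Y \<sigma> I) a) z) * coord_partial a f z =
      (if i \<in># I \<and> a = Y \<sigma> (I - {#i#}) then coord_partial a f z else 0)"
    proof (cases a)
      case (Y \<tau> J)
      have "add_mset i J = I \<longleftrightarrow> i \<in># I \<and> J = I - {#i#}"
        by (metis add_mset_remove_trivial insert_DiffM union_single_eq_member)
      then show ?thesis
        by (auto simp: Y dir_deriv_coord unit_vec_def)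
    qed simp
  qed
  also have "\<dots> = (if i \<in># I then coord_partial (Y \<sigma> (I - {#i#})) f z else 0)"
  \<comment> \<open>A lowered multi-index of size above \<open>k\<close> is missing from the sum,
    but then its partial is zero.\<close>
  proof (cases "i \<in># I \<and> k < jet_order (Y \<sigma> (I - {#i#}))")
    case True
    then show ?thesis
      using coord_partial_high_order[OF f _ z, of "Y \<sigma> (I - {#i#})"] by (auto intro!: sum.neutral)
  next
    case False
    then show ?thesis
      using sum.delta[OF finite_jet_order_le, of "Y \<sigma> (I - {#i#})" "\<lambda>a. coord_partial a f z" k]
      by (cases "i \<in># I") (simp_all add: not_less cong: if_cong)
  qed
  finally show ?thesis
    unfolding coord_partial_dir_deriv[symmetric] by simp
qed

section \<open>The Euler operator and its bilinear form\<close>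

definition euler_form :: "'m \<Rightarrow> (('n, 'm) jet \<Rightarrow> real) \<Rightarrow> (('n, 'm) jet \<Rightarrow> real) \<Rightarrow> ('n, 'm) jet \<Rightarrow> real" where
  "euler_form \<sigma> f g z =
     Sum_any (\<lambda>I. (-1) ^ size I * total_deriv I (\<lambda>z. coord_partial (Y \<sigma> I) f z * g z) z)"

definition euler :: "'m \<Rightarrow> (('n, 'm) jet \<Rightarrow> real) \<Rightarrow> ('n, 'm) jet \<Rightarrow> real" where
  "euler \<sigma> f z = Sum_any (\<lambda>I. (-1) ^ size I * total_deriv I (coord_partial (Y \<sigma> I) f) z)"

lemma euler_eq_form: "euler \<sigma> f = euler_form \<sigma> f (\<lambda>z. 1)"
  by (simp add: euler_def euler_form_def fun_eq_iff)

text \<open>The cutoff \<open>N\<close> may be any number not below the order of \<open>f\<close>,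
  so sums for functions of different orders can be brought to one index set.\<close>

lemma euler_form_eq:
  assumes f: "jet_function U k f" and z: "z \<in> U" and "k \<le> N"
  shows "euler_form \<sigma> f g z =
    (\<Sum>I | size I \<le> N. (-1) ^ size I * total_deriv I (\<lambda>z. coord_partial (Y \<sigma> I) f z * g z) z)"
  unfolding euler_form_def
proof (rule Sum_any.expand_superset[OF finite_multiset_size_le], rule subsetI)
  fix I :: "'n multiset"
  assume I: "I \<in> {I. (-1) ^ size I * total_deriv I (\<lambda>z. coord_partial (Y \<sigma> I) f z * g z) z \<noteq> 0}"
  show "I \<in> {I. size I \<le> N}"
  proof (rule ccontr)
    assume "I \<notin> {I. size I \<le> N}"
    then have "k < jet_order (Y \<sigma> I)" using \<open>k \<le> N\<close> by simp
    then have "total_deriv I (\<lambda>z. coord_partial (Y \<sigma> I) f z * g z) z = total_deriv I (\<lambda>z. 0) z"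
      by (intro total_deriv_cong[OF _ z]) (simp add: coord_partial_high_order[OF f])
    with I show False by simp
  qed
qed

lemma euler_form_cong:
  assumes "\<And>z. z \<in> U \<Longrightarrow> f z = f' z" "\<And>z. z \<in> U \<Longrightarrow> g z = g' z" "z \<in> U"
  shows "euler_form \<sigma> f g z = euler_form \<sigma> f' g' z"
proof -
  have "total_deriv I (\<lambda>z. coord_partial (Y \<sigma> I) f z * g z) z =
      total_deriv I (\<lambda>z. coord_partial (Y \<sigma> I) f' z * g' z) z" for I
    by (rule total_deriv_cong[OF arg_cong2[where f = "(*)"] assms(3)])
      (rule coord_partial_cong[OF assms(1)], assumption+, rule assms(2), assumption)
  then show ?thesis by (simp only: euler_form_def)
qed

text \<open>Partials keep the order at \<open>k\<close>, and the at most \<open>k\<close> total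
  derivatives add one each, hence \<open>2 * k\<close>.\<close>

lemma jet_function_euler_form:
  assumes f: "jet_function U k f" and g: "jet_function U k g"
  shows "jet_function U (2 * k) (euler_form \<sigma> f g)"
proof (rule jet_function_cong)
  have "jet_function U (2 * k) (total_deriv I (\<lambda>z. coord_partial (Y \<sigma> I) f z * g z))" if "size I \<le> k" for I
    by (rule jet_function_mono[OF jet_function_total_deriv[OF
        jet_function_mult[OF jet_function_coord_partial[OF f] g]]]) (use that in simp)
  then show "jet_function U (2 * k)
      (\<lambda>z. \<Sum>I | size I \<le> k. (-1) ^ size I * total_deriv I (\<lambda>z. coord_partial (Y \<sigma> I) f z * g z) z)"
    by (intro jet_function_sum jet_function_mult jet_function_const) simp
  show "(\<Sum>I | size I \<le> k. (-1) ^ size I * total_deriv I (\<lambda>z. coord_partial (Y \<sigma> I) f z * g z) z) =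
      euler_form \<sigma> f g z" if "z \<in> U" for z
    by (rule euler_form_eq[OF f that order_refl, symmetric])
qed

lemma jet_function_euler: "jet_function U k f \<Longrightarrow> jet_function U (2 * k) (euler \<sigma> f)"
  unfolding euler_eq_form by (rule jet_function_euler_form[OF _ jet_function_const])

text \<open>Reindexing by I = J + i, which lowers the cutoff by one. It brings the commutator terms
  of the integration by parts to the index set of the others.\<close>

lemma sum_add_mset:
  fixes h :: "'n multiset \<Rightarrow> real"
  shows "(\<Sum>I | size I \<le> Suc N. if i \<in># I then h (I - {#i#}) else 0) = (\<Sum>J | size J \<le> N. h J)"
proof -
  have "(\<Sum>J | size J \<le> N. h J) = (\<Sum>I \<in> add_mset i ` {J. size J \<le> N}. h (I - {#i#}))"
    by (subst sum.reindex) (simp_all add: inj_on_def)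
  also have "\<dots> = (\<Sum>I \<in> add_mset i ` {J. size J \<le> N}. if i \<in># I then h (I - {#i#}) else 0)"
    by (rule sum.cong) auto
  also have "\<dots> = (\<Sum>I | size I \<le> Suc N. if i \<in># I then h (I - {#i#}) else 0)"
  proof (rule sum.mono_neutral_left[OF finite_multiset_size_le])
    show "\<forall>I\<in>{I. size I \<le> Suc N} - add_mset i ` {J. size J \<le> N}. (if i \<in># I then h (I - {#i#}) else 0) = 0"
    proof
      fix I assume I: "I \<in> {I. size I \<le> Suc N} - add_mset i ` {J. size J \<le> N}"
      have "i \<notin># I"
      proof
        assume "i \<in># I"
        then obtain J where "I = add_mset i J" by (rule mset_add)
        with I show False by auto
      qed
      then show "(if i \<in># I then h (I - {#i#}) else 0) = 0" by simp
    qed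
  qed auto
  finally show ?thesis by simp
qed

text \<open>Integration by parts: the terms produced by commuting \<open>\<partial>/\<partial>y\<^sup>\<sigma>\<^sub>I\<close> with \<open>d\<^sub>i\<close> telescope against the Leibniz rule.\<close>

lemma euler_form_total:
  assumes f: "jet_function U k f" and g: "jet_function U l g" and z: "z \<in> U"
  shows "euler_form \<sigma> (\<lambda>z. dir_deriv (total_vec i z) f z) g z =
    - euler_form \<sigma> f (\<lambda>z. dir_deriv (total_vec i z) g z) z"
proof -
  let ?D = "\<lambda>f z. dir_deriv (total_vec i z) f z"
  let ?p = "\<lambda>I. coord_partial (Y \<sigma> I)"
  define q where "q = k + l"
  have f': "jet_function U q f" and g': "jet_function U q g"
    by (rule jet_function_mono[OF f] jet_function_mono[OF g], simp add: q_def)+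
  have pf: "jet_function U q (?p I f)" for I
    by (rule jet_function_coord_partial[OF f'])
  have Dpf: "jet_function U (Suc q) (?D (?p I f))" for I
    by (rule jet_function_total[OF pf])
  have Dg: "jet_function U (Suc q) (?D g)"
    by (rule jet_function_total[OF g'])
  have g'': "jet_function U (Suc q) g" and pf'': "jet_function U (Suc q) (?p I f)" for I
    by (rule jet_function_mono[OF g'] jet_function_mono[OF pf], simp)+
  have "total_deriv I (\<lambda>z. ?p I (?D f) z * g z) z =
      (total_deriv (add_mset i I) (\<lambda>z. ?p I f z * g z) z - total_deriv I (\<lambda>z. ?p I f z * ?D g z) z) +
      (if i \<in># I then total_deriv (add_mset i (I - {#i#})) (\<lambda>z. ?p (I - {#i#}) f z * g z) z else 0)" for I
  proof -
    have "total_deriv I (\<lambda>z. ?p I (?D f) z * g z) z =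
        total_deriv I (\<lambda>z. ?D (?p I f) z * g z + (if i \<in># I then ?p (I - {#i#}) f z * g z else 0)) z"
      by (rule total_deriv_cong[OF _ z]) (simp add: coord_partial_total[OF f] distrib_right)
    also have "\<dots> = total_deriv I (\<lambda>z. ?D (?p I f) z * g z) z +
        total_deriv I (\<lambda>z. if i \<in># I then ?p (I - {#i#}) f z * g z else 0) z"
      by (rule total_deriv_add[OF jet_function_mult[OF Dpf g''] _ z])
        (cases "i \<in># I"; simp add: jet_function_mult[OF pf'' g''])
    also have "total_deriv I (\<lambda>z. ?D (?p I f) z * g z) z =
        total_deriv (add_mset i I) (\<lambda>z. ?p I f z * g z) z - total_deriv I (\<lambda>z. ?p I f z * ?D g z) z"
    proof -
      have "total_deriv (add_mset i I) (\<lambda>z. ?p I f z * g z) z = total_deriv I (?D (\<lambda>z. ?p I f z * g z)) z"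
        by (rule total_deriv_add_mset'[OF jet_function_mult[OF pf g'] z])
      also have "\<dots> = total_deriv I (\<lambda>z. ?D (?p I f) z * g z + ?p I f z * ?D g z) z"
        by (rule total_deriv_cong[OF dir_deriv_mult[OF pf g'] z])
      also have "\<dots> = total_deriv I (\<lambda>z. ?D (?p I f) z * g z) z + total_deriv I (\<lambda>z. ?p I f z * ?D g z) z"
        by (rule total_deriv_add[OF jet_function_mult[OF Dpf g''] jet_function_mult[OF pf'' Dg] z])
      finally show ?thesis by simp
    qed
    also have "total_deriv I (\<lambda>z. if i \<in># I then ?p (I - {#i#}) f z * g z else 0) z =
        (if i \<in># I then total_deriv (add_mset i (I - {#i#})) (\<lambda>z. ?p (I - {#i#}) f z * g z) z else 0)"
      by simp
    finally show ?thesis .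
  qed
  note expand = this
  let ?h = "\<lambda>J. (-1) ^ size J * total_deriv (add_mset i J) (\<lambda>z. ?p J f z * g z) z"
  have "euler_form \<sigma> (?D f) g z =
      (\<Sum>I | size I \<le> Suc q. (-1) ^ size I * total_deriv I (\<lambda>z. ?p I (?D f) z * g z) z)"
    by (rule euler_form_eq[OF jet_function_total[OF f'] z order_refl])
  also have "\<dots> = (\<Sum>I | size I \<le> Suc q. (?h I - (-1) ^ size I * total_deriv I (\<lambda>z. ?p I f z * ?D g z) z) -
      (if i \<in># I then ?h (I - {#i#}) else 0))"
  proof (rule sum.cong[OF refl])
    fix I
    show "(-1) ^ size I * total_deriv I (\<lambda>z. ?p I (?D f) z * g z) z =
      (?h I - (-1) ^ size I * total_deriv I (\<lambda>z. ?p I f z * ?D g z) z) -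
      (if i \<in># I then ?h (I - {#i#}) else 0)"
    proof (cases "i \<in># I")
      case True
      \<comment> \<open>Removing i shortens I by one, which turns the commutator term into a copy of
        \<open>?h\<close> with opposite sign.\<close>
      then have "size I = Suc (size (I - {#i#}))"
        by (metis size_Suc_Diff1)
      then have "(-1::real) ^ size I = - ((-1) ^ size (I - {#i#}))" by simp
      then show ?thesis unfolding expand using True by (simp add: algebra_simps)
    next
      case False
      then show ?thesis unfolding expand by (simp add: algebra_simps)
    qed
  qed
  also have "\<dots> = (\<Sum>I | size I \<le> Suc q. ?h I) -
      (\<Sum>I | size I \<le> Suc q. (-1) ^ size I * total_deriv I (\<lambda>z. ?p I f z * ?D g z) z) - (\<Sum>I | size I \<le> q. ?h I)"
    by (simp only: sum_subtractf sum_add_mset[where h = ?h])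
  \<comment> \<open>Since \<open>f\<close> has order at most \<open>q\<close>, the terms of size q +
    1 vanish, and the two sums of \<open>?h\<close> cancel.\<close>
  also have "(\<Sum>I | size I \<le> Suc q. ?h I) = (\<Sum>I | size I \<le> q. ?h I)"
  proof (rule sum.mono_neutral_right[OF finite_multiset_size_le])
    show "\<forall>I\<in>{I. size I \<le> Suc q} - {I. size I \<le> q}. ?h I = 0"
    proof
      fix I :: "'n multiset" assume "I \<in> {I. size I \<le> Suc q} - {I. size I \<le> q}"
      then have "q < jet_order (Y \<sigma> I)" by simp
      then have "total_deriv (add_mset i I) (\<lambda>z. ?p I f z * g z) z = total_deriv (add_mset i I) (\<lambda>z. 0) z"
        by (intro total_deriv_cong[OF _ z]) (simp add: coord_partial_high_order[OF f'])
      then show "?h I = 0" by simp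
    qed
  qed auto
  also have "(\<Sum>I | size I \<le> Suc q. (-1) ^ size I * total_deriv I (\<lambda>z. ?p I f z * ?D g z) z) =
      euler_form \<sigma> f (?D g) z"
    by (rule euler_form_eq[OF f' z, symmetric]) simp
  finally show ?thesis by simp
qed

text \<open>One index is moved per step, each at the cost of a sign; \<open>g\<close> is generalised
  in the induction because it collects the total derivatives.\<close>

lemma euler_form_total_deriv:
  assumes f: "jet_function U k f" and g: "jet_function U l g" and z: "z \<in> U"
  shows "euler_form \<sigma> (total_deriv K f) g z = (-1) ^ size K * euler_form \<sigma> f (total_deriv K g) z"
  using g
proof (induction K arbitrary: g l)
  case empty
  then show ?case by simp
next
  case (add i K)
  have "euler_form \<sigma> (total_deriv (add_mset i K) f) g z =
      euler_form \<sigma> (\<lambda>z. dir_deriv (total_vec i z) (total_deriv K f) z) g z"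
    by (rule euler_form_cong[OF total_deriv_add_mset[OF f] refl z])
  also have "\<dots> = - euler_form \<sigma> (total_deriv K f) (\<lambda>z. dir_deriv (total_vec i z) g z) z"
    by (rule euler_form_total[OF jet_function_total_deriv[OF f] add.prems z])
  also have "\<dots> = - ((-1) ^ size K * euler_form \<sigma> f (total_deriv K (\<lambda>z. dir_deriv (total_vec i z) g z)) z)"
    by (simp only: add.IH[OF jet_function_total[OF add.prems]])
  also have "euler_form \<sigma> f (total_deriv K (\<lambda>z. dir_deriv (total_vec i z) g z)) z =
      euler_form \<sigma> f (total_deriv (add_mset i K) g) z"
    by (rule euler_form_cong[OF refl total_deriv_add_mset'[OF add.prems, symmetric] z])
  finally show ?case by simp
qed

lemma euler_form_add_right:
  assumes f: "jet_function U k f" and g: "jet_function U l g" and h: "jet_function U l h" and z: "z \<in> U"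
  shows "euler_form \<sigma> f (\<lambda>z. g z + h z) z = euler_form \<sigma> f g z + euler_form \<sigma> f h z"
proof -
  define q where "q = k + l"
  have j: "jet_function U q (coord_partial (Y \<sigma> I) f)" "jet_function U q g" "jet_function U q h" for I
    by (rule jet_function_mono[OF jet_function_coord_partial[OF f]] jet_function_mono[OF g]
      jet_function_mono[OF h], simp add: q_def)+
  have "total_deriv I (\<lambda>z. coord_partial (Y \<sigma> I) f z * (g z + h z)) z =
      total_deriv I (\<lambda>z. coord_partial (Y \<sigma> I) f z * g z) z + total_deriv I (\<lambda>z. coord_partial (Y \<sigma> I) f z * h z) z" for I
    unfolding distrib_left by (rule total_deriv_add[OF jet_function_mult[OF j(1,2)] jet_function_mult[OF j(1,3)] z])
  then show ?thesis
    unfolding euler_form_eq[OF f z order_refl] by (simp only: distrib_left sum.distrib)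
qed

lemma euler_form_add_left:
  assumes f: "jet_function U k f" and g: "jet_function U k g" and h: "jet_function U l h" and z: "z \<in> U"
  shows "euler_form \<sigma> (\<lambda>z. f z + g z) h z = euler_form \<sigma> f h z + euler_form \<sigma> g h z"
proof -
  define q where "q = k + l"
  have j: "jet_function U q (coord_partial (Y \<sigma> I) f)" "jet_function U q (coord_partial (Y \<sigma> I) g)"
    "jet_function U q h" for I
    by (rule jet_function_mono[OF jet_function_coord_partial[OF f]]
      jet_function_mono[OF jet_function_coord_partial[OF g]] jet_function_mono[OF h], simp add: q_def)+
  have "total_deriv I (\<lambda>z. coord_partial (Y \<sigma> I) (\<lambda>z. f z + g z) z * h z) z =
      total_deriv I (\<lambda>z. coord_partial (Y \<sigma> I) f z * h z) z + total_deriv I (\<lambda>z. coord_partial (Y \<sigma> I) g z * h z) z" for I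
  proof -
    have "coord_partial (Y \<sigma> I) (\<lambda>z. f z + g z) z * h z =
        coord_partial (Y \<sigma> I) f z * h z + coord_partial (Y \<sigma> I) g z * h z" if "z \<in> U" for z
      by (simp only: coord_partial_dir_deriv dir_deriv_add[OF f g that] distrib_right)
    from total_deriv_cong[OF this z]
    have "total_deriv I (\<lambda>z. coord_partial (Y \<sigma> I) (\<lambda>z. f z + g z) z * h z) z =
      total_deriv I (\<lambda>z. coord_partial (Y \<sigma> I) f z * h z + coord_partial (Y \<sigma> I) g z * h z) z" .
    then show ?thesis
      using total_deriv_add[OF jet_function_mult[OF j(1,3)] jet_function_mult[OF j(2,3)] z] by (simp only:)
  qed
  then show ?thesis
    unfolding euler_form_eq[OF f z order_refl] euler_form_eq[OF g z order_refl]
      euler_form_eq[OF jet_function_add[OF f g] z order_refl]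
    by (simp only: distrib_left sum.distrib)
qed

lemma euler_form_zero_left [simp]: "euler_form \<sigma> (\<lambda>z. 0) g z = 0"
proof -
  have "coord_partial a (\<lambda>z. 0) z = 0" for a and z :: "('n, 'm) jet"
    by (simp add: coord_partial_def)
  then show ?thesis by (simp add: euler_form_def)
qed

lemma euler_form_zero_right [simp]: "euler_form \<sigma> f (\<lambda>z. 0) z = 0"
  by (simp add: euler_form_def)

lemma euler_form_sum_left:
  assumes "\<And>i. i \<in> A \<Longrightarrow> jet_function U k (f i)" and g: "jet_function U l g" and z: "z \<in> U"
  shows "euler_form \<sigma> (\<lambda>z. \<Sum>i\<in>A. f i z) g z = (\<Sum>i\<in>A. euler_form \<sigma> (f i) g z)"
  using assms(1)
proof (induction A rule: infinite_finite_induct)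
  case (insert i A)
  have "euler_form \<sigma> (\<lambda>z. f i z + (\<Sum>i\<in>A. f i z)) g z = euler_form \<sigma> (f i) g z + euler_form \<sigma> (\<lambda>z. \<Sum>i\<in>A. f i z) g z"
    by (rule euler_form_add_left[OF _ _ g z]) (use insert.prems in \<open>auto intro!: jet_function_sum\<close>)
  with insert show ?case by simp
qed simp_all

lemma euler_form_sum_right:
  assumes f: "jet_function U l f" and "\<And>i. i \<in> A \<Longrightarrow> jet_function U k (g i)" and z: "z \<in> U"
  shows "euler_form \<sigma> f (\<lambda>z. \<Sum>i\<in>A. g i z) z = (\<Sum>i\<in>A. euler_form \<sigma> f (g i) z)"
  using assms(2)
proof (induction A rule: infinite_finite_induct)
  case (insert i A)
  have "euler_form \<sigma> f (\<lambda>z. g i z + (\<Sum>i\<in>A. g i z)) z = euler_form \<sigma> f (g i) z + euler_form \<sigma> f (\<lambda>z. \<Sum>i\<in>A. g i z) z"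
    by (rule euler_form_add_right[OF f _ _ z]) (use insert.prems in \<open>auto intro!: jet_function_sum\<close>)
  with insert show ?case by simp
qed simp_all

lemma euler_form_cmult_left:
  assumes f: "jet_function U k f" and g: "jet_function U l g" and z: "z \<in> U"
  shows "euler_form \<sigma> (\<lambda>z. c * f z) g z = c * euler_form \<sigma> f g z"
proof -
  have "total_deriv I (\<lambda>z. coord_partial (Y \<sigma> I) (\<lambda>z. c * f z) z * g z) z =
      c * total_deriv I (\<lambda>z. coord_partial (Y \<sigma> I) f z * g z) z" for I
  proof -
    have j: "jet_function U (k + l) (\<lambda>z. coord_partial (Y \<sigma> I) f z * g z)"
      by (rule jet_function_mult) (rule jet_function_mono[OF jet_function_coord_partial[OF f]]
        jet_function_mono[OF g], simp)+
    have "coord_partial (Y \<sigma> I) (\<lambda>z. c * f z) z * g z = c * (coord_partial (Y \<sigma> I) f z * g z)" if "z \<in> U" for z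
      by (simp only: coord_partial_dir_deriv dir_deriv_cmult[OF f that] mult.assoc)
    from total_deriv_cong[OF this z] show ?thesis
      by (simp only: total_deriv_cmult[OF j z])
  qed
  then show ?thesis
    unfolding euler_form_eq[OF f z order_refl] euler_form_eq[OF jet_function_mult[OF jet_function_const f] z order_refl]
    by (simp only: sum_distrib_left mult.left_commute)
qed

lemma euler_form_cmult_right:
  assumes f: "jet_function U k f" and g: "jet_function U l g" and z: "z \<in> U"
  shows "euler_form \<sigma> f (\<lambda>z. c * g z) z = c * euler_form \<sigma> f g z"
proof -
  have "total_deriv I (\<lambda>z. coord_partial (Y \<sigma> I) f z * (c * g z)) z =
      c * total_deriv I (\<lambda>z. coord_partial (Y \<sigma> I) f z * g z) z" for I
  proof -
    have j: "jet_function U (k + l) (\<lambda>z. coord_partial (Y \<sigma> I) f z * g z)"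
      by (rule jet_function_mult) (rule jet_function_mono[OF jet_function_coord_partial[OF f]]
        jet_function_mono[OF g], simp)+
    show ?thesis by (simp only: mult.left_commute[of _ c] total_deriv_cmult[OF j z])
  qed
  then show ?thesis
    unfolding euler_form_eq[OF f z order_refl] by (simp only: sum_distrib_left mult.left_commute)
qed

lemma euler_mult:
  assumes f: "jet_function U k f" and g: "jet_function U l g" and z: "z \<in> U"
  shows "euler \<sigma> (\<lambda>z. f z * g z) z = euler_form \<sigma> f g z + euler_form \<sigma> g f z"
proof -
  define q where "q = k + l"
  have j: "jet_function U q f" "jet_function U q g"
    by (rule jet_function_mono[OF f] jet_function_mono[OF g], simp add: q_def)+
  have "total_deriv I (coord_partial (Y \<sigma> I) (\<lambda>z. f z * g z)) z =
      total_deriv I (\<lambda>z. coord_partial (Y \<sigma> I) f z * g z) z + total_deriv I (\<lambda>z. coord_partial (Y \<sigma> I) g z * f z) z" for I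
  proof -
    have "coord_partial (Y \<sigma> I) (\<lambda>z. f z * g z) z =
        coord_partial (Y \<sigma> I) f z * g z + coord_partial (Y \<sigma> I) g z * f z" if "z \<in> U" for z
      by (simp only: coord_partial_dir_deriv dir_deriv_mult[OF j that] mult.commute)
    from total_deriv_cong[OF this z]
    have "total_deriv I (coord_partial (Y \<sigma> I) (\<lambda>z. f z * g z)) z =
      total_deriv I (\<lambda>z. coord_partial (Y \<sigma> I) f z * g z + coord_partial (Y \<sigma> I) g z * f z) z" .
    then show ?thesis
      using total_deriv_add[OF jet_function_mult[OF jet_function_coord_partial[OF j(1)] j(2)]
        jet_function_mult[OF jet_function_coord_partial[OF j(2)] j(1)] z] by (simp only:)
  qed
  then show ?thesis
    unfolding euler_eq_form euler_form_eq[OF j(1) z order_refl] euler_form_eq[OF j(2) z order_refl]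
      euler_form_eq[OF jet_function_mult[OF j] z order_refl] mult_1_right
    by (simp only: distrib_left sum.distrib)
qed

text \<open>Only the empty multi-index survives. Components of a vector field on Y have order zero,
  and this is the source of the term with \<partial>Q/\<partial>y in the second variation.\<close>

lemma euler_form_order_zero:
  assumes "jet_function U 0 f" "z \<in> U"
  shows "euler_form \<sigma> f g z = coord_partial (Y \<sigma> {#}) f z * g z"
  by (simp add: euler_form_eq[OF assms order_refl])

end

section \<open>Evolutionary fields\<close>

text \<open>The evolutionary field with characteristic \<open>Q\<close>. Unlike in
  \<open>prolong\<close>, the characteristic may depend on jets of any order, so variational
  identities can be stated for functions on jets without reference to fields on Y.\<close>

fun evolutionary :: "('m \<Rightarrow> ('n::{finite, linorder}, 'm::finite) jet \<Rightarrow> real) \<Rightarrow> ('n, 'm) jet \<Rightarrow> ('n, 'm) jvec" where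
  "evolutionary Q z (X i) = 0"
| "evolutionary Q z (Y \<sigma> I) = total_deriv I (Q \<sigma>) z"

lemma prolong_eq_evolutionary: "prolong \<xi> = evolutionary (\<lambda>\<sigma> z. snd (\<xi> (base_fibre z)) $ \<sigma>)"
proof (intro ext)
  show "prolong \<xi> z a = evolutionary (\<lambda>\<sigma> z. snd (\<xi> (base_fibre z)) $ \<sigma>) z a" for z a
    by (cases a) simp_all
qed

lemma sum_coord:
  fixes h :: "('n::{finite, linorder}, 'm::finite) coord \<Rightarrow> real"
  shows "(\<Sum>a | jet_order a \<le> k. h a) = (\<Sum>i\<in>UNIV. h (X i)) + (\<Sum>\<sigma>\<in>UNIV. \<Sum>I | size I \<le> k. h (Y \<sigma> I))"
proof -
  have "{a :: ('n, 'm) coord. jet_order a \<le> k} = range X \<union> (\<lambda>(\<sigma>, I). Y \<sigma> I) ` (UNIV \<times> {I. size I \<le> k})"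
  proof (intro equalityI subsetI)
    fix a :: "('n, 'm) coord"
    show "a \<in> {a. jet_order a \<le> k} \<Longrightarrow> a \<in> range X \<union> (\<lambda>(\<sigma>, I). Y \<sigma> I) ` (UNIV \<times> {I. size I \<le> k})"
      by (cases a) auto
  qed auto
  moreover have "(\<Sum>a\<in>range X \<union> (\<lambda>(\<sigma>, I). Y \<sigma> I) ` (UNIV \<times> {I. size I \<le> k}). h a) =
      (\<Sum>a\<in>range X. h a) + (\<Sum>a\<in>(\<lambda>(\<sigma>, I). Y \<sigma> I) ` (UNIV \<times> {I. size I \<le> k}). h a)"
    by (rule sum.union_disjoint) (auto simp: finite_multiset_size_le)
  moreover have "(\<Sum>a\<in>range X. h a) = (\<Sum>i\<in>UNIV. h (X i))"
    by (subst sum.reindex) (auto simp: inj_def)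
  moreover have "(\<Sum>a\<in>(\<lambda>(\<sigma>, I). Y \<sigma> I) ` (UNIV \<times> {I. size I \<le> k}). h a) =
      (\<Sum>\<sigma>\<in>UNIV. \<Sum>I | size I \<le> k. h (Y \<sigma> I))"
    by (subst sum.reindex) (auto simp: inj_on_def sum.cartesian_product case_prod_unfold)
  ultimately show ?thesis by simp
qed

context jet_region
begin

lemma jet_function_evolutionary:
  assumes "\<And>\<sigma>. jet_function U q (Q \<sigma>)" "jet_order a \<le> k"
  shows "jet_function U (q + k) (\<lambda>z. evolutionary Q z a)"
proof (cases a)
  case (Y \<sigma> I)
  have "jet_function U (q + k) (total_deriv I (Q \<sigma>))"
    by (rule jet_function_mono[OF jet_function_total_deriv[OF assms(1)]]) (use assms(2) Y in simp)
  then show ?thesis by (simp add: Y)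
qed simp

lemma jet_function_dir_deriv_evolutionary:
  assumes Q: "\<And>\<sigma>. jet_function U q (Q \<sigma>)" and f: "jet_function U k f"
  shows "jet_function U (q + k) (\<lambda>z. dir_deriv (evolutionary Q z) f z)"
  by (rule jet_function_dir_deriv[OF f jet_function_evolutionary[OF Q]]) simp_all

lemma dir_deriv_evolutionary:
  assumes f: "jet_function U k f" and z: "z \<in> U"
  shows "dir_deriv (evolutionary Q z) f z =
    (\<Sum>\<sigma>\<in>UNIV. \<Sum>I | size I \<le> k. total_deriv I (Q \<sigma>) z * coord_partial (Y \<sigma> I) f z)"
  by (simp add: dir_deriv_eq[OF f z] sum_coord)

text \<open>On the coordinate y_I both compositions give the total derivative of the characteristic
  with index I + i; on x they give zero. Commuting with d_i is what determines the higher components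
  of a prolongation.\<close>

lemma evolutionary_total_commute:
  assumes Q: "\<And>\<sigma>. jet_function U q (Q \<sigma>)" and f: "jet_function U k f" and z: "z \<in> U"
  shows "dir_deriv (evolutionary Q z) (\<lambda>z. dir_deriv (total_vec i z) f z) z =
    dir_deriv (total_vec i z) (\<lambda>z. dir_deriv (evolutionary Q z) f z) z"
proof (rule field_commute[OF f z, where V = "evolutionary Q" and W = "total_vec i" and l = "q + Suc k"])
  fix a :: "('n, 'm) coord" assume a: "jet_order a \<le> k"
  show "jet_function U (q + Suc k) (\<lambda>z. evolutionary Q z a)"
    by (rule jet_function_mono[OF jet_function_evolutionary[OF Q a]]) simp
  show "jet_function U (q + Suc k) (\<lambda>z. total_vec i z a)"
    by (rule jet_function_mono[OF jet_function_total_vec[OF a]]) simp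
  show "dir_deriv (evolutionary Q z) (\<lambda>z. total_vec i z a) z = dir_deriv (total_vec i z) (\<lambda>z. evolutionary Q z a) z"
    by (cases a) (simp_all add: dir_deriv_coord total_deriv_add_mset[OF Q z])
qed

lemma evolutionary_total_deriv_commute:
  assumes Q: "\<And>\<sigma>. jet_function U q (Q \<sigma>)" and f: "jet_function U k f" and z: "z \<in> U"
  shows "dir_deriv (evolutionary Q z) (total_deriv I f) z =
    total_deriv I (\<lambda>z. dir_deriv (evolutionary Q z) f z) z"
  using z
proof (induction I arbitrary: z)
  case (add i I)
  have "dir_deriv (evolutionary Q z) (total_deriv (add_mset i I) f) z =
      dir_deriv (evolutionary Q z) (\<lambda>z. dir_deriv (total_vec i z) (total_deriv I f) z) z"
    by (rule dir_deriv_cong[OF total_deriv_add_mset[OF f] add.prems])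
  also have "\<dots> = dir_deriv (total_vec i z) (\<lambda>z. dir_deriv (evolutionary Q z) (total_deriv I f) z) z"
    by (rule evolutionary_total_commute[OF Q jet_function_total_deriv[OF f] add.prems])
  also have "\<dots> = dir_deriv (total_vec i z) (total_deriv I (\<lambda>z. dir_deriv (evolutionary Q z) f z)) z"
    by (rule dir_deriv_cong[OF add.IH add.prems])
  also have "\<dots> = total_deriv (add_mset i I) (\<lambda>z. dir_deriv (evolutionary Q z) f z) z"
    by (rule total_deriv_add_mset[OF jet_function_dir_deriv_evolutionary[OF Q f] add.prems, symmetric])
  finally show ?case .
qed simp

text \<open>Integration by parts read backwards: the sign (-1)^|K| in E_\<tau>(L) is exactly the one
  produced by moving d_K into the other slot, so no signs remain. The counterpart for the left slot
  works in the same way.\<close>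

lemma euler_form_euler_right:
  assumes L: "jet_function U k L" and g: "jet_function U l g" and z: "z \<in> U"
  shows "euler_form \<sigma> g (euler \<tau> L) z =
    (\<Sum>K | size K \<le> k. euler_form \<sigma> (total_deriv K g) (coord_partial (Y \<tau> K) L) z)"
proof -
  note p = jet_function_coord_partial[OF L]
  have tp: "jet_function U (2 * k) (total_deriv K (coord_partial (Y \<tau> K) L))" if "size K \<le> k" for K
    by (rule jet_function_mono[OF jet_function_total_deriv[OF p]]) (use that in simp)
  have "euler_form \<sigma> g (euler \<tau> L) z =
      euler_form \<sigma> g (\<lambda>z. \<Sum>K | size K \<le> k. (-1) ^ size K * total_deriv K (coord_partial (Y \<tau> K) L) z) z"
    by (rule euler_form_cong[OF refl _ z])
      (simp only: euler_eq_form euler_form_eq[OF L _ order_refl] mult_1_right)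
  also have "\<dots> = (\<Sum>K | size K \<le> k. euler_form \<sigma> g (\<lambda>z. (-1) ^ size K * total_deriv K (coord_partial (Y \<tau> K) L) z) z)"
    by (rule euler_form_sum_right[where k = "2 * k", OF g _ z], rule jet_function_mult[OF jet_function_const tp]) simp
  also have "\<dots> = (\<Sum>K | size K \<le> k. euler_form \<sigma> (total_deriv K g) (coord_partial (Y \<tau> K) L) z)"
  proof (rule sum.cong[OF refl])
    fix K :: "'n multiset" assume "K \<in> {K. size K \<le> k}"
    show "euler_form \<sigma> g (\<lambda>z. (-1) ^ size K * total_deriv K (coord_partial (Y \<tau> K) L) z) z =
        euler_form \<sigma> (total_deriv K g) (coord_partial (Y \<tau> K) L) z"
      by (simp only: euler_form_cmult_right[OF g jet_function_total_deriv[OF p] z]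
          euler_form_total_deriv[OF g p z])
  qed
  finally show ?thesis .
qed

lemma euler_form_euler_left:
  assumes L: "jet_function U k L" and g: "jet_function U l g" and z: "z \<in> U"
  shows "euler_form \<sigma> (euler \<tau> L) g z =
    (\<Sum>K | size K \<le> k. euler_form \<sigma> (coord_partial (Y \<tau> K) L) (total_deriv K g) z)"
proof -
  note p = jet_function_coord_partial[OF L]
  have tp: "jet_function U (2 * k) (total_deriv K (coord_partial (Y \<tau> K) L))" if "size K \<le> k" for K
    by (rule jet_function_mono[OF jet_function_total_deriv[OF p]]) (use that in simp)
  have "euler_form \<sigma> (euler \<tau> L) g z =
      euler_form \<sigma> (\<lambda>z. \<Sum>K | size K \<le> k. (-1) ^ size K * total_deriv K (coord_partial (Y \<tau> K) L) z) g z"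
    by (rule euler_form_cong[OF _ refl z])
      (simp only: euler_eq_form euler_form_eq[OF L _ order_refl] mult_1_right)
  also have "\<dots> = (\<Sum>K | size K \<le> k. euler_form \<sigma> (\<lambda>z. (-1) ^ size K * total_deriv K (coord_partial (Y \<tau> K) L) z) g z)"
    by (rule euler_form_sum_left[where k = "2 * k", OF _ g z], rule jet_function_mult[OF jet_function_const tp]) simp
  also have "\<dots> = (\<Sum>K | size K \<le> k. euler_form \<sigma> (coord_partial (Y \<tau> K) L) (total_deriv K g) z)"
  proof (rule sum.cong[OF refl])
    fix K :: "'n multiset" assume "K \<in> {K. size K \<le> k}"
    have "(-1::real) ^ size K * (-1) ^ size K = 1"
      by (simp add: power_mult_distrib[symmetric])
    then show "euler_form \<sigma> (\<lambda>z. (-1) ^ size K * total_deriv K (coord_partial (Y \<tau> K) L) z) g z =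
        euler_form \<sigma> (coord_partial (Y \<tau> K) L) (total_deriv K g) z"
      by (simp only: euler_form_cmult_left[OF jet_function_total_deriv[OF p] g z]
          euler_form_total_deriv[OF p g z] mult.assoc[symmetric] mult_1_left)
  qed
  finally show ?thesis .
qed

text \<open>pr Q(L) and Q^\<tau> E_\<tau>(L) differ by a total divergence, but no divergence is
  constructed: the Leibniz formula \<open>euler_mult\<close> is applied to both expressions, and
  integration by parts identifies the resulting bilinear terms.\<close>

lemma euler_first_variation:
  assumes Q: "\<And>\<sigma>. jet_function U q (Q \<sigma>)" and L: "jet_function U k L" and z: "z \<in> U"
  shows "euler \<sigma> (\<lambda>z. dir_deriv (evolutionary Q z) L z) z =
    euler \<sigma> (\<lambda>z. \<Sum>\<tau>\<in>UNIV. Q \<tau> z * euler \<tau> L z) z"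
proof -
  note p = jet_function_coord_partial[OF L]
  \<comment> \<open>A common bound for the order q + k of d_K Q and the order 2 * k of the Euler
    expressions.\<close>
  define l where "l = q + 2 * k"
  have tQ: "jet_function U l (total_deriv K (Q \<tau>))" if "size K \<le> k" for K \<tau>
    by (rule jet_function_mono[OF jet_function_total_deriv[OF Q]]) (use that in \<open>simp add: l_def\<close>)
  have pl: "jet_function U l (coord_partial (Y \<tau> K) L)" for K \<tau>
    by (rule jet_function_mono[OF p]) (simp add: l_def)
  have Ql: "jet_function U l (Q \<tau>)" for \<tau>
    by (rule jet_function_mono[OF Q]) (simp add: l_def)
  have El: "jet_function U l (euler \<tau> L)" for \<tau>
    by (rule jet_function_mono[OF jet_function_euler[OF L]]) (simp add: l_def)
  have "euler \<sigma> (\<lambda>z. dir_deriv (evolutionary Q z) L z) z =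
      euler \<sigma> (\<lambda>z. \<Sum>\<tau>\<in>UNIV. \<Sum>K | size K \<le> k. total_deriv K (Q \<tau>) z * coord_partial (Y \<tau> K) L z) z"
    unfolding euler_eq_form by (rule euler_form_cong[OF dir_deriv_evolutionary[OF L] refl z])
  also have "\<dots> = (\<Sum>\<tau>\<in>UNIV. euler \<sigma> (\<lambda>z. \<Sum>K | size K \<le> k. total_deriv K (Q \<tau>) z * coord_partial (Y \<tau> K) L z) z)"
    unfolding euler_eq_form
    by (rule euler_form_sum_left[where k = l, OF _ jet_function_const z], rule jet_function_sum,
        rule jet_function_mult[OF tQ pl]) simp
  also have "\<dots> = (\<Sum>\<tau>\<in>UNIV. \<Sum>K | size K \<le> k. euler \<sigma> (\<lambda>z. total_deriv K (Q \<tau>) z * coord_partial (Y \<tau> K) L z) z)"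
    unfolding euler_eq_form
    by (rule sum.cong[OF refl], rule euler_form_sum_left[where k = l, OF _ jet_function_const z],
        rule jet_function_mult[OF tQ pl]) simp
  also have "\<dots> = (\<Sum>\<tau>\<in>UNIV. \<Sum>K | size K \<le> k.
      euler_form \<sigma> (total_deriv K (Q \<tau>)) (coord_partial (Y \<tau> K) L) z +
      euler_form \<sigma> (coord_partial (Y \<tau> K) L) (total_deriv K (Q \<tau>)) z)"
    by (intro sum.cong[OF refl] euler_mult[OF tQ pl z]) simp
  also have "\<dots> = (\<Sum>\<tau>\<in>UNIV. euler_form \<sigma> (Q \<tau>) (euler \<tau> L) z + euler_form \<sigma> (euler \<tau> L) (Q \<tau>) z)"
    by (simp only: sum.distrib euler_form_euler_right[OF L Q z] euler_form_euler_left[OF L Q z])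
  also have "\<dots> = (\<Sum>\<tau>\<in>UNIV. euler \<sigma> (\<lambda>z. Q \<tau> z * euler \<tau> L z) z)"
    by (intro sum.cong[OF refl] euler_mult[OF Ql El z, symmetric])
  also have "\<dots> = euler \<sigma> (\<lambda>z. \<Sum>\<tau>\<in>UNIV. Q \<tau> z * euler \<tau> L z) z"
    unfolding euler_eq_form[of \<sigma>]
    by (rule euler_form_sum_left[where k = l, OF _ jet_function_const z, symmetric], rule jet_function_mult[OF Ql El])
  finally show ?thesis .
qed

text \<open>One side linearises E_\<sigma>(L) along \<open>Q\<close>, the other applies the formal
  adjoint of the linearisation. Their equality is the self-adjointness of Euler expressions (the
  Helmholtz conditions); it comes from the symmetry of second partials once pr Q has been commuted
  past d_I.\<close>

lemma evolutionary_euler: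
  assumes Q: "\<And>\<sigma>. jet_function U q (Q \<sigma>)" and L: "jet_function U k L" and z: "z \<in> U"
  shows "dir_deriv (evolutionary Q z) (euler \<sigma> L) z = (\<Sum>\<tau>\<in>UNIV. euler_form \<sigma> (euler \<tau> L) (Q \<tau>) z)"
proof -
  note p = jet_function_coord_partial[OF L]
  define l where "l = q + 2 * k"
  have tQ: "jet_function U l (total_deriv K (Q \<tau>))" if "size K \<le> k" for K \<tau>
    by (rule jet_function_mono[OF jet_function_total_deriv[OF Q]]) (use that in \<open>simp add: l_def\<close>)
  have ppl: "jet_function U l (coord_partial a (coord_partial b L))" for a b
    by (rule jet_function_mono[OF jet_function_coord_partial[OF p]]) (simp add: l_def)
  have tp: "jet_function U l (total_deriv I (coord_partial (Y \<sigma> I) L))" if "size I \<le> k" for I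
    by (rule jet_function_mono[OF jet_function_total_deriv[OF p]]) (use that in \<open>simp add: l_def\<close>)
  have inner: "total_deriv I (\<lambda>z. dir_deriv (evolutionary Q z) (coord_partial (Y \<sigma> I) L) z) z =
      (\<Sum>\<tau>\<in>UNIV. \<Sum>K | size K \<le> k.
        total_deriv I (\<lambda>z. coord_partial (Y \<sigma> I) (coord_partial (Y \<tau> K) L) z * total_deriv K (Q \<tau>) z) z)" for I
  proof -
    have "total_deriv I (\<lambda>z. dir_deriv (evolutionary Q z) (coord_partial (Y \<sigma> I) L) z) z =
        total_deriv I (\<lambda>z. \<Sum>\<tau>\<in>UNIV. \<Sum>K | size K \<le> k.
          coord_partial (Y \<sigma> I) (coord_partial (Y \<tau> K) L) z * total_deriv K (Q \<tau>) z) z"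
      by (rule total_deriv_cong[OF _ z])
        (simp only: dir_deriv_evolutionary[OF p] coord_partial_commute[OF L, of _ "Y \<sigma> I"] mult.commute)
    also have "\<dots> = (\<Sum>\<tau>\<in>UNIV. total_deriv I (\<lambda>z. \<Sum>K | size K \<le> k.
          coord_partial (Y \<sigma> I) (coord_partial (Y \<tau> K) L) z * total_deriv K (Q \<tau>) z) z)"
      by (rule total_deriv_sum[where k = l, OF _ z], rule jet_function_sum, rule jet_function_mult[OF ppl tQ]) simp
    also have "\<dots> = (\<Sum>\<tau>\<in>UNIV. \<Sum>K | size K \<le> k.
        total_deriv I (\<lambda>z. coord_partial (Y \<sigma> I) (coord_partial (Y \<tau> K) L) z * total_deriv K (Q \<tau>) z) z)"
      by (rule sum.cong[OF refl], rule total_deriv_sum[where k = l, OF _ z], rule jet_function_mult[OF ppl tQ]) simp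
    finally show ?thesis .
  qed
  have "dir_deriv (evolutionary Q z) (euler \<sigma> L) z =
      dir_deriv (evolutionary Q z)
        (\<lambda>z. \<Sum>I | size I \<le> k. (-1) ^ size I * total_deriv I (coord_partial (Y \<sigma> I) L) z) z"
    by (rule dir_deriv_cong[OF _ z])
      (simp only: euler_eq_form euler_form_eq[OF L _ order_refl] mult_1_right)
  also have "\<dots> = (\<Sum>I | size I \<le> k. dir_deriv (evolutionary Q z)
        (\<lambda>z. (-1) ^ size I * total_deriv I (coord_partial (Y \<sigma> I) L) z) z)"
    by (rule dir_deriv_sum[where k = l, OF _ z], rule jet_function_mult[OF jet_function_const tp]) simp
  also have "\<dots> = (\<Sum>I | size I \<le> k. (-1) ^ size I *
      total_deriv I (\<lambda>z. dir_deriv (evolutionary Q z) (coord_partial (Y \<sigma> I) L) z) z)"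
    by (simp only: dir_deriv_cmult[OF jet_function_total_deriv[OF p] z] evolutionary_total_deriv_commute[OF Q p z])
  also have "\<dots> = (\<Sum>I | size I \<le> k. \<Sum>\<tau>\<in>UNIV. \<Sum>K | size K \<le> k. (-1) ^ size I *
      total_deriv I (\<lambda>z. coord_partial (Y \<sigma> I) (coord_partial (Y \<tau> K) L) z * total_deriv K (Q \<tau>) z) z)"
    by (simp only: inner sum_distrib_left)
  also have "\<dots> = (\<Sum>\<tau>\<in>UNIV. \<Sum>I | size I \<le> k. \<Sum>K | size K \<le> k. (-1) ^ size I *
      total_deriv I (\<lambda>z. coord_partial (Y \<sigma> I) (coord_partial (Y \<tau> K) L) z * total_deriv K (Q \<tau>) z) z)"
    by (rule sum.swap)
  also have "\<dots> = (\<Sum>\<tau>\<in>UNIV. \<Sum>K | size K \<le> k. \<Sum>I | size I \<le> k. (-1) ^ size I *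
      total_deriv I (\<lambda>z. coord_partial (Y \<sigma> I) (coord_partial (Y \<tau> K) L) z * total_deriv K (Q \<tau>) z) z)"
    by (rule sum.cong[OF refl sum.swap])
  also have "\<dots> = (\<Sum>\<tau>\<in>UNIV. \<Sum>K | size K \<le> k. euler_form \<sigma> (coord_partial (Y \<tau> K) L) (total_deriv K (Q \<tau>)) z)"
    by (simp only: euler_form_eq[OF p z order_refl])
  also have "\<dots> = (\<Sum>\<tau>\<in>UNIV. euler_form \<sigma> (euler \<tau> L) (Q \<tau>) z)"
    by (simp only: euler_form_euler_left[OF L Q z])
  finally show ?thesis .
qed

text \<open>After \<open>euler_mult\<close>, the half that differentiates Q^\<tau> reduces to its
  zeroth-order term, and the other half is the linearised Euler expression by
  self-adjointness.\<close>

lemma euler_second_variation: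
  assumes Q: "\<And>\<sigma>. jet_function U 0 (Q \<sigma>)" and L: "jet_function U k L" and z: "z \<in> U"
  shows "euler \<sigma> (\<lambda>z. \<Sum>\<tau>\<in>UNIV. Q \<tau> z * euler \<tau> L z) z =
    dir_deriv (evolutionary Q z) (euler \<sigma> L) z + (\<Sum>\<tau>\<in>UNIV. coord_partial (Y \<sigma> {#}) (Q \<tau>) z * euler \<tau> L z)"
proof -
  note E = jet_function_euler[OF L]
  have Q': "jet_function U (2 * k) (Q \<tau>)" for \<tau> by (rule jet_function_mono[OF Q]) simp
  have "euler \<sigma> (\<lambda>z. \<Sum>\<tau>\<in>UNIV. Q \<tau> z * euler \<tau> L z) z = (\<Sum>\<tau>\<in>UNIV. euler \<sigma> (\<lambda>z. Q \<tau> z * euler \<tau> L z) z)"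
    unfolding euler_eq_form[of \<sigma>]
    by (rule euler_form_sum_left[where k = "2 * k", OF _ jet_function_const z], rule jet_function_mult[OF Q' E])
  also have "\<dots> = (\<Sum>\<tau>\<in>UNIV. euler_form \<sigma> (Q \<tau>) (euler \<tau> L) z) + (\<Sum>\<tau>\<in>UNIV. euler_form \<sigma> (euler \<tau> L) (Q \<tau>) z)"
    by (simp only: euler_mult[OF Q E z] sum.distrib)
  finally show ?thesis
    by (simp only: euler_form_order_zero[OF Q z] evolutionary_euler[OF Q L z] add.commute)
qed

end

section \<open>Forms on jets\<close>

abbreviation omit :: "nat \<Rightarrow> 'a list \<Rightarrow> 'a list" where
  "omit j xs \<equiv> take j xs @ drop (Suc j) xs"

lemma sum_lessThan_add_Suc:
  fixes f :: "nat \<Rightarrow> real"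
  shows "(\<Sum>j<m + Suc n. f j) = (\<Sum>j<m. f j) + f m + (\<Sum>j<n. f (m + Suc j))"
  by (induction n) simp_all

lemma ext_deriv_append_Cons:
  "ext_deriv \<rho> z (us @ v # ws) =
    (\<Sum>j<length us. (-1) ^ j * dir_deriv (us ! j) (\<lambda>z. \<rho> z (omit j us @ v # ws)) z) +
    (-1) ^ length us * dir_deriv v (\<lambda>z. \<rho> z (us @ ws)) z +
    (\<Sum>j<length ws. (-1) ^ Suc (length us + j) * dir_deriv (ws ! j) (\<lambda>z. \<rho> z (us @ v # omit j ws)) z)"
proof -
  have "length (us @ v # ws) = length us + Suc (length ws)" by simp
  then show ?thesis
    unfolding ext_deriv_def by (simp only: sum_lessThan_add_Suc) (simp add: nth_append)
qed

lemma ext_deriv_Cons: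
  "ext_deriv \<rho> z (v # ws) = dir_deriv v (\<lambda>z. \<rho> z ws) z -
    (\<Sum>j<length ws. (-1) ^ j * dir_deriv (ws ! j) (\<lambda>z. \<rho> z (v # omit j ws)) z)"
  using ext_deriv_append_Cons[of \<rho> z "[]" v ws] by (simp add: sum_negf)

text \<open>Serves the alternation of the exterior derivative: a repeated argument survives the
  removal of any other slot, so only the terms omitting one of the two copies can be
  nonzero.\<close>

lemma not_distinct_omit:
  assumes "a < b" "b < length vs" "vs ! a = vs ! b" "j \<noteq> a" "j \<noteq> b"
  shows "\<not> distinct (omit j vs)"
proof
  assume "distinct (omit j vs)"
  then have d: "distinct (take j vs)" "distinct (drop (Suc j) vs)" "set (take j vs) \<inter> set (drop (Suc j) vs) = {}"
    by auto
  consider "b < j" | "a < j" "j < b" | "j < a" using assms by linarith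
  then show False
  proof cases
    case 1
    then show False
      using d(1) assms nth_eq_iff_index_eq[OF d(1), of a b] by simp
  next
    case 2
    have "vs ! a \<in> set (take j vs)" using 2 assms by (auto simp: in_set_conv_nth intro!: exI[of _ a])
    moreover have "vs ! b \<in> set (drop (Suc j) vs)"
      using 2 assms by (auto simp: in_set_conv_nth intro!: exI[of _ "b - Suc j"])
    ultimately show False using d(3) assms(3) by auto
  next
    case 3
    then have "a - Suc j < length vs - Suc j" "b - Suc j < length vs - Suc j" "a - Suc j \<noteq> b - Suc j"
      using assms by linarith+
    then show False
      using 3 assms nth_eq_iff_index_eq[OF d(2), of "a - Suc j" "b - Suc j"] by auto
  qed
qed

lemma hor_part_X [simp]: "hor_part z v (X i) = v (X i)"
  by (simp add: hor_part_def if_distrib cong: if_cong)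

lemma hor_part_cong: "(\<And>i. v (X i) = w (X i)) \<Longrightarrow> hor_part z v = hor_part z w"
  by (simp add: hor_part_def fun_eq_iff)

lemma hor_part_vertical: "(\<And>i. v (X i) = 0) \<Longrightarrow> hor_part z v = (\<lambda>a. 0)"
  by (simp add: hor_part_def fun_eq_iff)

lemma hor_part_hor_part [simp]: "hor_part z (hor_part z' v) = hor_part z v"
  by (rule hor_part_cong) simp

lemma con_part_vertical:
  assumes "\<And>i. v (X i) = 0"
  shows "con_part z v = v"
proof
  show "con_part z v a = v a" for a
    using hor_con_part[of z v a] hor_part_vertical[of v z, OF assms] by simp
qed

lemma hor_part_linear: "hor_part z (\<lambda>a. s * v a + t * w a) = (\<lambda>a. s * hor_part z v a + t * hor_part z w a)"
  by (simp add: hor_part_def fun_eq_iff sum.distrib sum_distrib_left algebra_simps)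

lemma contact_part_0: "contact_part 0 \<rho> z vs = \<rho> z (map (hor_part z) vs)"
proof -
  have "{S. S \<subseteq> {..<length vs} \<and> card S = 0} = {{}}"
    using finite_subset by fastforce
  moreover have "map (\<lambda>j. hor_part z (vs ! j)) [0..<length vs] = map (hor_part z) vs"
    by (rule nth_equalityI) simp_all
  ultimately show ?thesis by (simp add: contact_part_def)
qed

lemma card_1_sum:
  fixes g :: "nat set \<Rightarrow> real"
  shows "(\<Sum>S | S \<subseteq> {..<n} \<and> card S = 1. g S) = (\<Sum>j<n. g {j})"
proof -
  have "{S. S \<subseteq> {..<n} \<and> card S = 1} = (\<lambda>j. {j}) ` {..<n}"
    by (auto simp: card_1_singleton_iff)
  then show ?thesis by (simp add: sum.reindex)
qed

lemma contact_part_1: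
  "contact_part 1 \<rho> z vs = (\<Sum>j<length vs.
     \<rho> z (map (hor_part z) (take j vs) @ con_part z (vs ! j) # map (hor_part z) (drop (Suc j) vs)))"
  unfolding contact_part_def card_1_sum
proof (rule sum.cong[OF refl])
  fix j assume "j \<in> {..<length vs}"
  then have j: "j < length vs" by simp
  have "map (\<lambda>k. if k \<in> {j} then con_part z (vs ! k) else hor_part z (vs ! k)) [0..<length vs] =
      map (hor_part z) (take j vs) @ con_part z (vs ! j) # map (hor_part z) (drop (Suc j) vs)"
    by (rule nth_equalityI) (use j in \<open>auto simp: nth_append nth_Cons' min_def\<close>)
  then show "\<rho> z (map (\<lambda>k. if k \<in> {j} then con_part z (vs ! k) else hor_part z (vs ! k)) [0..<length vs]) =
      \<rho> z (map (hor_part z) (take j vs) @ con_part z (vs ! j) # map (hor_part z) (drop (Suc j) vs))"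
    by (simp only:)
qed

text \<open>A vertical vector has no horizontal part, so every term that takes its horizontal part
  vanishes; what remains is the term where it occupies the contact slot.\<close>

lemma contact_part_1_vertical:
  assumes v: "\<And>i. v (X i) = 0" and zero: "\<And>ws. \<rho> z ((\<lambda>a. 0) # ws) = 0"
  shows "contact_part 1 \<rho> z (v # vs) = \<rho> z (v # map (hor_part z) vs)"
  unfolding contact_part_1
  by (simp only: length_Cons sum.lessThan_Suc_shift)
    (simp add: con_part_vertical[where v = v, OF v] hor_part_vertical[where v = v, OF v] zero)

context jet_region
begin

section \<open>Exterior calculus on a region\<close>

lemma ext_deriv_cong:
  assumes "\<And>z ws. z \<in> U \<Longrightarrow> \<alpha> z ws = \<beta> z ws" "z \<in> U"
  shows "ext_deriv \<alpha> z vs = ext_deriv \<beta> z vs"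
  unfolding ext_deriv_def by (intro sum.cong refl arg_cong2[where f = "(*)"] dir_deriv_cong[OF assms])

lemma dir_deriv_direction_linear:
  assumes "jet_function U k f" "z \<in> U"
  shows "dir_deriv (\<lambda>a. s * v a + t * w a) f z = s * dir_deriv v f z + t * dir_deriv w f z"
  unfolding dir_deriv_eq[OF assms] by (simp add: distrib_right sum.distrib sum_distrib_left mult.assoc)

lemma dir_deriv_linear:
  assumes f: "jet_function U k f" and g: "jet_function U k g" and z: "z \<in> U"
  shows "dir_deriv v (\<lambda>z. s * f z + t * g z) z = s * dir_deriv v f z + t * dir_deriv v g z"
  using dir_deriv_add[OF jet_function_mult[OF jet_function_const f] jet_function_mult[OF jet_function_const g] z, of v s t]
    dir_deriv_cmult[OF f z, of v s] dir_deriv_cmult[OF g z, of v t] by simp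

lemma jform_length: "is_jform U k q \<rho> \<Longrightarrow> z \<in> U \<Longrightarrow> length vs \<noteq> q \<Longrightarrow> \<rho> z vs = 0"
  unfolding is_jform_def by blast

lemma jform_linear: "is_jform U k q \<rho> \<Longrightarrow> z \<in> U \<Longrightarrow>
    \<rho> z (us @ (\<lambda>a. s * v a + t * w a) # ws) = s * \<rho> z (us @ v # ws) + t * \<rho> z (us @ w # ws)"
  unfolding is_jform_def by (drule conjunct2, drule conjunct1) simp

lemma jform_alternating: "is_jform U k q \<rho> \<Longrightarrow> z \<in> U \<Longrightarrow> \<not> distinct vs \<Longrightarrow> \<rho> z vs = 0"
  unfolding is_jform_def by blast

lemma jform_truncate: "is_jform U k q \<rho> \<Longrightarrow> z \<in> U \<Longrightarrow>
    \<rho> z (map (\<lambda>v a. if jet_order a \<le> k then v a else 0) vs) = \<rho> z vs"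
  unfolding is_jform_def by blast

lemma jform_jet_function: "is_jform U k q \<rho> \<Longrightarrow> jet_function U k (\<lambda>z. \<rho> z vs)"
  unfolding is_jform_def by blast

lemma jform_zero: "is_jform U k q \<rho> \<Longrightarrow> z \<in> U \<Longrightarrow> \<rho> z (us @ (\<lambda>a. 0) # ws) = 0"
  using jform_linear[of k q \<rho> z us 0 "\<lambda>a. 0" 0 "\<lambda>a. 0" ws] by simp

lemma jform_sum:
  assumes \<rho>: "is_jform U k q \<rho>" and z: "z \<in> U" and "finite A"
  shows "\<rho> z (us @ (\<lambda>b. \<Sum>a\<in>A. c a * e a b) # ws) = (\<Sum>a\<in>A. c a * \<rho> z (us @ e a # ws))"
  using assms(3)
proof (induction A rule: finite_induct)
  case empty
  then show ?case by (simp add: jform_zero[OF \<rho> z])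
next
  case (insert a A)
  have "\<rho> z (us @ (\<lambda>b. c a * e a b + 1 * (\<Sum>a\<in>A. c a * e a b)) # ws) =
      c a * \<rho> z (us @ e a # ws) + 1 * \<rho> z (us @ (\<lambda>b. \<Sum>a\<in>A. c a * e a b) # ws)"
    by (rule jform_linear[OF \<rho> z])
  with insert show ?case by simp
qed

text \<open>Jet vectors have infinitely many components; truncation to order \<open>k\<close> leaves
  finitely many, which turns multilinearity into an expansion over unit vectors.\<close>

lemma jform_expand:
  assumes \<rho>: "is_jform U k q \<rho>" and z: "z \<in> U"
  shows "\<rho> z (us @ w # ws) = (\<Sum>a | jet_order a \<le> k. w a * \<rho> z (us @ unit_vec a # ws))"
proof -
  let ?t = "\<lambda>(v :: ('n, 'm) jvec) a. if jet_order a \<le> k then v a else 0"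
  have t: "?t w = (\<lambda>b. \<Sum>a | jet_order a \<le> k. w a * unit_vec a b)"
    using sum.delta'[OF finite_jet_order_le, of _ w k]
    by (simp add: fun_eq_iff unit_vec_def if_distrib cong: if_cong)
  have "\<rho> z (us @ w # ws) = \<rho> z (map ?t (us @ w # ws))"
    by (rule jform_truncate[OF \<rho> z, symmetric])
  also have "map ?t (us @ w # ws) = map ?t (us @ ?t w # ws)"
    by (simp add: fun_eq_iff)
  also have "\<rho> z (map ?t (us @ ?t w # ws)) = \<rho> z (us @ ?t w # ws)"
    by (rule jform_truncate[OF \<rho> z])
  also have "\<dots> = (\<Sum>a | jet_order a \<le> k. w a * \<rho> z (us @ unit_vec a # ws))"
    unfolding t by (rule jform_sum[OF \<rho> z finite_jet_order_le])
  finally show ?thesis .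
qed

text \<open>Alternation is encoded as vanishing on repeated arguments; polarising with v + w gives
  the change of sign.\<close>

lemma jform_swap:
  assumes \<rho>: "is_jform U k q \<rho>" and z: "z \<in> U"
  shows "\<rho> z (us @ v # w # ws) = - \<rho> z (us @ w # v # ws)"
proof -
  let ?s = "\<lambda>a. 1 * v a + 1 * w a"
  have nd: "\<rho> z (us @ x # x # ws) = 0" for x
    by (rule jform_alternating[OF \<rho> z]) simp
  have "0 = \<rho> z (us @ ?s # ?s # ws)" by (rule nd[symmetric])
  also have "\<dots> = 1 * \<rho> z (us @ v # ?s # ws) + 1 * \<rho> z (us @ w # ?s # ws)"
    by (rule jform_linear[OF \<rho> z])
  also have "\<rho> z (us @ v # ?s # ws) = 1 * \<rho> z (us @ v # v # ws) + 1 * \<rho> z (us @ v # w # ws)"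
    using jform_linear[OF \<rho> z, of "us @ [v]" 1 v 1 w ws] by simp
  also have "\<rho> z (us @ w # ?s # ws) = 1 * \<rho> z (us @ w # v # ws) + 1 * \<rho> z (us @ w # w # ws)"
    using jform_linear[OF \<rho> z, of "us @ [w]" 1 v 1 w ws] by simp
  finally show ?thesis by (simp add: nd)
qed

lemma jform_move:
  assumes \<rho>: "is_jform U k q \<rho>" and z: "z \<in> U"
  shows "\<rho> z (us @ xs @ v # ws) = (-1) ^ length xs * \<rho> z (us @ v # xs @ ws)"
proof (induction xs arbitrary: us)
  case (Cons x xs)
  have "\<rho> z (us @ (x # xs) @ v # ws) = (-1) ^ length xs * \<rho> z (us @ x # v # xs @ ws)"
    using Cons.IH[of "us @ [x]"] by simp
  also have "\<rho> z (us @ x # v # xs @ ws) = - \<rho> z (us @ v # x # xs @ ws)"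
    by (rule jform_swap[OF \<rho> z])
  finally show ?case by simp
qed simp

lemma is_jformI:
  assumes "\<And>z vs. z \<in> U \<Longrightarrow> length vs \<noteq> q \<Longrightarrow> \<rho> z vs = 0"
    and "\<And>z us ws v w s t. z \<in> U \<Longrightarrow> \<rho> z (us @ (\<lambda>a. s * v a + t * w a) # ws) =
        s * \<rho> z (us @ v # ws) + t * \<rho> z (us @ w # ws)"
    and "\<And>z vs. z \<in> U \<Longrightarrow> \<not> distinct vs \<Longrightarrow> \<rho> z vs = 0"
    and "\<And>z vs. z \<in> U \<Longrightarrow> \<rho> z (map (\<lambda>v a. if jet_order a \<le> k then v a else 0) vs) = \<rho> z vs"
    and "\<And>vs. jet_function U k (\<lambda>z. \<rho> z vs)"
  shows "is_jform U k q \<rho>"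
  unfolding is_jform_def
proof (intro conjI ballI allI impI)
  show "\<rho> z (us @ (\<lambda>a. s * v a + t * w a) # ws) = s * \<rho> z (us @ v # ws) + t * \<rho> z (us @ w # ws)"
    if "z \<in> U" for z us v w s t ws
    by (rule assms(2)[OF that])
qed (fact assms(1,3-5))+

lemma is_jform_ext_deriv:
  assumes \<rho>: "is_jform U k q \<rho>"
  shows "is_jform U k (Suc q) (ext_deriv \<rho>)"
proof (rule is_jformI)
  fix z :: "('n, 'm) jet" and vs :: "('n, 'm) jvec list" assume z: "z \<in> U"
  show "ext_deriv \<rho> z vs = 0" if len: "length vs \<noteq> Suc q"
    unfolding ext_deriv_def
  proof (rule sum.neutral, rule ballI)
    fix j assume "j \<in> {..<length vs}"
    then have "length (omit j vs) \<noteq> q" using len by auto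
    then have "dir_deriv (vs ! j) (\<lambda>z. \<rho> z (omit j vs)) z = dir_deriv (vs ! j) (\<lambda>z. 0) z"
      by (intro dir_deriv_cong[OF _ z] jform_length[OF \<rho>])
    then show "(-1) ^ j * dir_deriv (vs ! j) (\<lambda>z. \<rho> z (omit j vs)) z = 0" by simp
  qed
  show "ext_deriv \<rho> z vs = 0" if nd: "\<not> distinct vs"
  proof -
    obtain xs ys zs y where vs: "vs = xs @ y # ys @ y # zs"
      using not_distinct_decomp[OF nd] by auto
    \<comment> \<open>Only the terms omitting one copy of \<open>y\<close> remain. Moving
      \<open>y\<close> past \<open>ys\<close> gives one of them the sign (-1)^(a + length ys); the
      other has (-1)^b with b = a + length ys + 1, so they cancel.\<close>
    define a where "a = length xs"
    define b where "b = Suc (length xs + length ys)"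
    have ab: "a < b" "b < length vs" "vs ! a = y" "vs ! b = y"
      by (auto simp: vs a_def b_def nth_append)
    have oa: "omit a vs = xs @ ys @ y # zs" and ob: "omit b vs = xs @ y # ys @ zs"
      by (auto simp: vs a_def b_def)
    let ?t = "\<lambda>j. (-1) ^ j * dir_deriv (vs ! j) (\<lambda>z. \<rho> z (omit j vs)) z"
    have "ext_deriv \<rho> z vs = (\<Sum>j\<in>{a, b}. ?t j)"
      unfolding ext_deriv_def
    proof (rule sum.mono_neutral_right)
      show "\<forall>j\<in>{..<length vs} - {a, b}. ?t j = 0"
      proof
        fix j assume j: "j \<in> {..<length vs} - {a, b}"
        have "\<not> distinct (omit j vs)"
          by (rule not_distinct_omit[of a b]) (use j ab in auto)
        then have "dir_deriv (vs ! j) (\<lambda>z. \<rho> z (omit j vs)) z = dir_deriv (vs ! j) (\<lambda>z. 0) z"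
          by (intro dir_deriv_cong[OF _ z] jform_alternating[OF \<rho>])
        then show "?t j = 0" by simp
      qed
    qed (use ab in auto)
    also have "\<dots> = ?t a + ?t b" using ab(1) by simp
    also have "?t a = (-1) ^ a * ((-1) ^ length ys * dir_deriv y (\<lambda>z. \<rho> z (xs @ y # ys @ zs)) z)"
    proof -
      have "dir_deriv y (\<lambda>z. \<rho> z (xs @ ys @ y # zs)) z =
          dir_deriv y (\<lambda>z. (-1) ^ length ys * \<rho> z (xs @ y # ys @ zs)) z"
        by (rule dir_deriv_cong[OF jform_move[OF \<rho>] z])
      then show ?thesis
        unfolding ab oa by (simp only: dir_deriv_cmult[OF jform_jet_function[OF \<rho>] z])
    qed
    finally show ?thesis unfolding ab ob by (simp add: a_def b_def power_add)
  qed
  show "ext_deriv \<rho> z (map (\<lambda>v a. if jet_order a \<le> k then v a else 0) vs) = ext_deriv \<rho> z vs"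
    unfolding ext_deriv_def length_map
  proof (rule sum.cong[OF refl])
    let ?t = "\<lambda>(v :: ('n, 'm) jvec) a. if jet_order a \<le> k then v a else 0"
    fix j assume j: "j \<in> {..<length vs}"
    have "dir_deriv (?t v) f z = dir_deriv v f z" if "jet_function U k f" for f v
      unfolding dir_deriv_eq[OF that z] by (rule sum.cong) auto
    note trunc = this[OF jform_jet_function[OF \<rho>]]
    have "omit j (map ?t vs) = map ?t (omit j vs)" by (simp add: take_map drop_map)
    then have "dir_deriv v (\<lambda>z. \<rho> z (omit j (map ?t vs))) z = dir_deriv v (\<lambda>z. \<rho> z (omit j vs)) z" for v
      by (simp only:) (rule dir_deriv_cong[OF jform_truncate[OF \<rho>] z])
    then show "(-1) ^ j * dir_deriv (map ?t vs ! j) (\<lambda>z. \<rho> z (omit j (map ?t vs))) z =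
        (-1) ^ j * dir_deriv (vs ! j) (\<lambda>z. \<rho> z (omit j vs)) z"
      using j trunc by simp
  qed
next
  fix z us ws and v w :: "('n, 'm) jvec" and s t :: real assume z: "z \<in> U"
  note J = jform_jet_function[OF \<rho>]
  let ?u = "\<lambda>a. s * v a + t * w a"
  have lin: "dir_deriv x (\<lambda>z. \<rho> z (as @ ?u # bs)) z =
      s * dir_deriv x (\<lambda>z. \<rho> z (as @ v # bs)) z + t * dir_deriv x (\<lambda>z. \<rho> z (as @ w # bs)) z" for x as bs
  proof -
    have "dir_deriv x (\<lambda>z. \<rho> z (as @ ?u # bs)) z =
        dir_deriv x (\<lambda>z. s * \<rho> z (as @ v # bs) + t * \<rho> z (as @ w # bs)) z"
      by (rule dir_deriv_cong[OF jform_linear[OF \<rho>] z])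
    then show ?thesis by (simp only: dir_deriv_linear[OF J J z])
  qed
  show "ext_deriv \<rho> z (us @ ?u # ws) = s * ext_deriv \<rho> z (us @ v # ws) + t * ext_deriv \<rho> z (us @ w # ws)"
    unfolding ext_deriv_append_Cons lin dir_deriv_direction_linear[OF J z]
    by (simp only: distrib_left sum.distrib sum_distrib_left mult.left_commute add.assoc add.left_commute)
next
  fix vs :: "('n, 'm) jvec list"
  show "jet_function U k (\<lambda>z. ext_deriv \<rho> z vs)"
    unfolding ext_deriv_def
    by (intro jet_function_sum jet_function_mult jet_function_const
        jet_function_dir_deriv[OF jform_jet_function[OF \<rho>]]) simp_all
qed

text \<open>The definition of a form gives smoothness for constant arguments. Point-dependent ones
  are expanded in unit vectors one at a time, each unit vector joining the constant prefix
  \<open>us\<close>.\<close>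

lemma jet_function_jform_apply:
  assumes \<rho>: "is_jform U k q \<rho>" and "k \<le> l"
    and "\<And>W a. W \<in> set Ws \<Longrightarrow> jet_order a \<le> k \<Longrightarrow> jet_function U l (\<lambda>z. W z a)"
  shows "jet_function U l (\<lambda>z. \<rho> z (us @ map (\<lambda>W. W z) Ws))"
  using assms(3)
proof (induction Ws arbitrary: us)
  case Nil
  show ?case using jet_function_mono[OF jform_jet_function[OF \<rho>] \<open>k \<le> l\<close>] by simp
next
  case (Cons W Ws)
  show ?case
  proof (rule jet_function_cong)
    have "jet_function U l (\<lambda>z. \<rho> z (us @ unit_vec a # map (\<lambda>W. W z) Ws))" for a
      using Cons.IH[of "us @ [unit_vec a]"] Cons.prems by simp
    then show "jet_function U l (\<lambda>z. \<Sum>a | jet_order a \<le> k. W z a * \<rho> z (us @ unit_vec a # map (\<lambda>W. W z) Ws))"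
      by (intro jet_function_sum jet_function_mult[OF Cons.prems]) simp_all
    show "(\<Sum>a | jet_order a \<le> k. W z a * \<rho> z (us @ unit_vec a # map (\<lambda>W. W z) Ws)) =
        \<rho> z (us @ map (\<lambda>W. W z) (W # Ws))" if "z \<in> U" for z
      by (simp add: jform_expand[OF \<rho> that, symmetric])
  qed
qed

lemma jet_function_hor_part: "jet_order a \<le> k \<Longrightarrow> jet_function U (Suc k) (\<lambda>z. hor_part z v a)"
  unfolding hor_part_def by (intro jet_function_sum jet_function_mult jet_function_const jet_function_total_vec)

lemma jet_function_jform_hor:
  assumes \<rho>: "is_jform U k q \<rho>"
  shows "jet_function U (Suc k) (\<lambda>z. \<rho> z (us @ map (hor_part z) vs))"
proof -
  have "jet_function U (Suc k) (\<lambda>z. \<rho> z (us @ map (\<lambda>W. W z) (map (\<lambda>v z. hor_part z v) vs)))"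
  proof (rule jet_function_jform_apply[OF \<rho>])
    show "jet_function U (Suc k) (\<lambda>z. W z a)" if W: "W \<in> set (map (\<lambda>v z. hor_part z v) vs)" and a: "jet_order a \<le> k" for W a
    proof -
      obtain v where "W = (\<lambda>z. hor_part z v)" using W by auto
      then show ?thesis using jet_function_hor_part[OF a] by simp
    qed
  qed simp
  then show ?thesis by (simp add: o_def)
qed

text \<open>Horizontality over X, encoded as dependence on the dx^i-components of the arguments
  alone; equality of the mapped lists also fixes their length. Arguments with equal base components
  can be exchanged even when they belong to different jets, which is how varying arguments are
  frozen.\<close>

definition semibasic :: "('n, 'm) jform \<Rightarrow> bool" where
  "semibasic \<mu> \<longleftrightarrow>
     (\<forall>z\<in>U. \<forall>vs ws. map (\<lambda>v i. v (X i)) vs = map (\<lambda>v i. v (X i)) ws \<longrightarrow> \<mu> z vs = \<mu> z ws)"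

lemma semibasicD: "semibasic \<mu> \<Longrightarrow> z \<in> U \<Longrightarrow> map (\<lambda>v i. v (X i)) vs = map (\<lambda>v i. v (X i)) ws \<Longrightarrow> \<mu> z vs = \<mu> z ws"
  unfolding semibasic_def by blast

lemma semibasic_vertical:
  assumes \<mu>: "is_jform U k q \<mu>" and sb: "semibasic \<mu>" and z: "z \<in> U" and v: "\<And>i. v (X i) = 0"
  shows "\<mu> z (us @ v # ws) = 0"
proof -
  have "\<mu> z (us @ v # ws) = \<mu> z (us @ (\<lambda>a. 0) # ws)"
    by (rule semibasicD[OF sb z]) (simp add: v)
  then show ?thesis by (simp add: jform_zero[OF \<mu> z])
qed

lemma semibasic_hor: "semibasic \<mu> \<Longrightarrow> z \<in> U \<Longrightarrow> \<mu> z (map (hor_part z') vs) = \<mu> z vs"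
  by (rule semibasicD) simp_all

lemma is_jform_contact_part_0:
  assumes \<rho>: "is_jform U k q \<rho>"
  shows "is_jform U (Suc k) q (contact_part 0 \<rho>)"
proof (rule is_jformI)
  fix z :: "('n, 'm) jet" and vs :: "('n, 'm) jvec list" assume z: "z \<in> U"
  show "contact_part 0 \<rho> z vs = 0" if "length vs \<noteq> q"
    unfolding contact_part_0 by (rule jform_length[OF \<rho> z]) (use that in simp)
  show "contact_part 0 \<rho> z vs = 0" if "\<not> distinct vs"
    unfolding contact_part_0
    by (rule jform_alternating[OF \<rho> z]) (use that in \<open>simp add: distinct_map\<close>)
  show "contact_part 0 \<rho> z (map (\<lambda>v a. if jet_order a \<le> Suc k then v a else 0) vs) = contact_part 0 \<rho> z vs"
  proof -
    have "hor_part z (\<lambda>a. if jet_order a \<le> Suc k then v a else 0) = hor_part z v" for v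
      by (rule hor_part_cong) simp
    then show ?thesis by (simp add: contact_part_0 o_def)
  qed
next
  fix z us ws and v w :: "('n, 'm) jvec" and s t :: real assume z: "z \<in> U"
  show "contact_part 0 \<rho> z (us @ (\<lambda>a. s * v a + t * w a) # ws) =
      s * contact_part 0 \<rho> z (us @ v # ws) + t * contact_part 0 \<rho> z (us @ w # ws)"
    by (simp add: contact_part_0 hor_part_linear jform_linear[OF \<rho> z])
next
  show "jet_function U (Suc k) (\<lambda>z. contact_part 0 \<rho> z vs)" for vs
    using jet_function_jform_hor[OF \<rho>, of "[]" vs] by (simp add: contact_part_0)
qed

lemma semibasic_contact_part_0: "semibasic (contact_part 0 \<rho>)"
  unfolding semibasic_def
proof (intro ballI allI impI)
  fix z :: "('n, 'm) jet" and vs ws :: "('n, 'm) jvec list"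
  assume eq: "map (\<lambda>v i. v (X i)) vs = map (\<lambda>v i. v (X i)) ws"
  then have "length vs = length ws" by (metis length_map)
  then have "map (hor_part z) vs = map (hor_part z) ws"
    using eq
    by (induction vs ws rule: list_induct2) (simp_all add: hor_part_def fun_eq_iff)
  then show "contact_part 0 \<rho> z vs = contact_part 0 \<rho> z ws" by (simp add: contact_part_0)
qed

text \<open>A linear operator on functions that sees only values on \<open>U\<close>, applied to the
  coefficient of each fixed list of arguments, preserves multilinearity and alternation. Lie
  derivatives and contracted Euler-Lagrange forms both arise this way. The truncation condition
  comes from horizontality, since base coordinates have order zero.\<close>

lemma is_jform_operator:
  assumes \<mu>: "is_jform U k q \<mu>" and sb: "semibasic \<mu>"
    and \<nu>: "\<And>z vs. z \<in> U \<Longrightarrow> \<nu> z vs = T (\<lambda>z. \<mu> z vs) z"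
    and jet: "\<And>f. jet_function U k f \<Longrightarrow> jet_function U l (T f)"
    and lin: "\<And>f g s t z. jet_function U k f \<Longrightarrow> jet_function U k g \<Longrightarrow> z \<in> U \<Longrightarrow>
      T (\<lambda>z. s * f z + t * g z) z = s * T f z + t * T g z"
    and cong: "\<And>f g z. (\<And>z. z \<in> U \<Longrightarrow> f z = g z) \<Longrightarrow> z \<in> U \<Longrightarrow> T f z = T g z"
  shows "is_jform U l q \<nu>" "semibasic \<nu>"
proof -
  have T0: "T (\<lambda>z. 0) z = 0" if "z \<in> U" for z
    using lin[OF jet_function_const jet_function_const that, of 0 0 0 0] by simp
  show sb': "semibasic \<nu>"
    unfolding semibasic_def
  proof (intro ballI allI impI)
    fix z :: "('n, 'm) jet" and vs ws :: "('n, 'm) jvec list"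
    assume z: "z \<in> U" and eq: "map (\<lambda>v i. v (X i)) vs = map (\<lambda>v i. v (X i)) ws"
    show "\<nu> z vs = \<nu> z ws"
      unfolding \<nu>[OF z] by (rule cong[OF semibasicD[OF sb _ eq] z])
  qed
  show "is_jform U l q \<nu>"
  proof (rule is_jformI)
    fix z :: "('n, 'm) jet" and vs :: "('n, 'm) jvec list" assume z: "z \<in> U"
    show "\<nu> z vs = 0" if "length vs \<noteq> q"
      unfolding \<nu>[OF z] using cong[OF jform_length[OF \<mu> _ that] z] T0[OF z] by simp
    show "\<nu> z vs = 0" if "\<not> distinct vs"
      unfolding \<nu>[OF z] using cong[OF jform_alternating[OF \<mu> _ that] z] T0[OF z] by simp
    show "\<nu> z (map (\<lambda>v a. if jet_order a \<le> l then v a else 0) vs) = \<nu> z vs"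
      by (rule semibasicD[OF sb' z]) simp
  next
    fix z us ws and v w :: "('n, 'm) jvec" and s t :: real assume z: "z \<in> U"
    show "\<nu> z (us @ (\<lambda>a. s * v a + t * w a) # ws) = s * \<nu> z (us @ v # ws) + t * \<nu> z (us @ w # ws)"
      unfolding \<nu>[OF z] using cong[OF jform_linear[OF \<mu>] z]
      by (simp only: lin[OF jform_jet_function[OF \<mu>] jform_jet_function[OF \<mu>] z])
  next
    fix vs :: "('n, 'm) jvec list"
    show "jet_function U l (\<lambda>z. \<nu> z vs)"
      by (rule jet_function_cong[OF \<nu>[symmetric] jet[OF jform_jet_function[OF \<mu>]]])
  qed
qed

text \<open>\<open>V\<close> varies, but its base components do not, so inside \<mu> it may be
  replaced by its value at \<open>z\<close>. The two halves of Cartan's formula then cancel except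
  for the derivative of the coefficient along \<open>V\<close>.\<close>

lemma lie_deriv_semibasic:
  assumes sb: "semibasic \<mu>" and V: "\<And>z z' i. V z (X i) = V z' (X i)" and z: "z \<in> U"
  shows "lie_deriv V \<mu> z vs = dir_deriv (V z) (\<lambda>z. \<mu> z vs) z"
proof -
  have "ext_deriv (contract V \<mu>) z vs =
      (\<Sum>j<length vs. (-1) ^ j * dir_deriv (vs ! j) (\<lambda>z'. \<mu> z' (V z # omit j vs)) z)"
    unfolding ext_deriv_def contract_def
  proof (intro sum.cong refl arg_cong2[where f = "(*)"] dir_deriv_cong[OF _ z])
    show "\<mu> z' (V z' # omit j vs) = \<mu> z' (V z # omit j vs)" if "z' \<in> U" for z' j
    proof (rule semibasicD[OF sb that])
      have "(\<lambda>i. V z' (X i)) = (\<lambda>i. V z (X i))" by (rule ext, rule V)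
      then show "map (\<lambda>v i. v (X i)) (V z' # omit j vs) = map (\<lambda>v i. v (X i)) (V z # omit j vs)" by simp
    qed
  qed
  then show ?thesis
    unfolding lie_deriv_def contract_def[of V "ext_deriv \<mu>"] ext_deriv_Cons by simp
qed

text \<open>Carries horizontality alone, which suits the iteration of total Lie derivatives, where
  the order grows with every step.\<close>

lemma semibasic_pointwise:
  assumes sb: "semibasic \<mu>" and \<nu>: "\<And>z vs. z \<in> U \<Longrightarrow> \<nu> z vs = T (\<lambda>z. \<mu> z vs) z"
    and cong: "\<And>f g z. (\<And>z. z \<in> U \<Longrightarrow> f z = g z) \<Longrightarrow> z \<in> U \<Longrightarrow> T f z = T g z"
  shows "semibasic \<nu>"
  unfolding semibasic_def
proof (intro ballI allI impI)
  fix z :: "('n, 'm) jet" and vs ws :: "('n, 'm) jvec list"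
  assume z: "z \<in> U" and eq: "map (\<lambda>v i. v (X i)) vs = map (\<lambda>v i. v (X i)) ws"
  show "\<nu> z vs = \<nu> z ws"
    unfolding \<nu>[OF z] by (rule cong[OF semibasicD[OF sb _ eq] z])
qed

lemma total_lie_semibasic:
  assumes sb: "semibasic \<mu>" and z: "z \<in> U"
  shows "total_lie I \<mu> z vs = total_deriv I (\<lambda>z. \<mu> z vs) z"
proof -
  define L where "L is = foldr (\<lambda>i. lie_deriv (total_vec i)) is \<mu>" for "is" :: "'n list"
  have X: "total_vec i z (X j) = total_vec i z' (X j)" for i j and z z' :: "('n, 'm) jet" by simp
  have "semibasic (L is) \<and> (\<forall>z\<in>U. \<forall>vs. L is z vs = total_list is (\<lambda>z. \<mu> z vs) z)" for "is"
  proof (induction "is")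
    case Nil
    then show ?case using sb by (simp add: L_def)
  next
    case (Cons i "is")
    have L: "L (i # is) z vs = dir_deriv (total_vec i z) (\<lambda>z. L is z vs) z" if "z \<in> U" for z vs
      unfolding L_def foldr.simps o_def
      by (rule lie_deriv_semibasic[where V = "total_vec i", OF _ X that]) (use Cons in \<open>simp add: L_def\<close>)
    have "semibasic (L (i # is))"
      by (rule semibasic_pointwise[where T = "\<lambda>f z. dir_deriv (total_vec i z) f z", OF conjunct1[OF Cons] L dir_deriv_cong])
    moreover have "L (i # is) z vs = total_list (i # is) (\<lambda>z. \<mu> z vs) z" if "z \<in> U" for z vs
      unfolding L[OF that] foldr.simps o_def
      by (rule dir_deriv_cong[OF _ that]) (use Cons in simp)
    ultimately show ?case by blast
  qed
  then show ?thesis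
    using z by (simp add: total_lie_def total_deriv_def L_def)
qed

end

section \<open>The Noether identity\<close>

lemma base_fibre_upd:
  "base_fibre (z(a := t)) = base_fibre z + (t - z a) *\<^sub>R
     (case a of X i \<Rightarrow> (axis i 1, 0) | Y \<sigma> I \<Rightarrow> if I = {#} then (0, axis \<sigma> 1) else 0)"
  by (cases a) (auto simp: base_fibre_def vec_eq_iff axis_def)

lemma continuous_on_base_fibre: "continuous_on A base_fibre"
  unfolding base_fibre_def
  by (intro continuous_on_Pair continuous_on_vec_lambda
      continuous_on_subset[OF continuous_on_product_coordinates subset_UNIV])

context jet_region
begin

section \<open>Contact parts and the interior Euler operator on horizontal forms\<close>

lemma contact_part_1_ext_deriv:
  assumes \<mu>: "is_jform U k q \<mu>" and sb: "semibasic \<mu>" and z: "z \<in> U" and v: "\<And>i. v (X i) = 0"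
  shows "contact_part 1 (ext_deriv \<mu>) z (v # vs) = dir_deriv v (\<lambda>z. \<mu> z vs) z"
proof -
  have "contact_part 1 (ext_deriv \<mu>) z (v # vs) = ext_deriv \<mu> z (v # map (hor_part z) vs)"
  proof (rule contact_part_1_vertical)
    show "v (X i) = 0" for i by (rule v)
    show "ext_deriv \<mu> z ((\<lambda>a. 0) # ws) = 0" for ws
      using jform_zero[OF is_jform_ext_deriv[OF \<mu>] z, of "[]" ws] by simp
  qed
  also have "\<dots> = dir_deriv v (\<lambda>z'. \<mu> z' (map (hor_part z) vs)) z"
  proof -
    have "dir_deriv w (\<lambda>z. \<mu> z (v # ws)) z = 0" for w ws
    proof -
      have "dir_deriv w (\<lambda>z. \<mu> z (v # ws)) z = dir_deriv w (\<lambda>z. 0) z"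
      proof (rule dir_deriv_cong[OF _ z])
        show "\<mu> z (v # ws) = 0" if "z \<in> U" for z
          using semibasic_vertical[where v = v and us = "[]", OF \<mu> sb that v] by simp
      qed
      then show ?thesis by simp
    qed
    then show ?thesis by (simp add: ext_deriv_Cons)
  qed
  also have "\<dots> = dir_deriv v (\<lambda>z. \<mu> z vs) z"
    by (rule dir_deriv_cong[OF semibasic_hor[OF sb] z])
  finally show ?thesis .
qed

lemma interior_euler_semibasic:
  assumes \<mu>: "is_jform U k q \<mu>" and sb: "semibasic \<mu>" and z: "z \<in> U"
  shows "interior_euler 1 (ext_deriv \<mu>) z vs =
    (\<Sum>\<sigma>\<in>UNIV. \<Sum>j<length vs. (-1) ^ j * omega \<sigma> {#} z (vs ! j) * euler \<sigma> (\<lambda>z. \<mu> z (omit j vs)) z)"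
proof -
  have "total_lie I (contract (\<lambda>_. unit_vec (Y \<sigma> I)) (contact_part 1 (ext_deriv \<mu>))) z ws =
      total_deriv I (coord_partial (Y \<sigma> I) (\<lambda>z. \<mu> z ws)) z" for I \<sigma> ws
  proof -
    let ?\<nu> = "contract (\<lambda>_. unit_vec (Y \<sigma> I)) (contact_part 1 (ext_deriv \<mu>))"
    have \<nu>: "?\<nu> z ws = coord_partial (Y \<sigma> I) (\<lambda>z. \<mu> z ws) z" if "z \<in> U" for z ws
      unfolding contract_def coord_partial_dir_deriv
      by (rule contact_part_1_ext_deriv[OF \<mu> sb that]) (simp add: unit_vec_def)
    have "semibasic ?\<nu>"
      by (rule semibasic_pointwise[where T = "coord_partial (Y \<sigma> I)", OF sb \<nu> coord_partial_cong])
    then have "total_lie I ?\<nu> z ws = total_deriv I (\<lambda>z. ?\<nu> z ws) z"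
      by (rule total_lie_semibasic[OF _ z])
    also have "\<dots> = total_deriv I (coord_partial (Y \<sigma> I) (\<lambda>z. \<mu> z ws)) z"
      by (rule total_deriv_cong[OF \<nu> z])
    finally show ?thesis .
  qed
  then show ?thesis
    unfolding interior_euler_def wedge1_def euler_def by simp
qed

text \<open>Every term that keeps the vertical argument inside \<mu> vanishes, so the wedge product
  with \<omega>^\<sigma> reduces to its first summand.\<close>

lemma interior_euler_vertical:
  assumes \<mu>: "is_jform U k q \<mu>" and sb: "semibasic \<mu>" and z: "z \<in> U" and v: "\<And>i. v (X i) = 0"
  shows "interior_euler 1 (ext_deriv \<mu>) z (v # vs) = (\<Sum>\<sigma>\<in>UNIV. v (Y \<sigma> {#}) * euler \<sigma> (\<lambda>z. \<mu> z vs) z)"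
proof -
  have zero: "euler \<sigma> (\<lambda>z. \<mu> z (v # ws)) z = 0" for \<sigma> ws
  proof -
    have "euler \<sigma> (\<lambda>z. \<mu> z (v # ws)) z = euler \<sigma> (\<lambda>z. 0) z"
      unfolding euler_eq_form
    proof (rule euler_form_cong[OF _ refl z])
      show "\<mu> z (v # ws) = 0" if "z \<in> U" for z
        using semibasic_vertical[where v = v and us = "[]", OF \<mu> sb that v] by simp
    qed
    then show ?thesis by (simp add: euler_eq_form)
  qed
  have "omega \<sigma> {#} z v = v (Y \<sigma> {#})" for \<sigma>
    by (simp add: omega_def v)
  then show ?thesis
    unfolding interior_euler_semibasic[OF \<mu> sb z]
    by (simp only: length_Cons sum.lessThan_Suc_shift) (simp add: zero)
qed

section \<open>The horizontal differential of the current\<close>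

lemma jet_function_jform_Cons_hor:
  assumes \<Theta>: "is_jform U s p \<Theta>" and W: "\<And>a. jet_order a \<le> s \<Longrightarrow> jet_function U l (\<lambda>z. W z a)" and "Suc s \<le> l"
  shows "jet_function U l (\<lambda>z. \<Theta> z (W z # map (hor_part z) ws))"
proof (rule jet_function_cong)
  have "jet_function U l (\<lambda>z. \<Theta> z (unit_vec a # map (hor_part z) ws))" for a
    using jet_function_mono[OF jet_function_jform_hor[OF \<Theta>, of "[unit_vec a]"] \<open>Suc s \<le> l\<close>] by simp
  then show "jet_function U l (\<lambda>z. \<Sum>a | jet_order a \<le> s. W z a * \<Theta> z (unit_vec a # map (hor_part z) ws))"
    by (intro jet_function_sum jet_function_mult[OF W]) simp_all
  show "(\<Sum>a | jet_order a \<le> s. W z a * \<Theta> z (unit_vec a # map (hor_part z) ws)) =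
      \<Theta> z (W z # map (hor_part z) ws)" if "z \<in> U" for z
    using jform_expand[OF \<Theta> that, of "[]" "W z"] by simp
qed

text \<open>The Leibniz rule for the leading argument alone. The dependence of the form and of the
  remaining horizontal parts on the jet stays together in the first term, because it need not be
  resolved further in the comparison this serves.\<close>

lemma dir_deriv_jform_Cons_hor:
  assumes \<Theta>: "is_jform U s p \<Theta>" and W: "\<And>a. jet_order a \<le> s \<Longrightarrow> jet_function U l (\<lambda>z. W z a)" and z: "z \<in> U"
  shows "dir_deriv w (\<lambda>z'. \<Theta> z' (W z' # map (hor_part z') ws)) z =
    dir_deriv w (\<lambda>z'. \<Theta> z' (W z # map (hor_part z') ws)) z +
    \<Theta> z ((\<lambda>a. dir_deriv w (\<lambda>z'. W z' a) z) # map (hor_part z) ws)"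
proof -
  define m where "m = l + Suc s"
  let ?G = "\<lambda>a z. \<Theta> z (unit_vec a # map (hor_part z) ws)"
  have G: "jet_function U m (?G a)" for a
    using jet_function_mono[OF jet_function_jform_hor[OF \<Theta>, of "[unit_vec a]"], of m ws] by (simp add: m_def)
  have Wm: "jet_function U m (\<lambda>z. W z a)" if "jet_order a \<le> s" for a
    by (rule jet_function_mono[OF W[OF that]]) (simp add: m_def)
  have expand: "\<Theta> z' (v # map (hor_part z') ws) = (\<Sum>a | jet_order a \<le> s. v a * ?G a z')" if "z' \<in> U" for z' v
    using jform_expand[OF \<Theta> that, of "[]" v] by simp
  have "dir_deriv w (\<lambda>z'. \<Theta> z' (W z' # map (hor_part z') ws)) z =
      dir_deriv w (\<lambda>z'. \<Sum>a | jet_order a \<le> s. W z' a * ?G a z') z"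
    by (rule dir_deriv_cong[OF expand z])
  also have "\<dots> = (\<Sum>a | jet_order a \<le> s. dir_deriv w (\<lambda>z'. W z' a * ?G a z') z)"
    by (rule dir_deriv_sum[where k = m, OF _ z], rule jet_function_mult[OF Wm G]) simp
  also have "\<dots> = (\<Sum>a | jet_order a \<le> s. dir_deriv w (\<lambda>z'. W z' a) z * ?G a z + W z a * dir_deriv w (?G a) z)"
    by (rule sum.cong[OF refl], rule dir_deriv_mult[OF Wm G z]) simp
  also have "\<dots> = (\<Sum>a | jet_order a \<le> s. W z a * dir_deriv w (?G a) z) +
      (\<Sum>a | jet_order a \<le> s. dir_deriv w (\<lambda>z'. W z' a) z * ?G a z)"
    by (simp only: sum.distrib add.commute)
  also have "(\<Sum>a | jet_order a \<le> s. W z a * dir_deriv w (?G a) z) =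
      dir_deriv w (\<lambda>z'. \<Sum>a | jet_order a \<le> s. W z a * ?G a z') z"
    using dir_deriv_sum[where k = m and I = "{a. jet_order a \<le> s}" and f = "\<lambda>a z'. W z a * ?G a z'",
        OF jet_function_mult[OF jet_function_const G] z, of w]
    by (simp only: dir_deriv_cmult[OF G z])
  also have "\<dots> = dir_deriv w (\<lambda>z'. \<Theta> z' (W z # map (hor_part z') ws)) z"
    by (rule dir_deriv_cong[OF expand[symmetric] z])
  also have "(\<Sum>a | jet_order a \<le> s. dir_deriv w (\<lambda>z'. W z' a) z * ?G a z) =
      \<Theta> z ((\<lambda>a. dir_deriv w (\<lambda>z'. W z' a) z) # map (hor_part z) ws)"
    by (rule expand[OF z, symmetric])
  finally show ?thesis .
qed

lemma dir_deriv_hor_part: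
  assumes "jet_function U k f" "z \<in> U"
  shows "dir_deriv (hor_part z v) f z = (\<Sum>i\<in>UNIV. v (X i) * dir_deriv (total_vec i z) f z)"
  unfolding dir_deriv_eq[OF assms] hor_part_def sum_distrib_left sum_distrib_right
  by (subst sum.swap) (simp only: mult.assoc)

text \<open>A prolonged vertical field preserves the contact structure.\<close>

lemma dir_deriv_con_part_evolutionary:
  assumes Q: "\<And>\<sigma>. jet_function U q (Q \<sigma>)" and z: "z \<in> U"
  shows "dir_deriv (evolutionary Q z) (\<lambda>z'. con_part z' (hor_part z v) a) z =
    - dir_deriv (hor_part z v) (\<lambda>z'. evolutionary Q z' a) z"
proof (cases a)
  case (Y \<tau> J)
  have "((\<lambda>t. hor_part z v (Y \<tau> J) -
      (\<Sum>i\<in>UNIV. (z (Y \<tau> (add_mset i J)) + t * evolutionary Q z (Y \<tau> (add_mset i J))) * v (X i)))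
      has_real_derivative 0 - (\<Sum>i\<in>UNIV. evolutionary Q z (Y \<tau> (add_mset i J)) * v (X i))) (at 0)"
    by (intro DERIV_diff DERIV_const DERIV_sum) (auto intro!: derivative_eq_intros)
  then have "dir_deriv (evolutionary Q z) (\<lambda>z'. con_part z' (hor_part z v) (Y \<tau> J)) z =
      0 - (\<Sum>i\<in>UNIV. evolutionary Q z (Y \<tau> (add_mset i J)) * v (X i))"
    unfolding dir_deriv_def con_part.simps omega_def hor_part_X by (rule DERIV_imp_deriv)
  also have "\<dots> = - dir_deriv (hor_part z v) (total_deriv J (Q \<tau>)) z"
    unfolding dir_deriv_hor_part[OF jet_function_total_deriv[OF Q] z]
    by (simp add: total_deriv_add_mset[OF Q z] mult.commute)
  finally show ?thesis by (simp only: Y evolutionary.simps)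
qed simp

lemma jform_zero_nth:
  assumes "is_jform U k q \<rho>" "z \<in> U" "j < length vs" "vs ! j = (\<lambda>a. 0)"
  shows "\<rho> z vs = 0"
  using jform_zero[OF assms(1,2), of "take j vs" "drop (Suc j) vs"] id_take_nth_drop[OF assms(3)] assms(4) by simp

text \<open>Contact components of positive degree insert a vertical vector and vanish, so only the
  summand with p_0 remains in d_H.\<close>

lemma hor_deriv_horizontal:
  assumes h: "\<And>z vs. z \<in> U \<Longrightarrow> \<eta> z (map (hor_part z) vs) = \<eta> z vs"
    and zero: "\<And>z vs j. z \<in> U \<Longrightarrow> j < length vs \<Longrightarrow> (\<And>i. (vs ! j) (X i) = 0) \<Longrightarrow> \<eta> z vs = 0"
    and z: "z \<in> U"
  shows "hor_deriv \<eta> z vs = ext_deriv \<eta> z (map (hor_part z) vs)"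
proof -
  have p0: "contact_part 0 \<eta> z ws = \<eta> z ws" if "z \<in> U" for z ws
    unfolding contact_part_0 by (rule h[OF that])
  have pi: "contact_part i \<eta> z ws = 0" if "z \<in> U" "i \<noteq> 0" for z ws i
    unfolding contact_part_def
  proof (rule sum.neutral, rule ballI)
    fix S assume "S \<in> {S. S \<subseteq> {..<length ws} \<and> card S = i}"
    then have "S \<noteq> {}" "S \<subseteq> {..<length ws}" using \<open>i \<noteq> 0\<close> by auto
    then obtain j where j: "j \<in> S" "j < length ws" by blast
    show "\<eta> z (map (\<lambda>j. if j \<in> S then con_part z (ws ! j) else hor_part z (ws ! j)) [0..<length ws]) = 0"
      by (rule zero[OF \<open>z \<in> U\<close>, of j]) (use j in auto)
  qed
  have rest: "contact_part i (ext_deriv (contact_part i \<eta>)) z vs = 0" if "i \<noteq> 0" for i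
  proof -
    have "ext_deriv (contact_part i \<eta>) z ws = 0" for ws
    proof -
      have "ext_deriv (contact_part i \<eta>) z ws = ext_deriv (\<lambda>z ws. 0) z ws"
        by (rule ext_deriv_cong[OF pi[OF _ that] z])
      then show ?thesis by (simp add: ext_deriv_def)
    qed
    then show ?thesis
      unfolding contact_part_def[of i "ext_deriv (contact_part i \<eta>)"] by (simp only: sum.neutral_const)
  qed
  have "hor_deriv \<eta> z vs = (\<Sum>i\<in>{0}. contact_part i (ext_deriv (contact_part i \<eta>)) z vs)"
    unfolding hor_deriv_def by (rule sum.mono_neutral_right) (use rest in auto)
  also have "\<dots> = contact_part 0 (ext_deriv \<eta>) z vs"
  proof -
    have "ext_deriv (contact_part 0 \<eta>) z ws = ext_deriv \<eta> z ws" for ws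
      by (rule ext_deriv_cong[OF p0 z])
    then show ?thesis by (simp add: contact_part_0)
  qed
  finally show ?thesis by (simp only: contact_part_0)
qed

text \<open>
  Both sides are expanded by the Leibniz rule; the terms in which the form itself is
  differentiated agree at once, and the remaining ones by \<open>dir_deriv_con_part_evolutionary\<close>.
\<close>

lemma hor_deriv_contract_contact_part_1:
  assumes Q: "\<And>\<sigma>. jet_function U q (Q \<sigma>)" and \<Theta>: "is_jform U s p \<Theta>" and z: "z \<in> U"
  shows "hor_deriv (\<lambda>z vs. - contract (evolutionary Q) (contact_part 1 \<Theta>) z vs) z vs =
    contact_part 1 (ext_deriv (contact_part 1 \<Theta>)) z (evolutionary Q z # vs)"
proof -
  let ?V = "evolutionary Q"
  let ?\<beta> = "contact_part 1 \<Theta>"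
  let ?h = "\<lambda>j. hor_part z (vs ! j)"
  define m where "m = q + Suc s"
  have zero\<Theta>: "\<Theta> z ((\<lambda>a. 0) # ws) = 0" if "z \<in> U" for z ws
    using jform_zero[OF \<Theta> that, of "[]" ws] by simp
  have \<beta>: "?\<beta> z' (v # ws) = \<Theta> z' (v # map (hor_part z') ws)" if "z' \<in> U" "\<And>i. v (X i) = 0" for z' v ws
    by (rule contact_part_1_vertical[where v = v and \<rho> = \<Theta> and z = z', OF that(2) zero\<Theta>[OF that(1)]])
  have \<beta>V: "?\<beta> z' (?V w # ws) = \<Theta> z' (?V w # map (hor_part z') ws)" if "z' \<in> U" for z' w ws
    by (rule \<beta>[OF that]) simp
  have \<beta>0: "?\<beta> z' ((\<lambda>a. 0) # ws) = 0" if "z' \<in> U" for z' ws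
    using \<beta>[OF that, of "\<lambda>a. 0" ws] zero\<Theta>[OF that] by simp
  have Vm: "jet_function U m (\<lambda>z. ?V z a)" if "jet_order a \<le> s" for a
    by (rule jet_function_mono[OF jet_function_evolutionary[OF Q that]]) (simp add: m_def)
  define \<eta> where "\<eta> z vs = - contract ?V ?\<beta> z vs" for z vs
  have \<eta>: "\<eta> z ws = - \<Theta> z (?V z # map (hor_part z) ws)" if "z \<in> U" for z ws
    unfolding \<eta>_def contract_def by (simp only: \<beta>V[OF that])
  have omit_map: "omit j (map f xs) = map f (omit j xs)" for j f and xs :: "('n, 'm) jvec list"
    by (simp add: take_map drop_map)
  \<comment> \<open>\<open>?A\<close> differentiates everything except the prolonged field in the
    leading slot, \<open>?B\<close> only that field.\<close>
  let ?A = "\<lambda>j. dir_deriv (?h j) (\<lambda>z'. \<Theta> z' (?V z # map (hor_part z') (omit j vs))) z"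
  let ?B = "\<lambda>j. \<Theta> z ((\<lambda>a. dir_deriv (?h j) (\<lambda>z'. ?V z' a) z) # map (hor_part z) (omit j vs))"

  have "hor_deriv \<eta> z vs = ext_deriv \<eta> z (map (hor_part z) vs)"
  proof (rule hor_deriv_horizontal[OF _ _ z])
    show "\<eta> z (map (hor_part z) ws) = \<eta> z ws" if "z \<in> U" for z ws
      by (simp add: \<eta>[OF that] o_def)
    show "\<eta> z ws = 0" if "z \<in> U" "j < length ws" "\<And>i. (ws ! j) (X i) = 0" for z ws j
    proof -
      have "\<Theta> z (?V z # map (hor_part z) ws) = 0"
        by (rule jform_zero_nth[OF \<Theta> that(1), of "Suc j"])
          (use that(2) hor_part_vertical[where v = "ws ! j", OF that(3)] in simp_all)
      then show ?thesis by (simp add: \<eta>[OF that(1)])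
    qed
  qed
  also have "\<dots> = (\<Sum>j<length vs. (-1) ^ j * dir_deriv (?h j) (\<lambda>z'. \<eta> z' (map (hor_part z) (omit j vs))) z)"
    unfolding ext_deriv_def omit_map length_map by (rule sum.cong) simp_all
  also have "\<dots> = (\<Sum>j<length vs. (-1) ^ j * - (?A j + ?B j))"
  proof (intro sum.cong refl arg_cong2[where f = "(*)"])
    fix j
    let ?F = "\<lambda>z'. \<Theta> z' (?V z' # map (hor_part z') (omit j vs))"
    have F: "jet_function U m ?F"
      by (rule jet_function_jform_Cons_hor[OF \<Theta> Vm]) (simp_all add: m_def)
    have "dir_deriv (?h j) (\<lambda>z'. \<eta> z' (map (hor_part z) (omit j vs))) z = dir_deriv (?h j) (\<lambda>z'. (-1) * ?F z') z"
      by (rule dir_deriv_cong[OF _ z]) (simp add: \<eta> o_def)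
    also have "\<dots> = (-1) * dir_deriv (?h j) ?F z"
      by (rule dir_deriv_cmult[OF F z])
    also have "dir_deriv (?h j) ?F z = ?A j + ?B j"
      by (rule dir_deriv_jform_Cons_hor[where W = ?V, OF \<Theta> Vm z])
    finally show "dir_deriv (?h j) (\<lambda>z'. \<eta> z' (map (hor_part z) (omit j vs))) z = - (?A j + ?B j)"
      by simp
  qed
  finally have left: "hor_deriv \<eta> z vs = (\<Sum>j<length vs. (-1) ^ j * - (?A j + ?B j))" .

  have "contact_part 1 (ext_deriv ?\<beta>) z (?V z # vs) = ext_deriv ?\<beta> z (?V z # map (hor_part z) vs)"
  proof (rule contact_part_1_vertical)
    show "?V z (X i) = 0" for i by simp
    fix ws :: "('n, 'm) jvec list"
    have "dir_deriv w (\<lambda>z. ?\<beta> z ((\<lambda>a. 0) # us)) z = dir_deriv w (\<lambda>z. 0) z" for w us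
      by (rule dir_deriv_cong[OF _ z]) (rule \<beta>0)
    then show "ext_deriv ?\<beta> z ((\<lambda>a. 0) # ws) = 0"
      by (simp add: ext_deriv_Cons) (simp add: dir_deriv_def)
  qed
  also have "\<dots> = dir_deriv (?V z) (\<lambda>z'. ?\<beta> z' (map (hor_part z) vs)) z -
      (\<Sum>j<length vs. (-1) ^ j * dir_deriv (?h j) (\<lambda>z'. ?\<beta> z' (?V z # map (hor_part z) (omit j vs))) z)"
    unfolding ext_deriv_Cons omit_map length_map
    by (intro arg_cong2[where f = "(-)"] refl sum.cong) simp
  also have "(\<Sum>j<length vs. (-1) ^ j * dir_deriv (?h j) (\<lambda>z'. ?\<beta> z' (?V z # map (hor_part z) (omit j vs))) z) =
      (\<Sum>j<length vs. (-1) ^ j * ?A j)"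
  proof (intro sum.cong refl arg_cong2[where f = "(*)"] dir_deriv_cong[OF _ z])
    show "?\<beta> z' (?V z # map (hor_part z) (omit j vs)) = \<Theta> z' (?V z # map (hor_part z') (omit j vs))"
      if "z' \<in> U" for z' j
      unfolding \<beta>V[OF that] by (simp add: o_def)
  qed
  also have "dir_deriv (?V z) (\<lambda>z'. ?\<beta> z' (map (hor_part z) vs)) z = (\<Sum>j<length vs. (-1) ^ j * - ?B j)"
  proof -
    \<comment> \<open>\<open>?C j z'\<close> is the contact part at z' of a vector that is
      horizontal at \<open>z\<close>. It vanishes at \<open>z\<close>, so in the Leibniz rule just
      its derivative along the field contributes, and that gives \<open>- ?B j\<close>.\<close>
    let ?C = "\<lambda>j z'. con_part z' (?h j)"
    let ?F = "\<lambda>j z'. \<Theta> z' (?C j z' # map (hor_part z') (omit j vs))"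
    have C: "jet_function U m (\<lambda>z'. ?C j z' a)" if "jet_order a \<le> s" for j a
    proof (rule jet_function_cong)
      show "jet_function U m (\<lambda>z'. ?h j a + (-1) * hor_part z' (?h j) a)"
        by (intro jet_function_add jet_function_mult jet_function_const
            jet_function_mono[OF jet_function_hor_part[OF that]]) (simp add: m_def)
      show "?h j a + (-1) * hor_part z' (?h j) a = ?C j z' a" for z'
        using hor_con_part[of z' "?h j" a] by simp
    qed
    have F: "jet_function U m (?F j)" for j
      by (rule jet_function_jform_Cons_hor[OF \<Theta> C]) (simp_all add: m_def)
    have "dir_deriv (?V z) (\<lambda>z'. ?\<beta> z' (map (hor_part z) vs)) z =
        dir_deriv (?V z) (\<lambda>z'. \<Sum>j<length vs. (-1) ^ j * ?F j z') z"
    proof (rule dir_deriv_cong[OF _ z])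
      fix z' assume z': "z' \<in> U"
      show "?\<beta> z' (map (hor_part z) vs) = (\<Sum>j<length vs. (-1) ^ j * ?F j z')"
        unfolding contact_part_1 length_map
      proof (rule sum.cong[OF refl])
        fix j assume j: "j \<in> {..<length vs}"
        have "\<Theta> z' ([] @ map (hor_part z') (take j vs) @ ?C j z' # map (hor_part z') (drop (Suc j) vs)) =
            (-1) ^ length (map (hor_part z') (take j vs)) *
            \<Theta> z' ([] @ ?C j z' # map (hor_part z') (take j vs) @ map (hor_part z') (drop (Suc j) vs))"
          by (rule jform_move[OF \<Theta> z'])
        then show "\<Theta> z' (map (hor_part z') (take j (map (hor_part z) vs)) @ con_part z' (map (hor_part z) vs ! j) #
            map (hor_part z') (drop (Suc j) (map (hor_part z) vs))) = (-1) ^ j * ?F j z'"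
          using j by (simp add: take_map drop_map o_def)
      qed
    qed
    also have "\<dots> = (\<Sum>j<length vs. (-1) ^ j * dir_deriv (?V z) (?F j) z)"
      using dir_deriv_sum[where k = m and I = "{..<length vs}" and f = "\<lambda>j z'. (-1) ^ j * ?F j z'",
          OF jet_function_mult[OF jet_function_const F] z]
      by (simp only: dir_deriv_cmult[OF F z])
    also have "\<dots> = (\<Sum>j<length vs. (-1) ^ j * - ?B j)"
    proof (intro sum.cong refl arg_cong2[where f = "(*)"])
      fix j
      have C0: "?C j z = (\<lambda>a. 0)"
      proof
        show "?C j z a = 0" for a using hor_con_part[of z "?h j" a] by simp
      qed
      have "dir_deriv (?V z) (?F j) z =
          dir_deriv (?V z) (\<lambda>z'. \<Theta> z' (?C j z # map (hor_part z') (omit j vs))) z +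
          \<Theta> z ((\<lambda>a. dir_deriv (?V z) (\<lambda>z'. ?C j z' a) z) # map (hor_part z) (omit j vs))"
        by (rule dir_deriv_jform_Cons_hor[where W = "?C j", OF \<Theta> C z])
      also have "dir_deriv (?V z) (\<lambda>z'. \<Theta> z' (?C j z # map (hor_part z') (omit j vs))) z = dir_deriv (?V z) (\<lambda>z. 0) z"
        by (rule dir_deriv_cong[OF _ z]) (simp only: C0 zero\<Theta>)
      \<comment> \<open>Written as a linear combination so that \<open>jform_linear\<close> extracts
        the sign.\<close>
      also have "(\<lambda>a. dir_deriv (?V z) (\<lambda>z'. ?C j z' a) z) =
          (\<lambda>a. (-1) * dir_deriv (?h j) (\<lambda>z'. ?V z' a) z + 0 * (0::real))"
        by (simp add: dir_deriv_con_part_evolutionary[OF Q z])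
      also have "\<Theta> z (\<dots> # map (hor_part z) (omit j vs)) = - ?B j"
        using jform_linear[OF \<Theta> z, of "[]" "-1" "\<lambda>a. dir_deriv (?h j) (\<lambda>z'. ?V z' a) z" 0 "\<lambda>a. 0"] by simp
      finally show "dir_deriv (?V z) (?F j) z = - ?B j" by simp
    qed
    finally show ?thesis .
  qed
  also have "(\<Sum>j<length vs. (-1) ^ j * - ?B j) - (\<Sum>j<length vs. (-1) ^ j * ?A j) =
      (\<Sum>j<length vs. (-1) ^ j * - (?A j + ?B j))"
  proof -
    have "p * - b - p * a = p * - (a + b)" for p a b :: real by (simp add: algebra_simps)
    then show ?thesis by (simp only: sum_subtractf[symmetric])
  qed
  finally have "contact_part 1 (ext_deriv ?\<beta>) z (?V z # vs) = (\<Sum>j<length vs. (-1) ^ j * - (?A j + ?B j))" .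
  moreover have "\<eta> = (\<lambda>z vs. - contract ?V ?\<beta> z vs)" by (intro ext) (rule \<eta>_def)
  ultimately show ?thesis using left by (simp only:)
qed

text \<open>In degree n a horizontal form is determined by its value on the coordinate basis. The
  point is that \<open>c\<close> does not depend on \<open>z\<close>, so it passes through the Euler
  operator, and all coefficients are controlled by the one in \<open>euler_coeff\<close>.\<close>

lemma top_form_proportional:
  assumes \<mu>: "is_jform U k CARD('n) \<mu>" and sb: "semibasic \<mu>"
  shows "\<exists>c. \<forall>z\<in>U. \<mu> z vs = c * \<mu> z (map (\<lambda>i. unit_vec (X i)) (sorted_list_of_set UNIV))"
proof -
  let ?b = "\<lambda>i :: 'n. unit_vec (X i) :: ('n, 'm) jvec"
  let ?es = "sorted_list_of_set (UNIV :: 'n set)"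
  \<comment> \<open>Here \<open>c\<close> is a product of the signs from moving each vector into
    place; the prefix \<open>us\<close> holds the vectors already matched.\<close>
  have perm: "\<exists>c. \<forall>z\<in>U. \<mu> z (us @ map ?b xs) = c * \<mu> z (us @ map ?b ys)" if "mset xs = mset ys" for us xs ys
    using that
  proof (induction xs arbitrary: us ys)
    case Nil
    then show ?case by (intro exI[of _ 1]) simp
  next
    case (Cons x xs)
    have "x \<in> set ys" using Cons.prems by (metis list.set_intros(1) mset_eq_setD)
    then obtain y1 y2 where ys: "ys = y1 @ x # y2" by (meson split_list)
    then have "mset xs = mset (y1 @ y2)" using Cons.prems by simp
    from Cons.IH[OF this, of "us @ [?b x]"]
    obtain c where c: "\<forall>z\<in>U. \<mu> z ((us @ [?b x]) @ map ?b xs) = c * \<mu> z ((us @ [?b x]) @ map ?b (y1 @ y2))" by blast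
    have "\<mu> z (us @ map ?b (x # xs)) = (c * (-1) ^ length y1) * \<mu> z (us @ map ?b ys)" if z: "z \<in> U" for z
    proof -
      have "\<mu> z (us @ map ?b ys) = (-1) ^ length y1 * \<mu> z (us @ ?b x # map ?b y1 @ map ?b y2)"
        using jform_move[OF \<mu> z, of us "map ?b y1" "?b x" "map ?b y2"] by (simp add: ys)
      moreover have "(-1::real) ^ length y1 * (-1) ^ length y1 = 1"
        by (simp add: power_mult_distrib[symmetric])
      moreover have "\<mu> z (us @ map ?b (x # xs)) = c * \<mu> z (us @ ?b x # map ?b y1 @ map ?b y2)"
        using c z by simp
      ultimately show ?thesis by (simp add: mult.assoc[symmetric])
    qed
    then show ?case by blast
  qed
  have basis: "\<exists>c. \<forall>z\<in>U. \<mu> z (map ?b is) = c * \<mu> z (map ?b ?es)" for "is"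
  proof (cases "length is = CARD('n) \<and> distinct is")
    case True
    then have "set is = UNIV"
      by (intro card_subset_eq[OF finite subset_UNIV]) (simp add: distinct_card)
    then have "mset is = mset ?es"
      using True by (subst set_eq_iff_mset_eq_distinct[symmetric]) simp_all
    from perm[OF this, of "[]"] show ?thesis by simp
  next
    case False
    have "\<mu> z (map ?b is) = 0" if z: "z \<in> U" for z
    proof (cases "length is = CARD('n)")
      case True
      then have "\<not> distinct (map ?b is)" using False by (auto simp: distinct_map)
      then show ?thesis by (rule jform_alternating[OF \<mu> z])
    next
      case False
      then show ?thesis by (intro jform_length[OF \<mu> z]) simp
    qed
    then show ?thesis by (intro exI[of _ 0]) simp
  qed
  have "\<exists>c. \<forall>z\<in>U. \<mu> z (map ?b is @ vs) = c * \<mu> z (map ?b ?es)" for "is"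
  proof (induction vs arbitrary: "is")
    case Nil
    then show ?case using basis by simp
  next
    case (Cons v vs)
    have "\<forall>i. \<exists>c. \<forall>z\<in>U. \<mu> z (map ?b is @ ?b i # vs) = c * \<mu> z (map ?b ?es)"
    proof
      fix i
      show "\<exists>c. \<forall>z\<in>U. \<mu> z (map ?b is @ ?b i # vs) = c * \<mu> z (map ?b ?es)"
        using Cons.IH[of "is @ [i]"] by simp
    qed
    from choice[OF this] obtain c where c: "\<forall>i. \<forall>z\<in>U. \<mu> z (map ?b is @ ?b i # vs) = c i * \<mu> z (map ?b ?es)" by blast
    have "\<mu> z (map ?b is @ v # vs) = (\<Sum>i\<in>UNIV. v (X i) * c i) * \<mu> z (map ?b ?es)" if z: "z \<in> U" for z
    proof -
      have "\<mu> z (map ?b is @ v # vs) = \<mu> z (map ?b is @ (\<lambda>b. \<Sum>i\<in>UNIV. v (X i) * ?b i b) # vs)"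
        by (rule semibasicD[OF sb z]) (simp add: unit_vec_def if_distrib cong: if_cong)
      also have "\<dots> = (\<Sum>i\<in>UNIV. v (X i) * \<mu> z (map ?b is @ ?b i # vs))"
        by (rule jform_sum[OF \<mu> z finite])
      also have "\<dots> = (\<Sum>i\<in>UNIV. v (X i) * c i) * \<mu> z (map ?b ?es)"
        using c z by (simp add: sum_distrib_right mult.assoc)
      finally show ?thesis .
    qed
    then show ?case by blast
  qed
  from this[of "[]"] show ?thesis by simp
qed

text \<open>The induction runs over \<open>g\<close>: a partial of the composite has the same shape,
  with \<open>g\<close> replaced by its derivative in a fixed direction, again smooth on
  \<open>S\<close>. The linear map \<open>h\<close>, which reads off a component, stays the
  same.\<close>

lemma jet_function_base_fibre:
  fixes g :: "('n, 'm) total_space \<Rightarrow> 'c::real_normed_vector" and h :: "'c \<Rightarrow> real"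
  assumes g: "smooth_on S g" and S: "\<And>z. z \<in> U \<Longrightarrow> base_fibre z \<in> S" and h: "bounded_linear h"
  shows "jet_function U 0 (\<lambda>z. h (g (base_fibre z)))"
proof (rule jet_functionI)
  fix z z' :: "('n, 'm) jet" assume "\<And>a. jet_order a \<le> 0 \<Longrightarrow> z a = z' a"
  then have "base_fibre z = base_fibre z'" by (simp add: base_fibre_def)
  then show "h (g (base_fibre z)) = h (g (base_fibre z'))" by simp
next
  interpret h: bounded_linear h by (rule h)
  \<comment> \<open>The velocity of the base point when coordinate \<open>a\<close> moves; zero for
    coordinates of positive order.\<close>
  let ?d = "\<lambda>a. case a of X i \<Rightarrow> (axis i 1, 0) | Y \<sigma> I \<Rightarrow> if I = {#} then (0, axis \<sigma> 1) else 0"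
  show "partials_upto m U (\<lambda>z. h (g (base_fibre z)))" for m
    using g
  proof (induction m arbitrary: g)
    case 0
    have "continuous_on S g" using 0[unfolded smooth_on_def, rule_format, of 0] by simp
    then have "continuous_on U (\<lambda>z. g (base_fibre z))"
      by (rule continuous_on_compose2[OF _ continuous_on_base_fibre]) (use S in auto)
    then show ?case using h.continuous_on by simp
  next
    case (Suc m)
    have cont: "continuous_on S g" using Suc.prems[unfolded smooth_on_def, rule_format, of 0] by simp
    have diff: "g differentiable (at u)" if "u \<in> S" for u
      using Suc.prems[unfolded smooth_on_def, rule_format, of "Suc 0"] that by simp
    have smooth: "smooth_on S (\<lambda>u. frechet_derivative g (at u) v)" for v
      unfolding smooth_on_def
    proof
      show "cont_diff_on l S (\<lambda>u. frechet_derivative g (at u) v)" for l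
        using Suc.prems[unfolded smooth_on_def, rule_format, of "Suc l"] unfolding cont_diff_on.simps by blast
    qed
    show ?case
    proof (rule partials_upto_SucI)
      have "continuous_on U (\<lambda>z. g (base_fibre z))"
        by (rule continuous_on_compose2[OF cont continuous_on_base_fibre]) (use S in auto)
      then show "continuous_on U (\<lambda>z. h (g (base_fibre z)))" by (rule h.continuous_on)
      show "partials_upto m U (\<lambda>z. h (frechet_derivative g (at (base_fibre z)) (?d a)))" for a
        by (rule Suc.IH[OF smooth])
      show "((\<lambda>t. h (g (base_fibre (z(a := t))))) has_real_derivative
          h (frechet_derivative g (at (base_fibre z)) (?d a))) (at (z a))" if "z \<in> U" for a z
      proof -
        have g': "(g has_derivative frechet_derivative g (at (base_fibre z))) (at (base_fibre z))"
          using diff[OF S[OF that]] by (simp add: frechet_derivative_works)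
        have "((\<lambda>t. base_fibre z + (t - z a) *\<^sub>R ?d a) has_derivative (\<lambda>t. t *\<^sub>R ?d a)) (at (z a))"
          by (auto intro!: derivative_eq_intros)
        then have "((\<lambda>t. base_fibre (z(a := t))) has_derivative (\<lambda>t. t *\<^sub>R ?d a)) (at (z a))"
          unfolding base_fibre_upd .
        moreover have "(g has_derivative frechet_derivative g (at (base_fibre z))) (at (base_fibre (z(a := z a))))"
          using g' by (simp only: fun_upd_triv)
        ultimately have "((\<lambda>t. g (base_fibre (z(a := t)))) has_derivative
            (\<lambda>t. frechet_derivative g (at (base_fibre z)) (t *\<^sub>R ?d a))) (at (z a))"
          by (rule has_derivative_compose)
        then have "((\<lambda>t. h (g (base_fibre (z(a := t))))) has_derivative
            (\<lambda>t. h (frechet_derivative g (at (base_fibre z)) (t *\<^sub>R ?d a)))) (at (z a))"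
          by (rule h.has_derivative)
        moreover have "h (frechet_derivative g (at (base_fibre z)) (t *\<^sub>R ?d a)) =
            h (frechet_derivative g (at (base_fibre z)) (?d a)) * t" for t
          using linear_scale[OF has_derivative_linear[OF g']] by (simp add: h.scaleR mult.commute)
        ultimately show ?thesis by (simp only: has_field_derivative_def)
      qed
    qed
  qed
qed

end

section \<open>Symmetries and Jacobi fields\<close>

context jet_region
begin

text \<open>With a characteristic of order zero, d_I Q has order |I|, so differentiating along the
  prolonged field does not raise the order \<open>k\<close>.\<close>

lemma lie_deriv_evolutionary:
  assumes \<mu>: "is_jform U k q \<mu>" and sb: "semibasic \<mu>" and Q: "\<And>\<sigma>. jet_function U 0 (Q \<sigma>)"
  shows "z \<in> U \<Longrightarrow> lie_deriv (evolutionary Q) \<mu> z vs = dir_deriv (evolutionary Q z) (\<lambda>z. \<mu> z vs) z"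
    and "is_jform U k q (lie_deriv (evolutionary Q) \<mu>)"
    and "semibasic (lie_deriv (evolutionary Q) \<mu>)"
proof -
  have X: "evolutionary Q z (X i) = evolutionary Q z' (X i)" for z z' i by simp
  show eq: "lie_deriv (evolutionary Q) \<mu> z vs = dir_deriv (evolutionary Q z) (\<lambda>z. \<mu> z vs) z" if "z \<in> U" for z vs
    by (rule lie_deriv_semibasic[where V = "evolutionary Q", OF sb X that])
  have jet: "jet_function U k (\<lambda>z. dir_deriv (evolutionary Q z) f z)" if "jet_function U k f" for f
    using jet_function_dir_deriv_evolutionary[OF Q that] by simp
  show "is_jform U k q (lie_deriv (evolutionary Q) \<mu>)" "semibasic (lie_deriv (evolutionary Q) \<mu>)"
    by (rule is_jform_operator[where T = "\<lambda>f z. dir_deriv (evolutionary Q z) f z",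
        OF \<mu> sb eq jet dir_deriv_linear dir_deriv_cong]; assumption)+
qed

lemma euler_cong:
  assumes "\<And>z. z \<in> U \<Longrightarrow> f z = g z" "z \<in> U"
  shows "euler \<sigma> f z = euler \<sigma> g z"
  unfolding euler_eq_form by (rule euler_form_cong[OF assms(1) refl assms(2)])

lemma euler_cmult: "jet_function U k f \<Longrightarrow> z \<in> U \<Longrightarrow> euler \<sigma> (\<lambda>z. c * f z) z = c * euler \<sigma> f z"
  unfolding euler_eq_form by (rule euler_form_cmult_left[OF _ jet_function_const])

lemma euler_linear:
  assumes f: "jet_function U k f" and g: "jet_function U k g" and z: "z \<in> U"
  shows "euler \<sigma> (\<lambda>z. s * f z + t * g z) z = s * euler \<sigma> f z + t * euler \<sigma> g z"
  using euler_form_add_left[OF jet_function_mult[OF jet_function_const f] jet_function_mult[OF jet_function_const g]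
      jet_function_const z, of \<sigma> s t 1] euler_cmult[OF f z, of \<sigma> s] euler_cmult[OF g z, of \<sigma> t]
  unfolding euler_eq_form by simp

lemma euler_lagrange_vertical:
  assumes "is_jform U k q \<mu>" "semibasic \<mu>" "z \<in> U" "\<And>i. v (X i) = 0"
  shows "euler_lagrange \<mu> z (v # vs) = (\<Sum>\<sigma>\<in>UNIV. v (Y \<sigma> {#}) * euler \<sigma> (\<lambda>z. \<mu> z vs) z)"
  unfolding euler_lagrange_def by (rule interior_euler_vertical[where v = v, OF assms])

lemma contract_euler_lagrange:
  assumes \<mu>: "is_jform U k q \<mu>" and sb: "semibasic \<mu>" and Q: "\<And>\<sigma>. jet_function U 0 (Q \<sigma>)"
  shows "z \<in> U \<Longrightarrow> contract (evolutionary Q) (euler_lagrange \<mu>) z vs = (\<Sum>\<sigma>\<in>UNIV. Q \<sigma> z * euler \<sigma> (\<lambda>z. \<mu> z vs) z)"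
    and "is_jform U (2 * k) q (contract (evolutionary Q) (euler_lagrange \<mu>))"
    and "semibasic (contract (evolutionary Q) (euler_lagrange \<mu>))"
proof -
  show eq: "contract (evolutionary Q) (euler_lagrange \<mu>) z vs = (\<Sum>\<sigma>\<in>UNIV. Q \<sigma> z * euler \<sigma> (\<lambda>z. \<mu> z vs) z)"
    if "z \<in> U" for z vs
    unfolding contract_def using euler_lagrange_vertical[where v = "evolutionary Q z" and vs = vs, OF \<mu> sb that] by simp
  let ?T = "\<lambda>f z. \<Sum>\<sigma>\<in>UNIV. Q \<sigma> z * euler \<sigma> f z"
  have jet: "jet_function U (2 * k) (?T f)" if "jet_function U k f" for f
    by (intro jet_function_sum jet_function_mult[OF jet_function_mono[OF Q] jet_function_euler[OF that]]) simp
  have lin: "?T (\<lambda>z. s * f z + t * g z) z = s * ?T f z + t * ?T g z"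
    if "jet_function U k f" "jet_function U k g" "z \<in> U" for f g s t z
    by (simp add: euler_linear[OF that] distrib_left sum.distrib sum_distrib_left mult.left_commute)
  have cong: "?T f z = ?T g z" if "\<And>z. z \<in> U \<Longrightarrow> f z = g z" "z \<in> U" for f g z
    by (intro sum.cong refl arg_cong2[where f = "(*)"] euler_cong[OF that])
  show "is_jform U (2 * k) q (contract (evolutionary Q) (euler_lagrange \<mu>))"
    "semibasic (contract (evolutionary Q) (euler_lagrange \<mu>))"
    by (rule is_jform_operator[where T = ?T, OF \<mu> sb eq jet lin cong]; assumption)+
qed

text \<open>The first variation formula. The defining identity of the residual operator, with the
  prolonged field inserted in the first slot, expresses the variation of \<Lambda> as the
  contraction with E_n plus d_H of the current. It holds for every \<open>R\<close>, although
  residual operators are not unique.\<close>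

lemma hor_deriv_noether:
  assumes \<Lambda>: "is_jform U k CARD('n) \<Lambda>" and sb: "semibasic \<Lambda>" and Q: "\<And>\<sigma>. jet_function U 0 (Q \<sigma>)"
    and R: "residual_operator U R" and z: "z \<in> U"
  shows "hor_deriv (\<lambda>z vs. - contract (evolutionary Q) (contact_part 1 (R 1 (ext_deriv \<Lambda>))) z vs) z vs =
    dir_deriv (evolutionary Q z) (\<lambda>z. \<Lambda> z vs) z - contract (evolutionary Q) (euler_lagrange \<Lambda>) z vs"
proof -
  let ?V = "evolutionary Q"
  let ?\<Theta> = "R 1 (ext_deriv \<Lambda>)"
  have "is_jform U k (CARD('n) + 1) (ext_deriv \<Lambda>)"
    using is_jform_ext_deriv[OF \<Lambda>] by simp
  then have R1: "(\<exists>s'. is_jform U s' (CARD('n) + 1 - 1) ?\<Theta>) \<and>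
      (\<forall>z\<in>U. \<forall>vs. contact_part 1 (ext_deriv \<Lambda>) z vs =
           interior_euler 1 (ext_deriv \<Lambda>) z vs + contact_part 1 (ext_deriv (contact_part 1 ?\<Theta>)) z vs)"
    using R[unfolded residual_operator_def, THEN conjunct1, rule_format, of 1 k "ext_deriv \<Lambda>"] by simp
  then obtain s where \<Theta>: "is_jform U s (CARD('n) + 1 - 1) ?\<Theta>" by blast
  have "contact_part 1 (ext_deriv \<Lambda>) z (?V z # vs) = interior_euler 1 (ext_deriv \<Lambda>) z (?V z # vs) +
      contact_part 1 (ext_deriv (contact_part 1 ?\<Theta>)) z (?V z # vs)"
    using R1 z by blast
  moreover have "contact_part 1 (ext_deriv \<Lambda>) z (?V z # vs) = dir_deriv (?V z) (\<lambda>z. \<Lambda> z vs) z"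
    by (rule contact_part_1_ext_deriv[OF \<Lambda> sb z]) simp
  ultimately show ?thesis
    using hor_deriv_contract_contact_part_1[where Q = Q and vs = vs, OF Q \<Theta> z]
    by (simp add: contract_def euler_lagrange_def)
qed

lemma noether_current_first_variation:
  assumes \<mu>: "is_jform U k CARD('n) \<mu>" and sb: "semibasic \<mu>"
    and Q1: "\<And>\<sigma>. jet_function U 0 (Q1 \<sigma>)" and Q2: "\<And>\<sigma>. jet_function U 0 (Q2 \<sigma>)"
    and R: "residual_operator U R" and z: "z \<in> U"
    and symmetry: "lie_deriv (evolutionary Q2) (lie_deriv (evolutionary Q1) \<mu>) z vs = 0"
    and jacobi: "contract (evolutionary Q2)
      (euler_lagrange (contract (evolutionary Q1) (euler_lagrange \<mu>))) z vs = 0"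
  shows "hor_deriv (\<lambda>z vs. - contract (evolutionary Q2)
    (contact_part 1 (R 1 (ext_deriv (lie_deriv (evolutionary Q1) \<mu>)))) z vs) z vs = 0"
proof -
  note L = lie_deriv_evolutionary[OF \<mu> sb Q1]
  note E = contract_euler_lagrange[OF \<mu> sb Q1]
  have "dir_deriv (evolutionary Q2 z) (\<lambda>z. lie_deriv (evolutionary Q1) \<mu> z vs) z = 0"
    using symmetry lie_deriv_evolutionary(1)[OF L(2,3) Q2 z] by simp
  moreover have "contract (evolutionary Q2) (euler_lagrange (lie_deriv (evolutionary Q1) \<mu>)) z vs = 0"
  proof -
    have "euler \<sigma> (\<lambda>z. lie_deriv (evolutionary Q1) \<mu> z vs) z =
        euler \<sigma> (\<lambda>z. contract (evolutionary Q1) (euler_lagrange \<mu>) z vs) z" for \<sigma>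
    proof -
      have "euler \<sigma> (\<lambda>z. lie_deriv (evolutionary Q1) \<mu> z vs) z =
          euler \<sigma> (\<lambda>z. dir_deriv (evolutionary Q1 z) (\<lambda>z. \<mu> z vs) z) z"
        by (rule euler_cong[OF L(1) z])
      also have "\<dots> = euler \<sigma> (\<lambda>z. \<Sum>\<tau>\<in>UNIV. Q1 \<tau> z * euler \<tau> (\<lambda>z. \<mu> z vs) z) z"
        by (rule euler_first_variation[OF Q1 jform_jet_function[OF \<mu>] z])
      also have "\<dots> = euler \<sigma> (\<lambda>z. contract (evolutionary Q1) (euler_lagrange \<mu>) z vs) z"
        by (rule euler_cong[OF E(1)[symmetric] z])
      finally show ?thesis .
    qed
    then show ?thesis
      using jacobi unfolding contract_euler_lagrange(1)[OF L(2,3) Q2 z] contract_euler_lagrange(1)[OF E(2,3) Q2 z]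
      by simp
  qed
  ultimately show ?thesis
    unfolding hor_deriv_noether[OF L(2,3) Q2 R z] by simp
qed

text \<open>Vanishing of \<open>euler_coeff\<close> concerns one frame, made of the total vectors at
  \<open>z\<close>. Horizontality replaces them by constant basis vectors, and proportionality in
  top degree then reaches arbitrary \<open>vs\<close>.\<close>

lemma euler_critical:
  assumes \<mu>: "is_jform U k CARD('n) \<mu>" and sb: "semibasic \<mu>" and z: "z \<in> U"
    and critical: "euler_coeff \<sigma> \<mu> z = 0"
  shows "euler \<sigma> (\<lambda>z. \<mu> z vs) z = 0"
proof -
  let ?es = "map (\<lambda>i. unit_vec (X i)) (sorted_list_of_set UNIV) :: ('n, 'm) jvec list"
  let ?ts = "map (\<lambda>i. total_vec i z) (sorted_list_of_set UNIV)"
  have "euler_coeff \<sigma> \<mu> z =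
      (\<Sum>\<tau>\<in>UNIV. (unit_vec (Y \<sigma> {#}) :: ('n, 'm) jvec) (Y \<tau> {#}) * euler \<tau> (\<lambda>z. \<mu> z ?ts) z)"
    unfolding euler_coeff_def by (rule euler_lagrange_vertical[where v = "unit_vec (Y \<sigma> {#})", OF \<mu> sb z]) (simp add: unit_vec_def)
  also have "\<dots> = (\<Sum>\<tau>\<in>UNIV. if \<tau> = \<sigma> then euler \<tau> (\<lambda>z. \<mu> z ?ts) z else 0)"
    by (rule sum.cong) (auto simp: unit_vec_def)
  also have "\<dots> = euler \<sigma> (\<lambda>z. \<mu> z ?ts) z" by simp
  also have "\<dots> = euler \<sigma> (\<lambda>z. \<mu> z ?es) z"
    by (rule euler_cong[OF semibasicD[OF sb] z]) (auto simp: unit_vec_def fun_eq_iff)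
  finally have es: "euler \<sigma> (\<lambda>z. \<mu> z ?es) z = 0" using critical by simp
  obtain c where c: "\<forall>z\<in>U. \<mu> z vs = c * \<mu> z ?es"
    using top_form_proportional[OF \<mu> sb] by blast
  have "euler \<sigma> (\<lambda>z. \<mu> z vs) z = euler \<sigma> (\<lambda>z. c * \<mu> z ?es) z"
    by (rule euler_cong[OF _ z]) (use c in simp)
  then show ?thesis
    by (simp only: euler_cmult[OF jform_jet_function[OF \<mu>] z] es mult_zero_right)
qed

text \<open>The argument takes place at a single jet where all Euler coefficients vanish, and it
  gives zero on all lists of vectors, not just on those tangent to a section.\<close>

lemma noether_current_jacobi_field:
  assumes \<mu>: "is_jform U k CARD('n) \<mu>" and sb: "semibasic \<mu>"
    and Q1: "\<And>\<sigma>. jet_function U 0 (Q1 \<sigma>)" and Q2: "\<And>\<sigma>. jet_function U 0 (Q2 \<sigma>)"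
    and R: "residual_operator U R" and z: "z \<in> U"
    and jacobi1: "\<And>vs. euler_lagrange (contract (evolutionary Q1) (euler_lagrange \<mu>)) z vs = 0"
    and jacobi2: "\<And>vs. euler_lagrange (contract (evolutionary Q2) (euler_lagrange \<mu>)) z vs = 0"
    and critical: "\<And>\<sigma>. euler_coeff \<sigma> \<mu> z = 0"
  shows "hor_deriv (\<lambda>z vs. - contract (evolutionary Q2)
    (contact_part 1 (R 1 (ext_deriv (contract (evolutionary Q1) (euler_lagrange \<mu>))))) z vs) z vs = 0"
proof -
  note E1 = contract_euler_lagrange[OF \<mu> sb Q1]
  note E2 = contract_euler_lagrange[OF \<mu> sb Q2]
  let ?f = "\<lambda>z. \<mu> z vs"
  have f: "jet_function U k ?f" by (rule jform_jet_function[OF \<mu>])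
  have Ef: "jet_function U (2 * k) (euler \<tau> ?f)" for \<tau> by (rule jet_function_euler[OF f])
  have Q1': "jet_function U (2 * k) (Q1 \<tau>)" for \<tau> by (rule jet_function_mono[OF Q1]) simp
  have crit: "euler \<tau> ?f z = 0" for \<tau> by (rule euler_critical[OF \<mu> sb z critical])
  have var: "dir_deriv (evolutionary Q2 z) (euler \<tau> ?f) z = 0" for \<tau>
  proof -
    \<comment> \<open>Inserting \<partial>/\<partial>y^\<tau> isolates one component of the Jacobi
      equation of the second field.\<close>
    have "0 = euler_lagrange (contract (evolutionary Q2) (euler_lagrange \<mu>)) z (unit_vec (Y \<tau> {#}) # vs)"
      by (simp only: jacobi2)
    also have "\<dots> = (\<Sum>\<sigma>\<in>UNIV. (unit_vec (Y \<tau> {#}) :: ('n, 'm) jvec) (Y \<sigma> {#}) *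
        euler \<sigma> (\<lambda>z. contract (evolutionary Q2) (euler_lagrange \<mu>) z vs) z)"
      by (rule euler_lagrange_vertical[where v = "unit_vec (Y \<tau> {#})", OF E2(2,3) z]) (simp add: unit_vec_def)
    also have "\<dots> = (\<Sum>\<sigma>\<in>UNIV. if \<sigma> = \<tau> then
        euler \<sigma> (\<lambda>z. contract (evolutionary Q2) (euler_lagrange \<mu>) z vs) z else 0)"
      by (rule sum.cong) (auto simp: unit_vec_def)
    also have "\<dots> = euler \<tau> (\<lambda>z. contract (evolutionary Q2) (euler_lagrange \<mu>) z vs) z" by simp
    also have "\<dots> = euler \<tau> (\<lambda>z. \<Sum>\<sigma>\<in>UNIV. Q2 \<sigma> z * euler \<sigma> ?f z) z"
      by (rule euler_cong[OF E2(1) z])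
    also have "\<dots> = dir_deriv (evolutionary Q2 z) (euler \<tau> ?f) z +
        (\<Sum>\<sigma>\<in>UNIV. coord_partial (Y \<tau> {#}) (Q2 \<sigma>) z * euler \<sigma> ?f z)"
      by (rule euler_second_variation[OF Q2 f z])
    finally show ?thesis by (simp add: crit)
  qed
  have "dir_deriv (evolutionary Q2 z) (\<lambda>z. contract (evolutionary Q1) (euler_lagrange \<mu>) z vs) z =
      dir_deriv (evolutionary Q2 z) (\<lambda>z. \<Sum>\<tau>\<in>UNIV. Q1 \<tau> z * euler \<tau> ?f z) z"
    by (rule dir_deriv_cong[OF E1(1) z])
  also have "\<dots> = (\<Sum>\<tau>\<in>UNIV. dir_deriv (evolutionary Q2 z) (\<lambda>z. Q1 \<tau> z * euler \<tau> ?f z) z)"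
    by (rule dir_deriv_sum[where k = "2 * k", OF jet_function_mult[OF Q1' Ef] z])
  \<comment> \<open>By the Leibniz rule each term contains E_\<tau> or its derivative along the
    second field, both zero at \<open>z\<close>.\<close>
  also have "\<dots> = 0"
    by (simp add: dir_deriv_mult[OF Q1' Ef z] crit var)
  finally have "dir_deriv (evolutionary Q2 z) (\<lambda>z. contract (evolutionary Q1) (euler_lagrange \<mu>) z vs) z = 0" .
  then show ?thesis
    unfolding hor_deriv_noether[OF E1(2,3) Q2 R z] by (simp add: contract_def jacobi1)
qed

end

section \<open>From regions of jets to fibered charts\<close>

lemma jet_domain_iff: "z \<in> jet_domain C \<longleftrightarrow> base_fibre z \<in> snd (fst C) ` fst (fst C)"
  by (cases C, cases "fst C") (auto simp: jet_domain_def)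

lemma jet_region_jet_domain:
  fixes C :: "('x::{second_countable_topology, t2_space}, 'y::{second_countable_topology, t2_space},
    'n::{finite, linorder}, 'm::finite) fchart"
  assumes "C \<in> fibered_charts F"
  shows "jet_region (jet_domain C)"
proof
  have "(fst (fst C), snd (fst C)) \<in> maximal_atlas (total_atlas F)"
    using assms by (auto simp: fibered_charts_def)
  then have "open (snd (fst C) ` fst (fst C))"
    by (auto simp: maximal_atlas_def is_chart_def)
  then have "open (base_fibre -` (snd (fst C) ` fst (fst C)) :: ('n, 'm) jet set)"
    by (rule open_vimage[OF _ continuous_on_base_fibre])
  moreover have "jet_domain C = base_fibre -` (snd (fst C) ` fst (fst C))"
    by (auto simp: jet_domain_iff)
  ultimately show "open (jet_domain C)" by simp
  fix z z' assume z: "z \<in> jet_domain C" and eq: "\<And>a. jet_order a = 0 \<Longrightarrow> z a = z' a"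
  have "base_fibre z = base_fibre z'" by (simp add: base_fibre_def eq)
  with z show "z' \<in> jet_domain C" by (simp add: jet_domain_iff)
qed

lemma vertical_field_jet_function:
  assumes C: "C \<in> fibered_charts F" and \<Xi>: "vertical_field F \<Xi>"
  shows "jet_function (jet_domain C) 0 (\<lambda>z. snd (\<Xi> C (base_fibre z)) $ \<sigma>)"
proof -
  interpret jet_region "jet_domain C" by (rule jet_region_jet_domain[OF C])
  show ?thesis
  proof (rule jet_function_base_fibre[where h = "\<lambda>u. snd u $ \<sigma>"])
    show "smooth_on (snd (fst C) ` fst (fst C)) (\<Xi> C)"
      using \<Xi> C unfolding vertical_field_def vector_field_def by (cases C, cases "fst C") auto
    show "bounded_linear (\<lambda>u. snd u $ \<sigma>)"
      by (rule bounded_linear_compose[OF bounded_linear_vec_nth bounded_linear_snd])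
  qed (simp add: jet_domain_iff)
qed

text \<open>Connects pull-back with evaluation at a jet: the base chart recovers \<open>x\<close>
  from its coordinates, and the jet lies over the chart domain because its order-zero coordinates
  are those of \<gamma> x.\<close>

lemma section_point:
  assumes C: "C \<in> fibered_charts F" and \<gamma>: "local_section F W \<gamma>" and x: "x \<in> W" "\<gamma> x \<in> fst (fst C)"
  shows "inv_into (fst (snd C)) (snd (snd C)) (snd (snd C) x) = x" "jet_coord C \<gamma> x \<in> jet_domain C"
proof -
  obtain V \<psi> B \<phi> where C_eq: "C = ((V, \<psi>), (B, \<phi>))" by (cases C) auto
  have base: "(B, \<phi>) \<in> maximal_atlas (base_atlas F)" "B = proj F ` V" "\<And>p. p \<in> V \<Longrightarrow> fst (\<psi> p) = \<phi> (proj F p)"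
    using C by (auto simp: fibered_charts_def C_eq)
  have "proj F (\<gamma> x) = x" using \<gamma> x(1) by (auto simp: local_section_def)
  moreover have V: "\<gamma> x \<in> V" using x(2) by (simp add: C_eq)
  ultimately have "x \<in> B" and fst: "fst (\<psi> (\<gamma> x)) = \<phi> x" using base(2,3) by force+
  obtain \<theta> where "homeomorphism B (\<phi> ` B) \<phi> \<theta>"
    using base(1) by (auto simp: maximal_atlas_def is_chart_def)
  then have "inj_on \<phi> B" by (metis homeomorphism_apply1 inj_onI)
  then have inv: "inv_into B \<phi> (\<phi> x) = x" using \<open>x \<in> B\<close> by (rule inv_into_f_f)
  then show "inv_into (fst (snd C)) (snd (snd C)) (snd (snd C) x) = x" by (simp add: C_eq)
  have "base_fibre (jet_coord C \<gamma> x) = \<psi> (\<gamma> x)"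
    by (rule prod_eqI) (simp_all add: base_fibre_def C_eq multi_partial_def inv fst vec_eq_iff)
  then show "jet_coord C \<gamma> x \<in> jet_domain C"
    using V by (simp add: jet_domain_iff C_eq)
qed

lemma noether_current_evolutionary:
  "noether_current R \<xi> \<Lambda> =
    (\<lambda>z vs. - contract (evolutionary (\<lambda>\<sigma> z. snd (\<xi> (base_fibre z)) $ \<sigma>)) (contact_part 1 (R 1 (ext_deriv \<Lambda>))) z vs)"
  by (intro ext) (simp only: noether_current_def prolong_eq_evolutionary)

theorem theorem2p17:
  fixes F :: "('x::{second_countable_topology, t2_space}, 'y::{second_countable_topology, t2_space},
               'n::{finite, linorder}, 'm::finite) fibration"
    and \<rho> :: "('x, 'y, 'n, 'm) fchart \<Rightarrow> ('n, 'm) jform"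
    and \<Xi>1 \<Xi>2 :: "('x, 'y, 'n, 'm) field_components"
    and r :: nat
  assumes "fibered_manifold F"
    and "1 \<le> r"
    and "form_on_jets F (r - 1) CARD('n) \<rho>"
    and "vertical_field F \<Xi>1"
    and "vertical_field F \<Xi>2"
  shows
    "((\<forall>C\<in>fibered_charts F. vanishes_on (jet_domain C)
         (lie_deriv (prolong (\<Xi>2 C)) (lie_deriv (prolong (\<Xi>1 C)) (horizontalization (\<rho> C))))) \<and>
      (\<forall>C\<in>fibered_charts F. vanishes_on (jet_domain C)
         (contract (prolong (\<Xi>2 C)) (jacobi_morphism (\<Xi>1 C) (horizontalization (\<rho> C)))))
      \<longrightarrow>
      (\<forall>C\<in>fibered_charts F. \<forall>R. residual_operator (jet_domain C) R \<longrightarrow>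
         vanishes_on (jet_domain C)
           (hor_deriv (noether_current R (\<Xi>2 C)
             (lie_deriv (prolong (\<Xi>1 C)) (horizontalization (\<rho> C)))))))
     \<and>
     ((\<forall>C\<in>fibered_charts F. vanishes_on (jet_domain C)
         (jacobi_morphism (\<Xi>1 C) (horizontalization (\<rho> C)))) \<and>
      (\<forall>C\<in>fibered_charts F. vanishes_on (jet_domain C)
         (jacobi_morphism (\<Xi>2 C) (horizontalization (\<rho> C))))
      \<longrightarrow>
      (\<forall>W \<gamma>. critical_section F (\<lambda>C. horizontalization (\<rho> C)) W \<gamma> \<longrightarrow>
        (\<forall>C\<in>fibered_charts F. \<forall>R. residual_operator (jet_domain C) R \<longrightarrow>
          vanishes_along C W \<gamma>
            (hor_deriv (noether_current R (\<Xi>2 C)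
              (contract (prolong (\<Xi>1 C)) (euler_lagrange (horizontalization (\<rho> C)))))))))"
proof -
  have \<mu>: "is_jform (jet_domain C) r CARD('n) (horizontalization (\<rho> C))"
    and sb: "jet_region.semibasic (jet_domain C) (horizontalization (\<rho> C))"
    if "C \<in> fibered_charts F" for C
  proof -
    interpret jet_region "jet_domain C" by (rule jet_region_jet_domain[OF that])
    \<comment> \<open>Horizontalization raises the order by one, and 1 \<le> r makes Suc (r - 1)
      equal to r.\<close>
    have "is_jform (jet_domain C) (r - 1) CARD('n) (\<rho> C)"
      using assms(3) that by (simp add: form_on_jets_def)
    from is_jform_contact_part_0[OF this]
    show "is_jform (jet_domain C) r CARD('n) (horizontalization (\<rho> C))"
      using \<open>1 \<le> r\<close> by (simp add: horizontalization_def)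
    show "semibasic (horizontalization (\<rho> C))"
      unfolding horizontalization_def by (rule semibasic_contact_part_0)
  qed
  note Q1 = vertical_field_jet_function[OF _ \<open>vertical_field F \<Xi>1\<close>]
  note Q2 = vertical_field_jet_function[OF _ \<open>vertical_field F \<Xi>2\<close>]
  show ?thesis
  proof (intro conjI impI ballI allI)
    fix C R
    assume hyp: "(\<forall>C\<in>fibered_charts F. vanishes_on (jet_domain C)
         (lie_deriv (prolong (\<Xi>2 C)) (lie_deriv (prolong (\<Xi>1 C)) (horizontalization (\<rho> C))))) \<and>
      (\<forall>C\<in>fibered_charts F. vanishes_on (jet_domain C)
         (contract (prolong (\<Xi>2 C)) (jacobi_morphism (\<Xi>1 C) (horizontalization (\<rho> C)))))"
      and C: "C \<in> fibered_charts F" and R: "residual_operator (jet_domain C) R"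
    interpret jet_region "jet_domain C" by (rule jet_region_jet_domain[OF C])
    show "vanishes_on (jet_domain C) (hor_deriv (noether_current R (\<Xi>2 C)
        (lie_deriv (prolong (\<Xi>1 C)) (horizontalization (\<rho> C)))))"
      unfolding vanishes_on_def noether_current_evolutionary prolong_eq_evolutionary
    proof (intro ballI allI)
      fix z vs assume z: "z \<in> jet_domain C"
      show "hor_deriv (\<lambda>z vs. - contract (evolutionary (\<lambda>\<sigma> z. snd (\<Xi>2 C (base_fibre z)) $ \<sigma>))
          (contact_part 1 (R 1 (ext_deriv (lie_deriv (evolutionary (\<lambda>\<sigma> z. snd (\<Xi>1 C (base_fibre z)) $ \<sigma>))
            (horizontalization (\<rho> C)))))) z vs) z vs = 0"
        by (rule noether_current_first_variation[OF \<mu>[OF C] sb[OF C] Q1[OF C] Q2[OF C] R z])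
          (use hyp C z in \<open>simp_all add: vanishes_on_def jacobi_morphism_def prolong_eq_evolutionary\<close>)
    qed
  next
    fix W \<gamma> C R
    assume hyp: "(\<forall>C\<in>fibered_charts F. vanishes_on (jet_domain C)
         (jacobi_morphism (\<Xi>1 C) (horizontalization (\<rho> C)))) \<and>
      (\<forall>C\<in>fibered_charts F. vanishes_on (jet_domain C)
         (jacobi_morphism (\<Xi>2 C) (horizontalization (\<rho> C))))"
      and crit: "critical_section F (\<lambda>C. horizontalization (\<rho> C)) W \<gamma>"
      and C: "C \<in> fibered_charts F" and R: "residual_operator (jet_domain C) R"
    interpret jet_region "jet_domain C" by (rule jet_region_jet_domain[OF C])
    show "vanishes_along C W \<gamma> (hor_deriv (noether_current R (\<Xi>2 C)
        (contract (prolong (\<Xi>1 C)) (euler_lagrange (horizontalization (\<rho> C))))))"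
      unfolding vanishes_along_def
    proof (intro ballI allI impI)
      fix x ws assume x: "x \<in> W" "\<gamma> x \<in> fst (fst C)"
      have \<gamma>: "local_section F W \<gamma>" using crit by (simp add: critical_section_def)
      note point = section_point[OF C \<gamma> x]
      define z where "z = jet_coord C \<gamma> x"
      have z: "z \<in> jet_domain C" using point(2) by (simp add: z_def)
      \<comment> \<open>Vanishing for every \<open>vs\<close> covers the tangent vectors of the
        prolonged section that the pull-back inserts.\<close>
      have "hor_deriv (noether_current R (\<Xi>2 C)
          (contract (prolong (\<Xi>1 C)) (euler_lagrange (horizontalization (\<rho> C))))) z vs = 0" for vs
        unfolding noether_current_evolutionary prolong_eq_evolutionary
      proof (rule noether_current_jacobi_field[OF \<mu>[OF C] sb[OF C] Q1[OF C] Q2[OF C] R z])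
        show "euler_coeff \<sigma> (horizontalization (\<rho> C)) z = 0" for \<sigma>
          using crit C x by (simp add: critical_section_def z_def)
      qed (use hyp C z in \<open>simp_all add: vanishes_on_def jacobi_morphism_def prolong_eq_evolutionary\<close>)
      then show "pullback_section C \<gamma> (hor_deriv (noether_current R (\<Xi>2 C)
          (contract (prolong (\<Xi>1 C)) (euler_lagrange (horizontalization (\<rho> C)))))) (snd (snd C) x) ws = 0"
        by (simp add: pullback_section_def Let_def point(1) z_def)
    qed
  qed
qed

end
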